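(* Let $(R,\mathfrak m)$ be a Noetherian local ring, $I$ an ideal of $R$, and $M,N$ finitely generated $R$-modules. Let $i$ be a positive integer or $i=+\infty$. Then $$\bigcup_{0\le j<i}\operatorname{Supp}(H^j_I(M,N))=\bigcup_{0\le j<i}\operatorname{Supp}(\operatorname{Ext}^j_R(M/IM,N)).$$
   Context: For an ideal $I$ and $j\ge 0$, the generalized local cohomology module is $H^j_I(M,N)=\varinjlim_n \operatorname{Ext}^j_R(M/I^nM,N)$. *)

theory Defs
  imports "HOL-Algebra.Algebra" "HOL-Library.FuncSet" "HOL-Library.Extended_Nat"
begin

section \<open>Local rings, generated submodules, quotients\<close>

locale local_ring = cring R + maximalideal \<mm> R for R (structure) and \<mm> +
  assumes maximal_unique: "maximalideal J R \<Longrightarrow> J = \<mm>"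

text \<open>
  The record type of modules extends that of rings; the locale \<^locale>\<open>module\<close> ignores the fields
  \<open>mult\<close> and \<open>one\<close>, which are therefore left unspecified.
\<close>

definition mk_module ::
    "'a set \<Rightarrow> 'a \<Rightarrow> ('a \<Rightarrow> 'a \<Rightarrow> 'a) \<Rightarrow> ('r \<Rightarrow> 'a \<Rightarrow> 'a) \<Rightarrow> ('r, 'a) module" where
  "mk_module C z p s =
     \<lparr>carrier = C, monoid.mult = undefined, one = undefined, ring.zero = z, add = p, smult = s\<rparr>"

lemma mk_module_simps [simp]:
  "carrier (mk_module C z p s) = C" "ring.zero (mk_module C z p s) = z"
  "add (mk_module C z p s) = p" "smult (mk_module C z p s) = s"
  by (simp_all add: mk_module_def)

definition submodule_span ::
    "('r, 'x) ring_scheme \<Rightarrow> ('r, 'm, 'y) module_scheme \<Rightarrow> 'm set \<Rightarrow> 'm set" where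
  "submodule_span R M S = \<Inter>{H. submodule H R M \<and> S \<subseteq> H}"

definition fin_gen_module :: "('r, 'x) ring_scheme \<Rightarrow> ('r, 'm, 'y) module_scheme \<Rightarrow> bool" where
  "fin_gen_module R M \<longleftrightarrow>
     (\<exists>S. finite S \<and> S \<subseteq> carrier M \<and> submodule_span R M S = carrier M)"

definition ideal_times_module ::
    "('r, 'x) ring_scheme \<Rightarrow> 'r set \<Rightarrow> ('r, 'm, 'y) module_scheme \<Rightarrow> 'm set" where
  "ideal_times_module R I M =
     submodule_span R M {a \<odot>\<^bsub>M\<^esub> x | a x. a \<in> I \<and> x \<in> carrier M}"

definition quot_module :: "('r, 'm, 'y) module_scheme \<Rightarrow> 'm set \<Rightarrow> ('r, 'm set) module" where
  "quot_module M H =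
     mk_module (a_rcosets\<^bsub>M\<^esub> H) H (set_add M) (\<lambda>r Z. \<Union>x\<in>Z. H +>\<^bsub>M\<^esub> (r \<odot>\<^bsub>M\<^esub> x))"

definition quot_proj :: "('r, 'm, 'y) module_scheme \<Rightarrow> 'm set \<Rightarrow> 'm set \<Rightarrow> 'm set" where
  \<comment> \<open>the projection from \<open>M/H'\<close> to \<open>M/H\<close>, for \<open>H'\<close> contained in \<open>H\<close>\<close>
  "quot_proj M H Z = (\<Union>x\<in>Z. H +>\<^bsub>M\<^esub> x)"


section \<open>Modules of homomorphisms\<close>

definition mod_hom ::
    "('r, 'x) ring_scheme \<Rightarrow> ('r, 'm, 'y) module_scheme \<Rightarrow> ('r, 'n, 'z) module_scheme
      \<Rightarrow> ('m \<Rightarrow> 'n) set" where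
  "mod_hom R M N =
     {f \<in> carrier M \<rightarrow>\<^sub>E carrier N.
        (\<forall>x\<in>carrier M. \<forall>y\<in>carrier M. f (x \<oplus>\<^bsub>M\<^esub> y) = f x \<oplus>\<^bsub>N\<^esub> f y) \<and>
        (\<forall>r\<in>carrier R. \<forall>x\<in>carrier M. f (r \<odot>\<^bsub>M\<^esub> x) = r \<odot>\<^bsub>N\<^esub> f x)}"

definition Hom_module ::
    "('r, 'x) ring_scheme \<Rightarrow> ('r, 'm, 'y) module_scheme \<Rightarrow> ('r, 'n, 'z) module_scheme
      \<Rightarrow> ('r, 'm \<Rightarrow> 'n) module" where
  "Hom_module R M N =
     mk_module (mod_hom R M N)
       (\<lambda>x\<in>carrier M. \<zero>\<^bsub>N\<^esub>)
       (\<lambda>f g. \<lambda>x\<in>carrier M. f x \<oplus>\<^bsub>N\<^esub> g x)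
       (\<lambda>r f. \<lambda>x\<in>carrier M. r \<odot>\<^bsub>N\<^esub> f x)"


section \<open>A functorial free resolution\<close>

text \<open>
  Every module \<open>A\<close> gets a free resolution \<open>\<dots> \<rightarrow> F\<^sub>1 \<rightarrow> F\<^sub>0 \<rightarrow> A\<close> whose terms, for all degrees, live in
  one type.  \<open>F\<^sub>0\<close> is free on the elements of \<open>A\<close>, and the basis of \<open>F\<^sub>k\<^sub>+\<^sub>1\<close> consists of all finite
  formal combinations \<open>l\<close> of basis elements of \<open>F\<^sub>k\<close> whose value is in the kernel of the preceding
  map; the differential sends the basis element \<open>l\<close> to its value.
  Keeping formal combinations (rather than the kernel elements themselves) makes the resolution
  strictly functorial in \<open>A\<close>, through \<open>map_gen\<close>.
\<close>

datatype (dead 'r, 'm) gen = Base 'm | Syz "('r \<times> ('r, 'm) gen) list"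
  for map: map_gen

definition free_module :: "('r, 'x) ring_scheme \<Rightarrow> 'b set \<Rightarrow> ('r, 'b \<Rightarrow> 'r) module" where
  "free_module R B =
     mk_module {z. (\<forall>b. z b \<in> carrier R) \<and> finite {b. z b \<noteq> \<zero>\<^bsub>R\<^esub>} \<and> {b. z b \<noteq> \<zero>\<^bsub>R\<^esub>} \<subseteq> B}
       (\<lambda>b. \<zero>\<^bsub>R\<^esub>) (\<lambda>z w b. z b \<oplus>\<^bsub>R\<^esub> w b) (\<lambda>r z b. r \<otimes>\<^bsub>R\<^esub> z b)"

primrec formal_sum :: "('r, 'x) ring_scheme \<Rightarrow> ('r \<times> 'b) list \<Rightarrow> 'b \<Rightarrow> 'r" where
  "formal_sum R [] = (\<lambda>b. \<zero>\<^bsub>R\<^esub>)"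
| "formal_sum R (p # l) =
     (\<lambda>b. if b = snd p then fst p \<oplus>\<^bsub>R\<^esub> formal_sum R l b else formal_sum R l b)"

definition res_aug ::
    "('r, 'x) ring_scheme \<Rightarrow> ('r, 'm, 'y) module_scheme \<Rightarrow> (('r, 'm) gen \<Rightarrow> 'r) \<Rightarrow> 'm" where
  "res_aug R A z = (\<Oplus>\<^bsub>A\<^esub>m\<in>{m. z (Base m) \<noteq> \<zero>\<^bsub>R\<^esub>}. z (Base m) \<odot>\<^bsub>A\<^esub> m)"

primrec res_d_gen :: "('r, 'x) ring_scheme \<Rightarrow> ('r, 'm) gen \<Rightarrow> ('r, 'm) gen \<Rightarrow> 'r" where
  "res_d_gen R (Base m) = (\<lambda>u. \<zero>\<^bsub>R\<^esub>)"
| "res_d_gen R (Syz l) = formal_sum R l"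

definition res_d ::
    "('r, 'x) ring_scheme \<Rightarrow> (('r, 'm) gen \<Rightarrow> 'r) \<Rightarrow> (('r, 'm) gen \<Rightarrow> 'r)" where
  "res_d R z = (\<lambda>v. \<Oplus>\<^bsub>R\<^esub>u\<in>{u. z u \<noteq> \<zero>\<^bsub>R\<^esub>}. z u \<otimes>\<^bsub>R\<^esub> res_d_gen R u v)"

definition res_vanishes ::
    "('r, 'x) ring_scheme \<Rightarrow> ('r, 'm, 'y) module_scheme \<Rightarrow> nat \<Rightarrow> (('r, 'm) gen \<Rightarrow> 'r) \<Rightarrow> bool" where
  "res_vanishes R A k z \<longleftrightarrow>
     (case k of 0 \<Rightarrow> res_aug R A z = \<zero>\<^bsub>A\<^esub> | Suc _ \<Rightarrow> res_d R z = (\<lambda>u. \<zero>\<^bsub>R\<^esub>))"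

primrec res_gens ::
    "('r, 'x) ring_scheme \<Rightarrow> ('r, 'm, 'y) module_scheme \<Rightarrow> nat \<Rightarrow> ('r, 'm) gen set" where
  "res_gens R A 0 = Base ` carrier A"
| "res_gens R A (Suc k) =
     {Syz l | l. set l \<subseteq> carrier R \<times> res_gens R A k \<and> res_vanishes R A k (formal_sum R l)}"

definition free_res ::
    "('r, 'x) ring_scheme \<Rightarrow> ('r, 'm, 'y) module_scheme \<Rightarrow> nat \<Rightarrow> ('r, ('r, 'm) gen \<Rightarrow> 'r) module"
  where "free_res R A k = free_module R (res_gens R A k)"

definition res_map ::
    "('r, 'x) ring_scheme \<Rightarrow> ('m \<Rightarrow> 'm') \<Rightarrow> (('r, 'm) gen \<Rightarrow> 'r) \<Rightarrow> (('r, 'm') gen \<Rightarrow> 'r)" where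
  \<comment> \<open>the chain map induced by \<open>h\<close>: the linear extension of \<open>map_gen h\<close>\<close>
  "res_map R h z = (\<lambda>v. \<Oplus>\<^bsub>R\<^esub>u\<in>{u. z u \<noteq> \<zero>\<^bsub>R\<^esub> \<and> map_gen h u = v}. z u)"


subsection \<open>Exactness\<close>

text \<open>
  The two theorems below say that \<open>free_res R M\<close>, augmented by \<open>res_aug\<close>, is a resolution of \<open>M\<close>.
\<close>

lemma free_carrier_iff:
  "z \<in> carrier (free_module R B) \<longleftrightarrow>
     (\<forall>b. z b \<in> carrier R) \<and> finite {b. z b \<noteq> \<zero>\<^bsub>R\<^esub>} \<and> {b. z b \<noteq> \<zero>\<^bsub>R\<^esub>} \<subseteq> B"
  by (simp add: free_module_def)

context cring
begin

lemma formal_sum_free: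
  assumes "set l \<subseteq> carrier R \<times> B"
  shows "formal_sum R l \<in> carrier (free_module R B)"
  using assms
proof (induction l)
  case Nil
  then show ?case by (simp add: free_carrier_iff)
next
  case (Cons p l)
  have f: "formal_sum R l \<in> carrier (free_module R B)" using Cons by simp
  have "{b. formal_sum R (p # l) b \<noteq> \<zero>} \<subseteq> insert (snd p) {b. formal_sum R l b \<noteq> \<zero>}" by auto
  moreover have "finite (insert (snd p) {b. formal_sum R l b \<noteq> \<zero>})"
    using f by (simp add: free_carrier_iff)
  ultimately have "finite {b. formal_sum R (p # l) b \<noteq> \<zero>}" by (rule finite_subset)
  with f Cons.prems show ?case by (auto simp: free_carrier_iff)
qed

lemma formal_sum_surj:
  assumes "z \<in> carrier (free_module R B)"
  shows "\<exists>l. set l \<subseteq> carrier R \<times> B \<and> formal_sum R l = z"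
proof -
  have z: "\<And>b. z b \<in> carrier R" "finite {b. z b \<noteq> \<zero>}" "{b. z b \<noteq> \<zero>} \<subseteq> B"
    using assms by (auto simp: free_carrier_iff)
  obtain xs where xs: "set xs = {b. z b \<noteq> \<zero>}" "distinct xs"
    using finite_distinct_list[OF z(2)] by blast
  define l where "l = map (\<lambda>b. (z b, b)) xs"
  have "formal_sum R (map (\<lambda>b. (z b, b)) ys) = (\<lambda>b. if b \<in> set ys then z b else \<zero>)"
    if "distinct ys" for ys
    using that by (induction ys) (auto simp: fun_eq_iff z)
  then have "formal_sum R l = z" using xs by (auto simp: l_def fun_eq_iff)
  moreover have "set l \<subseteq> carrier R \<times> B" using z xs by (auto simp: l_def)
  ultimately show ?thesis by blast
qed

lemma res_gens_d:
  assumes "u \<in> res_gens R A k"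
  shows "res_d_gen R u v \<in> carrier R"
proof (cases k)
  case 0
  then show ?thesis using assms by auto
next
  case (Suc j)
  then obtain l where l: "u = Syz l" "set l \<subseteq> carrier R \<times> res_gens R A j" using assms by auto
  show ?thesis using formal_sum_free[OF l(2)] by (simp add: l free_carrier_iff)
qed

lemma finsum_free_support:
  assumes "finite S" "{u. z u \<noteq> \<zero>} \<subseteq> S" "\<And>u. z u \<in> carrier R" "\<And>u. u \<in> S \<Longrightarrow> g u \<in> carrier R"
  shows "(\<Oplus>u\<in>{u. z u \<noteq> \<zero>}. z u \<otimes> g u) = (\<Oplus>u\<in>S. z u \<otimes> g u)"
  by (rule add.finprod_mono_neutral_cong_left) (use assms in auto)

lemma res_d_formal_sum_Cons:
  assumes "set (p # l) \<subseteq> carrier R \<times> res_gens R A k"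
  shows "res_d R (formal_sum R (p # l)) v =
    fst p \<otimes> res_d_gen R (snd p) v \<oplus> res_d R (formal_sum R l) v"
proof -
  let ?f = "formal_sum R l" and ?g = "formal_sum R (p # l)"
  let ?d = "\<lambda>u. res_d_gen R u v"
  let ?S = "insert (snd p) {u. ?f u \<noteq> \<zero>}"
  have f: "?f \<in> carrier (free_module R (res_gens R A k))" using assms by (intro formal_sum_free) auto
  have g: "?g \<in> carrier (free_module R (res_gens R A k))" using assms by (intro formal_sum_free) auto
  have fin: "finite ?S" using f by (simp add: free_carrier_iff)
  have p: "fst p \<in> carrier R" "snd p \<in> res_gens R A k" using assms by auto
  have d: "u \<in> ?S \<Longrightarrow> ?d u \<in> carrier R" for u
    using f p res_gens_d by (auto simp: free_carrier_iff subset_iff)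
  have fc: "?f u \<in> carrier R" for u using f by (simp add: free_carrier_iff)
  have gc: "?g u \<in> carrier R" for u using g by (simp add: free_carrier_iff)
  have "res_d R ?g v = (\<Oplus>u\<in>?S. ?g u \<otimes> ?d u)"
    unfolding res_d_def by (rule finsum_free_support[OF fin _ gc d]) auto
  also have "\<dots> = (\<Oplus>u\<in>?S. (if snd p = u then fst p \<otimes> ?d u else \<zero>) \<oplus> ?f u \<otimes> ?d u)"
    by (rule add.finprod_cong) (use p d fc in \<open>auto simp: l_distr simp_implies_def\<close>)
  also have "\<dots> = (\<Oplus>u\<in>?S. (if snd p = u then fst p \<otimes> ?d u else \<zero>)) \<oplus> (\<Oplus>u\<in>?S. ?f u \<otimes> ?d u)"
    by (rule add.finprod_multf) (use p d fc in auto)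
  also have "(\<Oplus>u\<in>?S. (if snd p = u then fst p \<otimes> ?d u else \<zero>)) = fst p \<otimes> ?d (snd p)"
    by (rule add.finprod_singleton) (use p d fin in auto)
  also have "(\<Oplus>u\<in>?S. ?f u \<otimes> ?d u) = res_d R ?f v"
    unfolding res_d_def by (rule finsum_free_support[OF fin _ fc d, symmetric]) auto
  finally show ?thesis .
qed

lemma res_d_zero: "res_d R (\<lambda>u. \<zero>) = (\<lambda>v. \<zero>)"
  by (simp add: res_d_def)

lemma res_d_basis:
  assumes "u \<in> res_gens R A k"
  shows "res_d R (formal_sum R [(\<one>, u)]) = res_d_gen R u"
  using res_d_formal_sum_Cons[of "(\<one>, u)" "[]" A k] assms res_gens_d[OF assms]
  by (auto simp: res_d_zero)

end

context module
begin

lemma res_aug_support: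
  assumes "finite S" "{u. z (Base u) \<noteq> \<zero>} \<subseteq> S" "\<And>u. z u \<in> carrier R" "S \<subseteq> carrier M"
  shows "res_aug R M z = (\<Oplus>\<^bsub>M\<^esub>u\<in>S. z (Base u) \<odot>\<^bsub>M\<^esub> u)"
  unfolding res_aug_def
  by (rule M.add.finprod_mono_neutral_cong_left) (use assms in \<open>auto simp: subset_iff\<close>)

lemma res_aug_formal_sum_Cons:
  assumes "r \<in> carrier R" "m \<in> carrier M" "set l \<subseteq> carrier R \<times> Base ` carrier M"
  shows "res_aug R M (formal_sum R ((r, Base m) # l)) = r \<odot>\<^bsub>M\<^esub> m \<oplus>\<^bsub>M\<^esub> res_aug R M (formal_sum R l)"
proof -
  let ?f = "formal_sum R l" and ?g = "formal_sum R ((r, Base m) # l)"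
  let ?S = "insert m {u. ?f (Base u) \<noteq> \<zero>}"
  have f: "?f \<in> carrier (free_module R (Base ` carrier M))" using assms by (intro formal_sum_free) auto
  have g: "?g \<in> carrier (free_module R (Base ` carrier M))" using assms by (intro formal_sum_free) auto
  have "finite (Base -` {b. ?f b \<noteq> \<zero>})"
    using f by (intro finite_vimageI) (auto simp: free_carrier_iff inj_def)
  then have fin: "finite ?S" by (simp add: vimage_def)
  have S: "?S \<subseteq> carrier M" using f assms(2) by (auto simp: free_carrier_iff subset_iff)
  have fc: "?f u \<in> carrier R" for u using f by (simp add: free_carrier_iff)
  have gc: "?g u \<in> carrier R" for u using g by (simp add: free_carrier_iff)
  have "res_aug R M ?g = (\<Oplus>\<^bsub>M\<^esub>u\<in>?S. ?g (Base u) \<odot>\<^bsub>M\<^esub> u)"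
    by (rule res_aug_support[OF fin _ gc S]) auto
  also have "\<dots> = (\<Oplus>\<^bsub>M\<^esub>u\<in>?S. (if m = u then r \<odot>\<^bsub>M\<^esub> u else \<zero>\<^bsub>M\<^esub>) \<oplus>\<^bsub>M\<^esub> ?f (Base u) \<odot>\<^bsub>M\<^esub> u)"
    by (rule M.add.finprod_cong) (use assms S fc in \<open>auto simp: smult_l_distr simp_implies_def\<close>)
  also have "\<dots> = (\<Oplus>\<^bsub>M\<^esub>u\<in>?S. (if m = u then r \<odot>\<^bsub>M\<^esub> u else \<zero>\<^bsub>M\<^esub>)) \<oplus>\<^bsub>M\<^esub> (\<Oplus>\<^bsub>M\<^esub>u\<in>?S. ?f (Base u) \<odot>\<^bsub>M\<^esub> u)"
    by (rule M.add.finprod_multf) (use assms S fc in auto)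
  also have "(\<Oplus>\<^bsub>M\<^esub>u\<in>?S. (if m = u then r \<odot>\<^bsub>M\<^esub> u else \<zero>\<^bsub>M\<^esub>)) = r \<odot>\<^bsub>M\<^esub> m"
    by (rule M.add.finprod_singleton) (use assms S fin in auto)
  also have "(\<Oplus>\<^bsub>M\<^esub>u\<in>?S. ?f (Base u) \<odot>\<^bsub>M\<^esub> u) = res_aug R M ?f"
    by (rule res_aug_support[OF fin _ fc S, symmetric]) auto
  finally show ?thesis .
qed

lemma res_aug_zero: "res_aug R M (\<lambda>u. \<zero>) = \<zero>\<^bsub>M\<^esub>"
  by (simp add: res_aug_def)

lemma res_aug_closed:
  assumes "set l \<subseteq> carrier R \<times> Base ` carrier M"
  shows "res_aug R M (formal_sum R l) \<in> carrier M"
  using assms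
proof (induction l)
  case Nil
  then show ?case by (simp add: res_aug_zero)
next
  case (Cons p l)
  then obtain r m where "p = (r, Base m)" "r \<in> carrier R" "m \<in> carrier M" by auto
  with Cons show ?case using res_aug_formal_sum_Cons[of r m l] by simp
qed

theorem res_aug_surj: "res_aug R M ` carrier (free_res R M 0) = carrier M"
proof (intro equalityI subsetI)
  fix x assume "x \<in> res_aug R M ` carrier (free_res R M 0)"
  then show "x \<in> carrier M"
    unfolding free_res_def using formal_sum_surj[of _ "res_gens R M 0"] res_aug_closed by fastforce
next
  fix x assume x: "x \<in> carrier M"
  then have "res_aug R M (formal_sum R [(\<one>, Base x)]) = x"
    using res_aug_formal_sum_Cons[of \<one> x "[]"] by (simp add: res_aug_zero)
  moreover have "formal_sum R [(\<one>, Base x)] \<in> carrier (free_res R M 0)"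
    unfolding free_res_def using x by (intro formal_sum_free) auto
  ultimately show "x \<in> res_aug R M ` carrier (free_res R M 0)" by (metis imageI)
qed

lemma res_d_closed:
  assumes "set l \<subseteq> carrier R \<times> res_gens R M (Suc k)"
  shows "res_d R (formal_sum R l) \<in> carrier (free_res R M k) \<and> res_vanishes R M k (res_d R (formal_sum R l))"
  using assms
proof (induction l)
  case Nil
  then show ?case
    by (auto simp: res_d_zero free_res_def free_carrier_iff res_vanishes_def res_aug_zero split: nat.split)
next
  case (Cons p l)
  let ?B = "res_gens R M k"
  obtain r l1 where p: "p = (r, Syz l1)" "r \<in> carrier R" "set l1 \<subseteq> carrier R \<times> ?B"
      "res_vanishes R M k (formal_sum R l1)"
    using Cons.prems by auto
  have IH: "res_d R (formal_sum R l) \<in> carrier (free_module R ?B)"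
      "res_vanishes R M k (res_d R (formal_sum R l))"
    using Cons by (auto simp: free_res_def)
  obtain l2 where l2: "set l2 \<subseteq> carrier R \<times> ?B" "formal_sum R l2 = res_d R (formal_sum R l)"
    using formal_sum_surj[OF IH(1)] by blast
  let ?l3 = "map (\<lambda>q. (r \<otimes> fst q, snd q)) l1 @ l2"
  have l3: "set ?l3 \<subseteq> carrier R \<times> ?B" using p l2 by auto
  have app: "formal_sum R (map (\<lambda>q. (r \<otimes> fst q, snd q)) ys @ l2) v = r \<otimes> formal_sum R ys v \<oplus> formal_sum R l2 v"
    if "set ys \<subseteq> carrier R \<times> ?B" for ys v
    using that
  proof (induction ys)
    case Nil
    then show ?case using p formal_sum_free[OF l2(1)] by (simp add: free_carrier_iff)
  next
    case (Cons a ys)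
    have "formal_sum R ys v \<in> carrier R" "formal_sum R l2 v \<in> carrier R"
      using formal_sum_free[OF l2(1)] formal_sum_free[of ys ?B] Cons.prems
      by (auto simp: free_carrier_iff)
    with Cons p show ?case by (auto simp: r_distr R.a_assoc)
  qed
  have eq: "res_d R (formal_sum R (p # l)) = formal_sum R ?l3"
    using res_d_formal_sum_Cons[OF Cons.prems] app[OF p(3)] l2(2) by (auto simp: p fun_eq_iff)
  have "res_vanishes R M k (formal_sum R ?l3)"
  proof (cases k)
    case 0
    have "res_aug R M (formal_sum R (map (\<lambda>q. (r \<otimes> fst q, snd q)) ys @ l2)) =
        r \<odot>\<^bsub>M\<^esub> res_aug R M (formal_sum R ys)" if "set ys \<subseteq> carrier R \<times> ?B" for ys
      using that
    proof (induction ys)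
      case Nil
      then show ?case using IH p l2 0 by (simp add: res_vanishes_def res_aug_zero)
    next
      case (Cons a ys)
      obtain s m where a: "a = (s, Base m)" "s \<in> carrier R" "m \<in> carrier M" using Cons.prems 0 by auto
      have "set (map (\<lambda>q. (r \<otimes> fst q, snd q)) ys @ l2) \<subseteq> carrier R \<times> Base ` carrier M"
        using Cons.prems p l2 0 by auto
      moreover have ys: "set ys \<subseteq> carrier R \<times> Base ` carrier M" using Cons.prems 0 by auto
      ultimately show ?case
        using Cons a p res_aug_closed[OF ys]
          res_aug_formal_sum_Cons[of s m ys] res_aug_formal_sum_Cons[of "r \<otimes> s" m "map (\<lambda>q. (r \<otimes> fst q, snd q)) ys @ l2"]
        by (simp add: smult_r_distr smult_assoc1 del: formal_sum.simps)
    qed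
    from this[OF p(3)] p(2,4) 0 show ?thesis by (simp add: res_vanishes_def)
  next
    case (Suc j)
    have "res_d R (formal_sum R (map (\<lambda>q. (r \<otimes> fst q, snd q)) ys @ l2)) v =
        r \<otimes> res_d R (formal_sum R ys) v \<and> res_d R (formal_sum R ys) v \<in> carrier R"
      if "set ys \<subseteq> carrier R \<times> ?B" for ys v
      using that
    proof (induction ys)
      case Nil
      then show ?case using IH p l2 Suc by (simp add: res_vanishes_def res_d_zero)
    next
      case (Cons a ys)
      let ?a' = "(r \<otimes> fst a, snd a)"
      have 1: "set (?a' # map (\<lambda>q. (r \<otimes> fst q, snd q)) ys @ l2) \<subseteq> carrier R \<times> ?B"
        using Cons.prems p(2) l2(1) by auto
      have "res_d_gen R (snd a) v \<in> carrier R" using Cons.prems by (intro res_gens_d[of _ M k]) auto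
      then show ?case
        using Cons p res_d_formal_sum_Cons[OF 1, of v] res_d_formal_sum_Cons[OF Cons.prems, of v]
        by (auto simp: r_distr R.m_assoc simp del: formal_sum.simps)
    qed
    from this[OF p(3)] p(2,4) Suc show ?thesis by (simp add: res_vanishes_def fun_eq_iff)
  qed
  then show ?case using eq formal_sum_free[OF l3] by (simp add: free_res_def)
qed

theorem res_exact:
  "res_d R ` carrier (free_res R M (Suc k)) = {z \<in> carrier (free_res R M k). res_vanishes R M k z}"
proof (intro equalityI subsetI)
  fix z assume "z \<in> res_d R ` carrier (free_res R M (Suc k))"
  then obtain l where "set l \<subseteq> carrier R \<times> res_gens R M (Suc k)" "z = res_d R (formal_sum R l)"
    unfolding free_res_def using formal_sum_surj by blast
  then show "z \<in> {z \<in> carrier (free_res R M k). res_vanishes R M k z}" using res_d_closed by simp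
next
  fix z assume z: "z \<in> {z \<in> carrier (free_res R M k). res_vanishes R M k z}"
  then obtain l where l: "set l \<subseteq> carrier R \<times> res_gens R M k" "formal_sum R l = z"
    unfolding free_res_def using formal_sum_surj by blast
  have u: "Syz l \<in> res_gens R M (Suc k)" using l z by auto
  have "res_d R (formal_sum R [(\<one>, Syz l)]) = z" using res_d_basis[OF u] l by simp
  moreover have "formal_sum R [(\<one>, Syz l)] \<in> carrier (free_res R M (Suc k))"
    unfolding free_res_def using u by (intro formal_sum_free) auto
  ultimately show "z \<in> res_d R ` carrier (free_res R M (Suc k))" by (metis imageI)
qed

end


section \<open>Ext\<close>

text \<open>
  \<open>Ext\<^sup>j(A, N)\<close> is the cohomology in degree \<open>j\<close> of the complex \<open>Hom(F\<^sub>\<bullet>, N)\<close>, where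
  \<open>F\<^sub>\<bullet>\<close> is the above free resolution of \<open>A\<close>; it is contravariant in \<open>A\<close>.
\<close>

definition Ext_cocycles ::
    "('r, 'x) ring_scheme \<Rightarrow> ('r, 'm, 'y) module_scheme \<Rightarrow> ('r, 'n, 'z) module_scheme \<Rightarrow> nat
      \<Rightarrow> ((('r, 'm) gen \<Rightarrow> 'r) \<Rightarrow> 'n) set" where
  "Ext_cocycles R A N j =
     {f \<in> mod_hom R (free_res R A j) N.
        \<forall>z\<in>carrier (free_res R A (Suc j)). f (res_d R z) = \<zero>\<^bsub>N\<^esub>}"

primrec Ext_coboundaries ::
    "('r, 'x) ring_scheme \<Rightarrow> ('r, 'm, 'y) module_scheme \<Rightarrow> ('r, 'n, 'z) module_scheme \<Rightarrow> nat
      \<Rightarrow> ((('r, 'm) gen \<Rightarrow> 'r) \<Rightarrow> 'n) set" where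
  "Ext_coboundaries R A N 0 = {\<zero>\<^bsub>Hom_module R (free_res R A 0) N\<^esub>}"
| "Ext_coboundaries R A N (Suc j) =
     (\<lambda>f. \<lambda>z\<in>carrier (free_res R A (Suc j)). f (res_d R z)) ` mod_hom R (free_res R A j) N"

definition Ext ::
    "('r, 'x) ring_scheme \<Rightarrow> ('r, 'm, 'y) module_scheme \<Rightarrow> ('r, 'n, 'z) module_scheme \<Rightarrow> nat
      \<Rightarrow> ('r, ((('r, 'm) gen \<Rightarrow> 'r) \<Rightarrow> 'n) set) module" where
  "Ext R A N j =
     quot_module ((Hom_module R (free_res R A j) N)\<lparr>carrier := Ext_cocycles R A N j\<rparr>)
       (Ext_coboundaries R A N j)"

definition Ext_map ::
    "('r, 'x) ring_scheme \<Rightarrow> ('r, 'm, 'y) module_scheme \<Rightarrow> ('m \<Rightarrow> 'm')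
      \<Rightarrow> ('r, 'n, 'z) module_scheme \<Rightarrow> nat
      \<Rightarrow> ((('r, 'm') gen \<Rightarrow> 'r) \<Rightarrow> 'n) set \<Rightarrow> ((('r, 'm) gen \<Rightarrow> 'r) \<Rightarrow> 'n) set" where
  \<comment> \<open>the map \<open>Ext\<^sup>j(B, N) \<rightarrow> Ext\<^sup>j(A, N)\<close> induced by \<open>h : A \<rightarrow> B\<close>\<close>
  "Ext_map R A h N j Z =
     (\<Union>f\<in>Z. Ext_coboundaries R A N j +>\<^bsub>Hom_module R (free_res R A j) N\<^esub>
        (\<lambda>z\<in>carrier (free_res R A j). f (res_map R h z)))"


section \<open>Direct limits of sequences and generalized local cohomology\<close>

definition dirlim_rel ::
    "(nat \<Rightarrow> ('r, 'a, 'y) module_scheme) \<Rightarrow> (nat \<Rightarrow> nat \<Rightarrow> 'a \<Rightarrow> 'a) \<Rightarrow> ((nat \<times> 'a) \<times> (nat \<times> 'a)) set"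
  where
  \<comment> \<open>the transition map \<open>\<phi> n k\<close> goes from \<open>Z n\<close> to \<open>Z k\<close>, for \<open>n \<le> k\<close>\<close>
  "dirlim_rel Z \<phi> =
     {((n, x), (m, y)). x \<in> carrier (Z n) \<and> y \<in> carrier (Z m) \<and>
        (\<exists>k. n \<le> k \<and> m \<le> k \<and> \<phi> n k x = \<phi> m k y)}"

definition dirlim ::
    "(nat \<Rightarrow> ('r, 'a, 'y) module_scheme) \<Rightarrow> (nat \<Rightarrow> nat \<Rightarrow> 'a \<Rightarrow> 'a) \<Rightarrow> ('r, (nat \<times> 'a) set) module"
  where
  "dirlim Z \<phi> =
     mk_module ((SIGMA n:UNIV. carrier (Z n)) // dirlim_rel Z \<phi>)
       (dirlim_rel Z \<phi> `` {(0, \<zero>\<^bsub>Z 0\<^esub>)})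
       (\<lambda>C D. \<Union>(n, x)\<in>C. \<Union>(m, y)\<in>D.
          dirlim_rel Z \<phi> `` {(max n m, \<phi> n (max n m) x \<oplus>\<^bsub>Z (max n m)\<^esub> \<phi> m (max n m) y)})
       (\<lambda>r C. \<Union>(n, x)\<in>C. dirlim_rel Z \<phi> `` {(n, r \<odot>\<^bsub>Z n\<^esub> x)})"

definition power_quot ::
    "('r, 'x) ring_scheme \<Rightarrow> 'r set \<Rightarrow> ('r, 'm, 'y) module_scheme \<Rightarrow> nat \<Rightarrow> ('r, 'm set) module" where
  "power_quot R I M n = quot_module M (ideal_times_module R (I [^]\<^bsub>ideals_set R\<^esub> n) M)"

definition gen_local_cohomology ::
    "('r, 'x) ring_scheme \<Rightarrow> 'r set \<Rightarrow> ('r, 'm, 'y) module_scheme \<Rightarrow> ('r, 'n, 'z) module_scheme \<Rightarrow> nat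
      \<Rightarrow> ('r, (nat \<times> ((('r, 'm set) gen \<Rightarrow> 'r) \<Rightarrow> 'n) set) set) module" where
  "gen_local_cohomology R I M N j =
     dirlim (\<lambda>n. Ext R (power_quot R I M n) N j)
       (\<lambda>n k. Ext_map R (power_quot R I M k)
                 (quot_proj M (ideal_times_module R (I [^]\<^bsub>ideals_set R\<^esub> n) M)) N j)"


section \<open>Localization and support\<close>

definition frac_rel ::
    "('r, 'x) ring_scheme \<Rightarrow> 'r set \<Rightarrow> ('r, 'm, 'y) module_scheme \<Rightarrow> (('m \<times> 'r) \<times> ('m \<times> 'r)) set"
  where
  "frac_rel R S M =
     {((x, s), (y, t)). x \<in> carrier M \<and> s \<in> S \<and> y \<in> carrier M \<and> t \<in> S \<and>
        (\<exists>u\<in>S. u \<odot>\<^bsub>M\<^esub> (t \<odot>\<^bsub>M\<^esub> x \<ominus>\<^bsub>M\<^esub> s \<odot>\<^bsub>M\<^esub> y) = \<zero>\<^bsub>M\<^esub>)}"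

definition loc_module ::
    "('r, 'x) ring_scheme \<Rightarrow> 'r set \<Rightarrow> ('r, 'm, 'y) module_scheme \<Rightarrow> ('r, ('m \<times> 'r) set) module" where
  \<comment> \<open>\<open>S\<^sup>-\<^sup>1M\<close> for a multiplicative set \<open>S\<close>, with scalars restricted along \<open>R \<rightarrow> S\<^sup>-\<^sup>1R\<close>\<close>
  "loc_module R S M =
     mk_module ((carrier M \<times> S) // frac_rel R S M)
       (frac_rel R S M `` {(\<zero>\<^bsub>M\<^esub>, \<one>\<^bsub>R\<^esub>)})
       (\<lambda>C D. \<Union>(x, s)\<in>C. \<Union>(y, t)\<in>D.
          frac_rel R S M `` {(t \<odot>\<^bsub>M\<^esub> x \<oplus>\<^bsub>M\<^esub> s \<odot>\<^bsub>M\<^esub> y, s \<otimes>\<^bsub>R\<^esub> t)})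
       (\<lambda>r C. \<Union>(x, s)\<in>C. frac_rel R S M `` {(r \<odot>\<^bsub>M\<^esub> x, s)})"

definition Supp :: "('r, 'x) ring_scheme \<Rightarrow> ('r, 'm, 'y) module_scheme \<Rightarrow> 'r set set" where
  "Supp R M =
     {\<pp>. primeideal \<pp> R \<and>
         carrier (loc_module R (carrier R - \<pp>) M) \<noteq> {\<zero>\<^bsub>loc_module R (carrier R - \<pp>) M\<^esub>}}"

end

theory Submission
  imports Defs
begin

text \<open>
  Fix a prime \<open>\<pp>\<close> and call a module torsion if each of its elements is killed by some \<open>s \<notin> \<pp>\<close>.
  All arguments on Ext run up to torsion modules, so nothing is ever localized.

  Let \<open>A\<close> be finitely generated with \<open>Ext\<^sup>j(A, N)\<close> torsion for all \<open>j < t\<close>.  Then the same holds for every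
  finitely generated \<open>L\<close> killed by the annihilator of \<open>A\<close>.  By induction on \<open>t\<close>, the functor
  \<open>Ext\<^sup>t(-, N)\<close> is left exact up to torsion on such modules; filtering \<open>L\<close>, it suffices to treat
  \<open>R/J\<close>.  A maximal counterexample \<open>J\<close> is prime, hence there is a nonzero map \<open>A \<rightarrow> R/J\<close>; its image and its
  cokernel are harmless, and so is \<open>R/J\<close>.  This gives both inclusions: it applies to the factors
  of the \<open>I\<close>-adic filtration of \<open>M\<close>, and it makes \<open>Ext\<^sup>t(M/IM, N) \<rightarrow> H\<^sup>t\<^sub>I(M, N)\<close> injective up to torsion
  as soon as the lower \<open>Ext\<^sup>j(M/IM, N)\<close> are torsion.

  The long exact sequence of a surjection \<open>A \<rightarrow> B\<close> with kernel \<open>K\<close> is obtained from the cone of the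
  map of resolutions, whose only homology is \<open>K\<close> in degree one: up to a shift it is homotopy
  equivalent to the resolution of \<open>K\<close>.
\<close>

section \<open>Linear maps\<close>

text \<open>The functorial resolutions force the detour through the cone. Even for a surjection A ->
  B the induced map of resolutions need not be onto: a formal combination whose value vanishes in B
  may lift only to one whose value lies in the kernel. So a short exact sequence of modules gives no
  short exact sequence of resolutions, whereas the cone needs only the chain map. The nonzero map A
  -> R/J exists because J is prime and contains the annihilator of A: modulo the span of the others,
  a generator of A either generates some R/J' with J' inside J, or is killed by some s outside J.
  The kernel of the map is killed by the annihilator of A as well, so the induction covers it in the
  lower degrees, and exactness gives the top degree for the image. The cokernel is R/J' with J'
  strictly larger than J, hence no counterexample. J is prime because, for a b in J with a and b
  outside J, the submodule of R/J generated by the class of a is R/(J : a), with quotient R/(J +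
  (a)). Both ideals are strictly larger than J, so R/J, being an extension, would be no
  counterexample.\<close>

definition lin ::
    "('r, 'x) ring_scheme \<Rightarrow> ('r, 'a, 'y) module_scheme \<Rightarrow> ('r, 'b, 'z) module_scheme
      \<Rightarrow> ('a \<Rightarrow> 'b) \<Rightarrow> bool" where
  "lin R U V f \<longleftrightarrow> (\<forall>x\<in>carrier U. f x \<in> carrier V) \<and>
     (\<forall>x\<in>carrier U. \<forall>y\<in>carrier U. f (x \<oplus>\<^bsub>U\<^esub> y) = f x \<oplus>\<^bsub>V\<^esub> f y) \<and>
     (\<forall>r\<in>carrier R. \<forall>x\<in>carrier U. f (r \<odot>\<^bsub>U\<^esub> x) = r \<odot>\<^bsub>V\<^esub> f x)"

abbreviation submod :: "('r, 'a, 'y) module_scheme \<Rightarrow> 'a set \<Rightarrow> ('r, 'a, 'y) module_scheme" where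
  "submod A H \<equiv> A\<lparr>carrier := H\<rparr>"

lemma linI:
  assumes "\<And>x. x \<in> carrier U \<Longrightarrow> f x \<in> carrier V"
    and "\<And>x y. x \<in> carrier U \<Longrightarrow> y \<in> carrier U \<Longrightarrow> f (x \<oplus>\<^bsub>U\<^esub> y) = f x \<oplus>\<^bsub>V\<^esub> f y"
    and "\<And>r x. r \<in> carrier R \<Longrightarrow> x \<in> carrier U \<Longrightarrow> f (r \<odot>\<^bsub>U\<^esub> x) = r \<odot>\<^bsub>V\<^esub> f x"
  shows "lin R U V f"
  using assms by (auto simp: lin_def)

lemma lin_closed: "lin R U V f \<Longrightarrow> x \<in> carrier U \<Longrightarrow> f x \<in> carrier V"
  and lin_add: "lin R U V f \<Longrightarrow> x \<in> carrier U \<Longrightarrow> y \<in> carrier U \<Longrightarrow> f (x \<oplus>\<^bsub>U\<^esub> y) = f x \<oplus>\<^bsub>V\<^esub> f y"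
  and lin_smult: "lin R U V f \<Longrightarrow> r \<in> carrier R \<Longrightarrow> x \<in> carrier U \<Longrightarrow> f (r \<odot>\<^bsub>U\<^esub> x) = r \<odot>\<^bsub>V\<^esub> f x"
  by (auto simp: lin_def)

lemma lin_comp: "lin R U V f \<Longrightarrow> lin R V W g \<Longrightarrow> lin R U W (\<lambda>x. g (f x))"
  by (auto simp: lin_def Pi_iff)

text \<open>Serves \<open>Ext_map_lin\<close>: a map given on cosets is checked on cocycles, where
  it has a formula.\<close>

lemma lin_factor:
  assumes q: "lin R W U q" "carrier U \<subseteq> q ` carrier W" and f: "lin R W V (\<lambda>x. f (q x))"
    and W: "module R W"
  shows "lin R U V f"
proof (rule linI)
  interpret W: module R W by fact
  fix u assume "u \<in> carrier U"
  then obtain w where w: "w \<in> carrier W" "u = q w" using q(2) by blast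
  show "f u \<in> carrier V" using lin_closed[OF f] w by simp
  show "f (r \<odot>\<^bsub>U\<^esub> u) = r \<odot>\<^bsub>V\<^esub> f u" if "r \<in> carrier R" for r
    using lin_smult[OF f that w(1)] lin_smult[OF q(1) that w(1)] w(2) by simp
  fix v assume "v \<in> carrier U"
  then obtain z where z: "z \<in> carrier W" "v = q z" using q(2) by blast
  show "f (u \<oplus>\<^bsub>U\<^esub> v) = f u \<oplus>\<^bsub>V\<^esub> f v"
    using lin_add[OF f w(1) z(1)] lin_add[OF q(1) w(1) z(1)] w(2) z(2) by simp
qed

lemma lin_id: "lin R U U (\<lambda>x. x)"
  by (auto simp: lin_def)

lemma lin_cong:
  assumes "module R U" "\<And>x. x \<in> carrier U \<Longrightarrow> f x = g x"
  shows "lin R U V f = lin R U V g"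
proof -
  interpret U: module R U by fact
  show ?thesis using assms(2) by (auto simp: lin_def Pi_iff)
qed

text \<open>\<open>lin\<close> drops the extensionality built into \<open>mod_hom\<close>, so
  composites and pointwise sums stay linear without being cut off outside the carrier. This is the
  link back to the modules of homomorphisms.\<close>

lemma mod_hom_iff: "f \<in> mod_hom R U V \<longleftrightarrow> lin R U V f \<and> f \<in> extensional (carrier U)"
  by (auto simp: mod_hom_def lin_def PiE_def)

lemma lin_restrict: "module R U \<Longrightarrow> lin R U V (restrict f (carrier U)) = lin R U V f"
  by (rule lin_cong) auto

lemma lin_zero:
  assumes "module R U" "module R V" "lin R U V f"
  shows "f \<zero>\<^bsub>U\<^esub> = \<zero>\<^bsub>V\<^esub>"
proof -
  interpret U: module R U by fact
  interpret V: module R V by fact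
  have "f (\<zero>\<^bsub>R\<^esub> \<odot>\<^bsub>U\<^esub> \<zero>\<^bsub>U\<^esub>) = \<zero>\<^bsub>R\<^esub> \<odot>\<^bsub>V\<^esub> f \<zero>\<^bsub>U\<^esub>"
    using assms(3) by (intro lin_smult) auto
  then show ?thesis using lin_closed[OF assms(3), of "\<zero>\<^bsub>U\<^esub>"] by simp
qed

lemma lin_a_inv:
  assumes "module R U" "module R V" "lin R U V f" "x \<in> carrier U"
  shows "f (\<ominus>\<^bsub>U\<^esub> x) = \<ominus>\<^bsub>V\<^esub> f x"
proof -
  interpret U: module R U by fact
  interpret V: module R V by fact
  have "f (\<ominus>\<^bsub>U\<^esub> x) \<oplus>\<^bsub>V\<^esub> f x = \<zero>\<^bsub>V\<^esub>"
    using lin_add[OF assms(3), of "\<ominus>\<^bsub>U\<^esub> x" x] lin_zero[OF assms(1-3)] assms(4) by (simp add: U.M.l_neg)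
  then show ?thesis using assms lin_closed[OF assms(3)]
    by (intro V.M.minus_equality[symmetric]) auto
qed

lemma lin_minus:
  assumes "module R U" "module R V" "lin R U V f" "x \<in> carrier U" "y \<in> carrier U"
  shows "f (x \<ominus>\<^bsub>U\<^esub> y) = f x \<ominus>\<^bsub>V\<^esub> f y"
proof -
  interpret U: module R U by fact
  show ?thesis using assms by (simp add: a_minus_def lin_add lin_a_inv)
qed

lemma lin_plus:
  assumes "module R V" "lin R U V f" "lin R U V g"
  shows "lin R U V (\<lambda>x. f x \<oplus>\<^bsub>V\<^esub> g x)"
proof -
  interpret V: module R V by fact
  show ?thesis using assms(2,3)
    by (auto intro!: linI simp: lin_add lin_smult lin_closed V.smult_r_distr V.M.a_ac)
qed

lemma lin_uminus:
  assumes "module R V" "lin R U V f"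
  shows "lin R U V (\<lambda>x. \<ominus>\<^bsub>V\<^esub> f x)"
proof -
  interpret V: module R V by fact
  show ?thesis using assms(2)
    by (auto intro!: linI simp: lin_add lin_smult lin_closed V.smult_r_minus V.M.minus_add)
qed

lemma lin_diff:
  assumes "module R V" "lin R U V f" "lin R U V g"
  shows "lin R U V (\<lambda>x. f x \<ominus>\<^bsub>V\<^esub> g x)"
  unfolding a_minus_def by (intro lin_plus lin_uminus assms)

lemma lin_scale:
  assumes "module R V" "lin R U V f" "s \<in> carrier R"
  shows "lin R U V (\<lambda>x. s \<odot>\<^bsub>V\<^esub> f x)"
proof -
  interpret V: module R V by fact
  show ?thesis using assms(2,3)
    by (auto intro!: linI simp: lin_add lin_smult lin_closed V.smult_r_distr V.smult_assoc1[symmetric] V.R.m_comm)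
qed

lemma lin_const_zero:
  assumes "module R V"
  shows "lin R U V (\<lambda>x. \<zero>\<^bsub>V\<^esub>)"
proof -
  interpret V: module R V by fact
  show ?thesis by (auto intro!: linI)
qed

lemma submodule_ker:
  assumes "module R U" "module R V" "lin R U V f"
  shows "submodule {x \<in> carrier U. f x = \<zero>\<^bsub>V\<^esub>} R U"
proof -
  interpret U: module R U by fact
  interpret V: module R V by fact
  show ?thesis
    by (rule U.submoduleI) (use assms in \<open>auto simp: lin_zero lin_a_inv lin_add lin_smult\<close>)
qed

lemma submodule_image:
  assumes "module R U" "module R V" "lin R U V f" "submodule H R U"
  shows "submodule (f ` H) R V"
proof -
  interpret U: module R U by fact
  interpret V: module R V by fact
  note H = U.submoduleE[OF assms(4)]
  show ?thesis
  proof (rule V.submoduleI)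
    show "f ` H \<subseteq> carrier V" using H(1) assms(3) by (auto simp: lin_closed)
    obtain x where x: "x \<in> H" using H(2) by blast
    have "\<zero>\<^bsub>R\<^esub> \<odot>\<^bsub>U\<^esub> x \<in> H" using x by (intro H) auto
    then have "\<zero>\<^bsub>U\<^esub> \<in> H" using x H(1) by (simp add: subset_iff)
    then show "\<zero>\<^bsub>V\<^esub> \<in> f ` H" using lin_zero[OF assms(1-3)] by force
  next
    fix a assume "a \<in> f ` H"
    then obtain x where x: "x \<in> H" "a = f x" by blast
    then have "\<ominus>\<^bsub>V\<^esub> a = f (\<ominus>\<^bsub>U\<^esub> x)" using H(1) assms by (auto simp: lin_a_inv subset_iff)
    then show "\<ominus>\<^bsub>V\<^esub> a \<in> f ` H" using H(3) x by blast
  next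
    fix a b assume "a \<in> f ` H" "b \<in> f ` H"
    then obtain x y where x: "x \<in> H" "a = f x" "y \<in> H" "b = f y" by blast
    then have "a \<oplus>\<^bsub>V\<^esub> b = f (x \<oplus>\<^bsub>U\<^esub> y)" using H(1) assms(3) by (auto simp: lin_add subset_iff)
    then show "a \<oplus>\<^bsub>V\<^esub> b \<in> f ` H" using H(5) x by blast
  next
    fix r a assume r: "r \<in> carrier R" and "a \<in> f ` H"
    then obtain x where x: "x \<in> H" "a = f x" by blast
    then have "r \<odot>\<^bsub>V\<^esub> a = f (r \<odot>\<^bsub>U\<^esub> x)" using r H(1) assms by (auto simp: lin_smult subset_iff)
    then show "r \<odot>\<^bsub>V\<^esub> a \<in> f ` H" using H(4)[OF r] x by blast
  qed
qed

lemma module_submod: "module R A \<Longrightarrow> submodule H R A \<Longrightarrow> module R (submod A H)"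
  by (rule submodule.submodule_is_module)

lemma lin_submodule:
  "H \<subseteq> carrier U \<Longrightarrow> lin R (submod U H) U (\<lambda>x. x)"
  by (auto intro!: linI)

text \<open>Turns ideals into submodules and the cyclic modules R/J into instances of
  \<open>quot_module\<close>, so that no quotient ring is formed.\<close>

definition ring_module :: "('r, 'x) ring_scheme \<Rightarrow> ('r, 'r) module" where
  "ring_module R = mk_module (carrier R) \<zero>\<^bsub>R\<^esub> (add R) (monoid.mult R)"

lemma ring_module_simps [simp]:
  "carrier (ring_module R) = carrier R" "\<zero>\<^bsub>ring_module R\<^esub> = \<zero>\<^bsub>R\<^esub>"
  "x \<oplus>\<^bsub>ring_module R\<^esub> y = x \<oplus>\<^bsub>R\<^esub> y" "r \<odot>\<^bsub>ring_module R\<^esub> x = r \<otimes>\<^bsub>R\<^esub> x"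
  "\<ominus>\<^bsub>ring_module R\<^esub> x = \<ominus>\<^bsub>R\<^esub> x" "x \<ominus>\<^bsub>ring_module R\<^esub> y = x \<ominus>\<^bsub>R\<^esub> y"
  by (simp_all add: ring_module_def a_inv_def a_minus_def m_inv_def)

context cring
begin

lemma module_ring_module: "module R (ring_module R)"
proof (rule moduleI)
  show "abelian_group (ring_module R)"
    by (rule abelian_groupI) (auto simp: a_ac intro: exI[of _ "\<ominus> _"] l_neg)
qed (auto simp: is_cring l_distr r_distr m_assoc)

lemma lin_scalars:
  assumes "module R A" "x \<in> carrier A"
  shows "lin R (ring_module R) A (\<lambda>r. r \<odot>\<^bsub>A\<^esub> x)"
proof -
  interpret A: module R A by fact
  show ?thesis using assms(2) by (auto intro!: linI simp: A.smult_l_distr A.smult_assoc1)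
qed

end

section \<open>Free modules\<close>

lemma free_simps [simp]:
  "\<zero>\<^bsub>free_module R B\<^esub> = (\<lambda>b. \<zero>\<^bsub>R\<^esub>)"
  "z \<oplus>\<^bsub>free_module R B\<^esub> w = (\<lambda>b. z b \<oplus>\<^bsub>R\<^esub> w b)"
  "r \<odot>\<^bsub>free_module R B\<^esub> z = (\<lambda>b. r \<otimes>\<^bsub>R\<^esub> z b)"
  by (simp_all add: free_module_def)

context cring
begin

lemma free_closed: "z \<in> carrier (free_module R B) \<Longrightarrow> z b \<in> carrier R"
  by (simp add: free_carrier_iff)

lemma module_free: "module R (free_module R B)"
proof (rule moduleI)
  have sub: "finite {b. f b \<noteq> \<zero>} \<and> {b. f b \<noteq> \<zero>} \<subseteq> B"
    if "z \<in> carrier (free_module R B)" "w \<in> carrier (free_module R B)"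
      "\<And>b. z b = \<zero> \<Longrightarrow> w b = \<zero> \<Longrightarrow> f b = \<zero>" for f z w
  proof -
    have "{b. f b \<noteq> \<zero>} \<subseteq> {b. z b \<noteq> \<zero>} \<union> {b. w b \<noteq> \<zero>}" using that(3) by auto
    then show ?thesis using that(1,2) unfolding free_carrier_iff
      by (meson finite_Un finite_subset le_sup_iff order_trans)
  qed
  have cl: "(\<lambda>b. z b \<oplus> w b) \<in> carrier (free_module R B)"
    if "z \<in> carrier (free_module R B)" "w \<in> carrier (free_module R B)" for z w
    using sub[OF that, of "\<lambda>b. z b \<oplus> w b"] that by (auto simp: free_carrier_iff)
  have sc: "(\<lambda>b. r \<otimes> z b) \<in> carrier (free_module R B)"
    if "z \<in> carrier (free_module R B)" "r \<in> carrier R" for r z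
    using sub[OF that(1) that(1), of "\<lambda>b. r \<otimes> z b"] that by (auto simp: free_carrier_iff)
  have neg: "(\<lambda>b. \<ominus> z b) \<in> carrier (free_module R B)"
    if "z \<in> carrier (free_module R B)" for z
    using sub[OF that that, of "\<lambda>b. \<ominus> z b"] that by (auto simp: free_carrier_iff)
  show "abelian_group (free_module R B)"
  proof (rule abelian_groupI, goal_cases)
    case (6 x)
    then show ?case using neg[of x] by (intro bexI[of _ "\<lambda>b. \<ominus> x b"]) (auto simp: free_closed l_neg)
  qed (use cl in \<open>auto simp: free_closed a_ac fun_eq_iff free_carrier_iff\<close>)
  show "cring R" by (rule is_cring)
  show "r \<odot>\<^bsub>free_module R B\<^esub> z \<in> carrier (free_module R B)"
    if "r \<in> carrier R" "z \<in> carrier (free_module R B)" for r z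
    using sc that by simp
qed (auto simp: free_closed l_distr r_distr m_assoc fun_eq_iff)

text \<open>The indicator of \<open>b\<close>, written as a one-term formal sum so that
  \<open>res_d_basis\<close> applies to it after folding.\<close>

definition basis :: "'c \<Rightarrow> 'c \<Rightarrow> 'a" where
  "basis b = formal_sum R [(\<one>, b)]"

lemma free_ext:
  assumes "module R W" "\<And>b. b \<in> B \<Longrightarrow> w b \<in> carrier W"
  defines "k \<equiv> \<lambda>z. \<Oplus>\<^bsub>W\<^esub>b\<in>{b. z b \<noteq> \<zero>}. z b \<odot>\<^bsub>W\<^esub> w b"
  shows "lin R (free_module R B) W k"
    and "b \<in> B \<Longrightarrow> k (basis b) = w b"
proof -
  interpret W: module R W by fact
  \<comment> \<open>The support varies with the argument. Summing over any larger finite subset of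
    \<open>B\<close> lets two elements and their sum share one index set.\<close>
  have k: "k z = (\<Oplus>\<^bsub>W\<^esub>b\<in>S. z b \<odot>\<^bsub>W\<^esub> w b)"
    if "finite S" "{b. z b \<noteq> \<zero>} \<subseteq> S" "S \<subseteq> B" "\<And>b. z b \<in> carrier R" for S z
    unfolding k_def
    by (rule W.M.add.finprod_mono_neutral_cong_left) (use that assms(2) in \<open>auto simp: subset_iff\<close>)
  show "lin R (free_module R B) W k"
  proof (rule linI)
    fix z assume "z \<in> carrier (free_module R B)"
    then show "k z \<in> carrier W"
      unfolding k_def using assms(2) by (intro W.M.finsum_closed) (auto simp: free_carrier_iff)
  next
    fix z v assume z: "z \<in> carrier (free_module R B)" and v: "v \<in> carrier (free_module R B)"
    let ?S = "{b. z b \<noteq> \<zero>} \<union> {b. v b \<noteq> \<zero>}"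
    have S: "finite ?S" "?S \<subseteq> B" using z v by (auto simp: free_carrier_iff)
    then have w: "\<And>b. b \<in> ?S \<Longrightarrow> w b \<in> carrier W" using assms(2) by blast
    note c = free_closed[OF z] free_closed[OF v]
    have "k (\<lambda>b. z b \<oplus> v b) = (\<Oplus>\<^bsub>W\<^esub>b\<in>?S. (z b \<oplus> v b) \<odot>\<^bsub>W\<^esub> w b)"
      by (rule k) (use S c in auto)
    also have "\<dots> = (\<Oplus>\<^bsub>W\<^esub>b\<in>?S. z b \<odot>\<^bsub>W\<^esub> w b \<oplus>\<^bsub>W\<^esub> v b \<odot>\<^bsub>W\<^esub> w b)"
      by (rule W.M.add.finprod_cong) (use w c in \<open>auto simp: W.smult_l_distr simp_implies_def\<close>)
    also have "\<dots> = (\<Oplus>\<^bsub>W\<^esub>b\<in>?S. z b \<odot>\<^bsub>W\<^esub> w b) \<oplus>\<^bsub>W\<^esub> (\<Oplus>\<^bsub>W\<^esub>b\<in>?S. v b \<odot>\<^bsub>W\<^esub> w b)"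
      by (rule W.M.add.finprod_multf) (use w c in auto)
    also have "\<dots> = k z \<oplus>\<^bsub>W\<^esub> k v"
      using k[OF S(1) _ S(2) c(1)] k[OF S(1) _ S(2) c(2)] by auto
    finally show "k (z \<oplus>\<^bsub>free_module R B\<^esub> v) = k z \<oplus>\<^bsub>W\<^esub> k v" by simp
  next
    fix r z assume r: "r \<in> carrier R" and z: "z \<in> carrier (free_module R B)"
    have S: "finite {b. z b \<noteq> \<zero>}" "{b. z b \<noteq> \<zero>} \<subseteq> B" using z by (auto simp: free_carrier_iff)
    then have w: "\<And>b. b \<in> {b. z b \<noteq> \<zero>} \<Longrightarrow> w b \<in> carrier W" using assms(2) by blast
    note c = free_closed[OF z]
    have "k (\<lambda>b. r \<otimes> z b) = (\<Oplus>\<^bsub>W\<^esub>b\<in>{b. z b \<noteq> \<zero>}. (r \<otimes> z b) \<odot>\<^bsub>W\<^esub> w b)"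
      by (rule k) (use S c r in auto)
    also have "\<dots> = (\<Oplus>\<^bsub>W\<^esub>b\<in>{b. z b \<noteq> \<zero>}. r \<odot>\<^bsub>W\<^esub> (z b \<odot>\<^bsub>W\<^esub> w b))"
      by (rule W.M.add.finprod_cong) (use w c r in \<open>auto simp: W.smult_assoc1 simp_implies_def\<close>)
    also have "\<dots> = r \<odot>\<^bsub>W\<^esub> k z"
      unfolding k_def by (rule W.finsum_smult_ldistr[symmetric]) (use S w c r in auto)
    finally show "k (r \<odot>\<^bsub>free_module R B\<^esub> z) = r \<odot>\<^bsub>W\<^esub> k z" by simp
  qed
  show "k (basis b) = w b" if b: "b \<in> B"
  proof -
    have "k (basis b) = (\<Oplus>\<^bsub>W\<^esub>c\<in>{b}. basis b c \<odot>\<^bsub>W\<^esub> w c)"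
      by (rule k) (use b in \<open>auto simp: basis_def\<close>)
    then show ?thesis using assms(2)[OF b] by (simp add: W.M.finsum_insert basis_def)
  qed
qed

lemma basis_closed: "b \<in> B \<Longrightarrow> basis b \<in> carrier (free_module R B)"
  unfolding basis_def by (intro formal_sum_free) auto

lemma formal_sum_Cons_free:
  assumes "p \<in> carrier R \<times> B" "set l \<subseteq> carrier R \<times> B"
  shows "formal_sum R (p # l) = fst p \<odot>\<^bsub>free_module R B\<^esub> basis (snd p)
    \<oplus>\<^bsub>free_module R B\<^esub> formal_sum R l"
  using assms free_closed[OF formal_sum_free[OF assms(2)]] by (auto simp: fun_eq_iff basis_def)

lemma free_hom_eq:
  assumes "module R W" "lin R (free_module R B) W f" "lin R (free_module R B) W g"
    and "\<And>b. b \<in> B \<Longrightarrow> f (basis b) = g (basis b)"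
    and "z \<in> carrier (free_module R B)"
  shows "f z = g z"
proof -
  interpret F: module R "free_module R B" by (rule module_free)
  obtain l where l: "set l \<subseteq> carrier R \<times> B" "formal_sum R l = z"
    using formal_sum_surj[OF assms(5)] by blast
  have "f (formal_sum R l) = g (formal_sum R l)" using l(1)
  proof (induction l)
    case Nil
    show ?case
      using lin_zero[OF module_free assms(1,2)] lin_zero[OF module_free assms(1,3)] by simp
  next
    case (Cons p l)
    then have p: "p \<in> carrier R \<times> B" and l: "set l \<subseteq> carrier R \<times> B" by auto
    have c: "basis (snd p) \<in> carrier (free_module R B)"
      "formal_sum R l \<in> carrier (free_module R B)"
      using p l by (auto intro!: formal_sum_free basis_closed)
    have r: "fst p \<in> carrier R" using p by auto
    have "h (formal_sum R (p # l)) = fst p \<odot>\<^bsub>W\<^esub> h (basis (snd p)) \<oplus>\<^bsub>W\<^esub> h (formal_sum R l)"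
      if h: "lin R (free_module R B) W h" for h
      unfolding formal_sum_Cons_free[OF p l] using c r h
      by (simp add: lin_add lin_smult F.smult_closed del: free_simps)
    from this[OF assms(2)] this[OF assms(3)] show ?case
      using Cons.IH[OF l] assms(4)[of "snd p"] p by (auto)
  qed
  then show ?thesis using l by simp
qed

text \<open>Projectivity of free modules. Asking only that \<open>g\<close> takes values in the
  image of \<open>f\<close> suits the applications, where \<open>f\<close> is often a differential
  whose image is described by exactness.\<close>

lemma free_lift:
  assumes "module R U" "module R W" "lin R W U f" "lin R (free_module R B) U g"
    and "\<And>z. z \<in> carrier (free_module R B) \<Longrightarrow> g z \<in> f ` carrier W"
  shows "\<exists>k. lin R (free_module R B) W k \<and> (\<forall>z\<in>carrier (free_module R B). f (k z) = g z)"
proof -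
  have "\<forall>b\<in>B. \<exists>w. w \<in> carrier W \<and> f w = g (basis b)"
    using assms(5)[OF basis_closed] by (metis imageE)
  then obtain w where w: "\<And>b. b \<in> B \<Longrightarrow> w b \<in> carrier W"
    "\<And>b. b \<in> B \<Longrightarrow> f (w b) = g (basis b)" by metis
  obtain k where k: "lin R (free_module R B) W k"
    "\<And>b. b \<in> B \<Longrightarrow> k (basis b) = w b"
    using free_ext[where w = w, OF assms(2) w(1)] by blast
  have "f (k z) = g z" if "z \<in> carrier (free_module R B)" for z
    by (rule free_hom_eq[OF assms(1) lin_comp[OF k(1) assms(3)] assms(4) _ that])
      (use w k in \<open>auto\<close>)
  with k show ?thesis by blast
qed

subsection \<open>Sums of free modules\<close>

text \<open>A direct sum of free modules is realized as the free module on the disjoint union of the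
  bases. The cone is then degreewise free by construction, and \<open>free_lift\<close> applies to
  it.\<close>

lemma free_proj_Inl: "lin R (free_module R (A <+> B)) (free_module R A) (\<lambda>z b. z (Inl b))"
proof (rule linI)
  fix z assume z: "z \<in> carrier (free_module R (A <+> B))"
  have "finite (Inl -` {b. z b \<noteq> \<zero>})" using z by (intro finite_vimageI) (auto simp: free_carrier_iff)
  moreover have "Inl -` {b. z b \<noteq> \<zero>} \<subseteq> A" using z by (auto simp: free_carrier_iff subset_iff)
  ultimately show "(\<lambda>b. z (Inl b)) \<in> carrier (free_module R A)"
    using z by (simp add: free_carrier_iff vimage_def)
qed auto

lemma free_proj_Inr: "lin R (free_module R (A <+> B)) (free_module R B) (\<lambda>z b. z (Inr b))"
proof (rule linI)
  fix z assume z: "z \<in> carrier (free_module R (A <+> B))"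
  have "finite (Inr -` {b. z b \<noteq> \<zero>})" using z by (intro finite_vimageI) (auto simp: free_carrier_iff)
  moreover have "Inr -` {b. z b \<noteq> \<zero>} \<subseteq> B" using z by (auto simp: free_carrier_iff subset_iff)
  ultimately show "(\<lambda>b. z (Inr b)) \<in> carrier (free_module R B)"
    using z by (simp add: free_carrier_iff vimage_def)
qed auto

lemma free_pair_closed:
  assumes "z \<in> carrier (free_module R A)" "w \<in> carrier (free_module R B)"
  shows "case_sum z w \<in> carrier (free_module R (A <+> B))"
proof -
  have eq: "{b. case_sum z w b \<noteq> \<zero>} = {b. z b \<noteq> \<zero>} <+> {b. w b \<noteq> \<zero>}" (is "?l = ?r")
  proof (rule Set.set_eqI)
    show "x \<in> ?l \<longleftrightarrow> x \<in> ?r" for x by (cases x) auto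
  qed
  show ?thesis using assms unfolding free_carrier_iff eq by (auto split: sum.split simp: subset_iff)
qed

lemma free_pair_eta: "case_sum (\<lambda>b. z (Inl b)) (\<lambda>b. z (Inr b)) = z"
  by (auto simp: fun_eq_iff split: sum.split)

lemma free_pair_lin:
  assumes "lin R U (free_module R A) f" "lin R U (free_module R B) g"
  shows "lin R U (free_module R (A <+> B)) (\<lambda>u. case_sum (f u) (g u))"
  using assms
  by (auto intro!: linI free_pair_closed simp: lin_closed lin_add lin_smult fun_eq_iff split: sum.split)

lemma free_uminus:
  assumes "z \<in> carrier (free_module R B)"
  shows "\<ominus>\<^bsub>free_module R B\<^esub> z = (\<lambda>b. \<ominus> z b)"
proof -
  interpret F: module R "free_module R B" by (rule module_free)
  \<comment> \<open>The additive inverse is defined by a description, so it is computed as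
    multiplication by minus one.\<close>
  have "\<ominus>\<^bsub>free_module R B\<^esub> z = (\<ominus> \<one>) \<odot>\<^bsub>free_module R B\<^esub> z"
    using F.smult_l_minus[of \<one> z] assms by (simp add: free_closed del: free_simps)
  then show ?thesis using assms by (simp add: l_minus free_closed)
qed

end

section \<open>The functorial resolution\<close>

context cring
begin

text \<open>Moves coefficients from generators \<open>Base m\<close> to the elements
  \<open>m\<close>, which displays \<open>res_aug\<close> as an instance of
  \<open>free_ext\<close>.\<close>

lemma free_comap_lin:
  assumes "inj f"
  shows "lin R (free_module R (f ` B)) (free_module R B) (\<lambda>z b. z (f b))"
proof (rule linI)
  fix z assume z: "z \<in> carrier (free_module R (f ` B))"
  have "finite (f -` {b. z b \<noteq> \<zero>})"
    using z assms by (intro finite_vimageI) (auto simp: free_carrier_iff)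
  moreover have "f -` {b. z b \<noteq> \<zero>} \<subseteq> B"
    using z assms unfolding free_carrier_iff by (blast dest: injD)
  ultimately show "(\<lambda>b. z (f b)) \<in> carrier (free_module R B)"
    using z by (simp add: free_carrier_iff vimage_def)
qed auto

lemma module_free_res: "module R (free_res R A k)"
  unfolding free_res_def by (rule module_free)

lemma lin_res_aug:
  assumes "module R A"
  shows "lin R (free_res R A 0) A (res_aug R A)"
proof -
  interpret A: module R A by fact
  show ?thesis
    unfolding res_aug_def[abs_def] free_res_def res_gens.simps
    by (rule lin_comp[OF free_comap_lin free_ext(1)[OF assms]]) (auto simp: inj_def)
qed

text \<open>\<open>res_d\<close> is given coordinate by coordinate. It agrees with the linear
  extension of \<open>res_d_gen\<close> because both follow the same recursion along formal
  sums.\<close>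

lemma lin_res_d:
  assumes "module R A"
  shows "lin R (free_res R A (Suc k)) (free_res R A k) (res_d R)"
proof -
  let ?B = "res_gens R A (Suc k)"
  have c: "res_d_gen R u \<in> carrier (free_module R (res_gens R A k))" if "u \<in> ?B" for u
    using that formal_sum_free[of _ "res_gens R A k"] by auto
  obtain f where f: "lin R (free_module R ?B) (free_module R (res_gens R A k)) f"
    "\<And>u. u \<in> ?B \<Longrightarrow> f (basis u) = res_d_gen R u"
    using free_ext[where w = "res_d_gen R", OF module_free c] by blast
  have "f (formal_sum R l) = res_d R (formal_sum R l)" if "set l \<subseteq> carrier R \<times> ?B" for l
    using that
  proof (induction l)
    case Nil
    then show ?case using lin_zero[OF module_free module_free f(1)] by (simp add: res_d_zero)
  next
    case (Cons p l)
    interpret F: module R "free_module R ?B" by (rule module_free)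
    have p: "p \<in> carrier R \<times> ?B" "fst p \<in> carrier R" "snd p \<in> ?B" and l: "set l \<subseteq> carrier R \<times> ?B"
      using Cons.prems by (auto simp del: res_gens.simps)
    have "f (formal_sum R (p # l)) = fst p \<odot>\<^bsub>free_module R (res_gens R A k)\<^esub> res_d_gen R (snd p)
        \<oplus>\<^bsub>free_module R (res_gens R A k)\<^esub> f (formal_sum R l)"
      unfolding formal_sum_Cons_free[OF p(1) l] f(2)[OF p(3), symmetric]
      using basis_closed[OF p(3)] formal_sum_free[OF l] F.smult_closed[OF p(2) basis_closed[OF p(3)]] p(2)
      by (simp add: lin_add[OF f(1)] lin_smult[OF f(1)] del: free_simps formal_sum.simps res_gens.simps)
    then show ?case using Cons.IH[OF l] res_d_formal_sum_Cons[OF Cons.prems] by (simp add: fun_eq_iff del: formal_sum.simps)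
  qed
  then have "f z = res_d R z" if "z \<in> carrier (free_module R ?B)" for z
    using formal_sum_surj[OF that] by blast
  then show ?thesis using f(1) unfolding free_res_def by (subst lin_cong[OF module_free, of _ _ f]) auto
qed

lemma res_vanishes_d:
  assumes "module R A" "z \<in> carrier (free_res R A (Suc k))"
  shows "res_vanishes R A k (res_d R z)"
  using module.res_exact[OF assms(1), of k] assms(2) by blast

lemma res_vanishes_imp_d:
  assumes "module R A" "z \<in> carrier (free_res R A k)" "res_vanishes R A k z"
  shows "z \<in> res_d R ` carrier (free_res R A (Suc k))"
  using module.res_exact[OF assms(1), of k] assms(2,3) by blast

section \<open>Functoriality of the resolution\<close>

lemma finsum_ring_module: "finsum (ring_module R) f T = finsum R f T"
  by (simp add: finsum_def finprod_def ring_module_def)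

lemma res_map_expand:
  assumes "z \<in> carrier (free_module R B)" "finite S" "{u. z u \<noteq> \<zero>} \<subseteq> S"
  shows "res_map R h z v = (\<Oplus>u\<in>S. if map_gen h u = v then z u else \<zero>)"
  unfolding res_map_def using assms free_closed[OF assms(1)]
  by (intro add.finprod_mono_neutral_cong_left) auto

text \<open>The coordinate at \<open>v\<close> is the functional with weight one on the fibre of
  \<open>map_gen h\<close> over \<open>v\<close> and zero elsewhere, so \<open>free_ext\<close>
  yields linearity.\<close>

lemma res_map_component_lin:
  "lin R (free_module R B) (ring_module R) (\<lambda>z. res_map R h z v)"
proof -
  let ?w = "\<lambda>u. if map_gen h u = v then \<one> else \<zero>"
  have "lin R (free_module R B) (ring_module R)
      (\<lambda>z. \<Oplus>\<^bsub>ring_module R\<^esub>u\<in>{u. z u \<noteq> \<zero>}. z u \<odot>\<^bsub>ring_module R\<^esub> ?w u)"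
    by (rule free_ext(1)[OF module_ring_module]) simp
  moreover have "(\<Oplus>u\<in>{u. z u \<noteq> \<zero>}. z u \<otimes> ?w u) = res_map R h z v" if z: "z \<in> carrier (free_module R B)" for z
    unfolding res_map_def using z free_closed[OF z]
    by (intro add.finprod_mono_neutral_cong_right) (auto simp: free_carrier_iff)
  ultimately show ?thesis
    by (subst lin_cong[OF module_free]) (auto simp: finsum_ring_module)
qed

lemma res_map_lin:
  assumes "\<And>u. u \<in> B \<Longrightarrow> map_gen h u \<in> C"
  shows "lin R (free_module R B) (free_module R C) (res_map R h)"
proof (rule linI)
  note L = res_map_component_lin[of B h]
  fix z assume z: "z \<in> carrier (free_module R B)"
  have "{v. res_map R h z v \<noteq> \<zero>} \<subseteq> map_gen h ` {u. z u \<noteq> \<zero>}"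
  proof
    fix v assume "v \<in> {v. res_map R h z v \<noteq> \<zero>}"
    then have "{u. z u \<noteq> \<zero> \<and> map_gen h u = v} \<noteq> {}"
      unfolding res_map_def using finsum_empty[of z] by force
    then show "v \<in> map_gen h ` {u. z u \<noteq> \<zero>}" by blast
  qed
  moreover have "finite (map_gen h ` {u. z u \<noteq> \<zero>})" "map_gen h ` {u. z u \<noteq> \<zero>} \<subseteq> C"
    using z assms by (auto simp: free_carrier_iff)
  ultimately have "finite {v. res_map R h z v \<noteq> \<zero>}" "{v. res_map R h z v \<noteq> \<zero>} \<subseteq> C"
    using finite_subset by blast+
  then show "res_map R h z \<in> carrier (free_module R C)"
    using lin_closed[OF L z] by (simp add: free_carrier_iff)
  show "res_map R h (z \<oplus>\<^bsub>free_module R B\<^esub> w) = res_map R h z \<oplus>\<^bsub>free_module R C\<^esub> res_map R h w"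
    if "w \<in> carrier (free_module R B)" for w
    using lin_add[OF L z that] by (simp add: fun_eq_iff)
  show "res_map R h (r \<odot>\<^bsub>free_module R B\<^esub> z) = r \<odot>\<^bsub>free_module R C\<^esub> res_map R h z" if "r \<in> carrier R" for r
    using lin_smult[OF L that z] by (simp add: fun_eq_iff)
qed

lemma res_map_basis: "res_map R h (basis u) = basis (map_gen h u)"
proof
  fix v
  have "res_map R h (basis u) v
      = (\<Oplus>w\<in>{u}. if map_gen h w = v then basis u w else \<zero>)"
    by (rule res_map_expand[OF basis_closed[of u "{u}"]]) (auto simp: basis_def)
  then show "res_map R h (basis u) v = basis (map_gen h u) v"
    by (auto simp: finsum_insert basis_def)
qed

text \<open>\<open>map_gen\<close> rewrites the list inside \<open>Syz\<close> entry by entry, so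
  this identity is what makes \<open>res_map\<close> commute with the differential on
  generators.\<close>

lemma res_map_formal_sum:
  assumes "set l \<subseteq> carrier R \<times> B"
  shows "res_map R h (formal_sum R l) = formal_sum R (map (map_prod (\<lambda>a. a) (map_gen h)) l)"
proof -
  have L: "lin R (free_module R B) (free_module R (map_gen h ` B)) (res_map R h)"
    by (rule res_map_lin) auto
  interpret F: module R "free_module R B" by (rule module_free)
  show ?thesis using assms
  proof (induction l)
    case Nil
    show ?case using lin_zero[OF module_free module_free L] by simp
  next
    case (Cons p l)
    then have p: "p \<in> carrier R \<times> B" and l: "set l \<subseteq> carrier R \<times> B" by auto
    have r: "fst p \<in> carrier R" "snd p \<in> B" using p by auto
    have l': "set (map (map_prod (\<lambda>a. a) (map_gen h)) l) \<subseteq> carrier R \<times> (map_gen h ` B)" using l by auto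
    have p': "map_prod (\<lambda>a. a) (map_gen h) p \<in> carrier R \<times> (map_gen h ` B)" using p by auto
    have "res_map R h (formal_sum R (p # l))
      = fst p \<odot>\<^bsub>free_module R (map_gen h ` B)\<^esub> res_map R h (basis (snd p))
        \<oplus>\<^bsub>free_module R (map_gen h ` B)\<^esub> res_map R h (formal_sum R l)"
      unfolding formal_sum_Cons_free[OF p l]
      using basis_closed[OF r(2)] formal_sum_free[OF l] r
      by (simp add: lin_add[OF L] lin_smult[OF L] F.smult_closed del: free_simps)
    then show ?case
      using formal_sum_Cons_free[OF p' l'] Cons.IH[OF l] r
      by (cases p) (auto simp: res_map_basis simp del: free_simps)
  qed
qed

lemma res_aug_basis:
  assumes "module R A" "m \<in> carrier A"
  shows "res_aug R A (basis (Base m)) = m"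
proof -
  interpret A: module R A by fact
  show ?thesis using A.res_aug_formal_sum_Cons[of \<one> m "[]"] assms(2) by (simp add: A.res_aug_zero basis_def)
qed

context
  fixes A :: "('a, 'm, 'y) module_scheme" and B :: "('a, 'n, 'z) module_scheme" and h
  assumes A: "module R A" and B: "module R B" and h: "lin R A B h"
begin

lemma res_aug_map:
  assumes "z \<in> carrier (free_res R A 0)"
  shows "res_aug R B (res_map R h z) = h (res_aug R A z)"
proof (rule free_hom_eq[OF B, of "res_gens R A 0" "\<lambda>z. res_aug R B (res_map R h z)" "\<lambda>z. h (res_aug R A z)"])
  have "lin R (free_res R A 0) (free_res R B 0) (res_map R h)"
    unfolding free_res_def by (rule res_map_lin) (use lin_closed[OF h] in auto)
  from lin_comp[OF this lin_res_aug[OF B]]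
  show "lin R (free_module R (res_gens R A 0)) B (\<lambda>z. res_aug R B (res_map R h z))"
    by (simp add: free_res_def)
  show "lin R (free_module R (res_gens R A 0)) B (\<lambda>z. h (res_aug R A z))"
    using lin_comp[OF lin_res_aug[OF A] h] by (simp add: free_res_def)
  fix b assume "b \<in> res_gens R A 0"
  then show "res_aug R B (res_map R h (basis b)) = h (res_aug R A (basis b))"
    using lin_closed[OF h] by (auto simp: res_map_basis res_aug_basis A B)
qed (use assms in \<open>simp add: free_res_def\<close>)

text \<open>The premises on generators are themselves established by the induction in
  \<open>res_map_natural\<close>, which uses commutation with \<open>res_d\<close> in each step.
  Stating them as premises avoids the circle.\<close>

lemma res_d_map_aux:
  assumes gk: "\<And>u. u \<in> res_gens R A k \<Longrightarrow> map_gen h u \<in> res_gens R B k"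
    and gs: "\<And>u. u \<in> res_gens R A (Suc k) \<Longrightarrow> map_gen h u \<in> res_gens R B (Suc k)"
    and z: "z \<in> carrier (free_res R A (Suc k))"
  shows "res_d R (res_map R h z) = res_map R h (res_d R z)"
proof (rule free_hom_eq[OF module_free_res[of B k], of "res_gens R A (Suc k)" "\<lambda>z. res_d R (res_map R h z)" "\<lambda>z. res_map R h (res_d R z)"])
  have "lin R (free_res R A (Suc k)) (free_res R B (Suc k)) (res_map R h)"
    unfolding free_res_def by (rule res_map_lin) (rule gs)
  from lin_comp[OF this lin_res_d[OF B]]
  show "lin R (free_module R (res_gens R A (Suc k))) (free_res R B k) (\<lambda>z. res_d R (res_map R h z))"
    by (simp only: free_res_def)
  have "lin R (free_res R A k) (free_res R B k) (res_map R h)"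
    unfolding free_res_def by (rule res_map_lin) (rule gk)
  from lin_comp[OF lin_res_d[OF A] this]
  show "lin R (free_module R (res_gens R A (Suc k))) (free_res R B k) (\<lambda>z. res_map R h (res_d R z))"
    by (simp only: free_res_def)
  fix b assume b: "b \<in> res_gens R A (Suc k)"
  then obtain l where l: "b = Syz l" "set l \<subseteq> carrier R \<times> res_gens R A k" by auto
  show "res_d R (res_map R h (basis b)) = res_map R h (res_d R (basis b))"
    unfolding res_map_basis res_d_basis[OF b, folded basis_def] res_d_basis[OF gs[OF b], folded basis_def]
    by (simp add: l res_map_formal_sum[OF l(2)] id_def)
qed (use z in \<open>simp add: free_res_def\<close>)

text \<open>The two claims support each other: a generator of degree \<open>Suc k\<close> is a list
  whose value vanishes in degree \<open>k\<close>, and vanishing in degree \<open>Suc k\<close> is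
  tested by \<open>res_d\<close>, which commutes with \<open>res_map\<close> once generators go to
  generators.\<close>

lemma res_map_natural:
  "(\<forall>u\<in>res_gens R A k. map_gen h u \<in> res_gens R B k) \<and>
    (\<forall>z\<in>carrier (free_res R A k). res_vanishes R A k z \<longrightarrow> res_vanishes R B k (res_map R h z))"
proof (induction k)
  case 0
  show ?case using lin_zero[OF A B h] lin_closed[OF h] res_aug_map by (auto simp: res_vanishes_def)
next
  case (Suc k)
  have g: "map_gen h u \<in> res_gens R B (Suc k)" if u: "u \<in> res_gens R A (Suc k)" for u
  proof -
    obtain l where l: "u = Syz l" "set l \<subseteq> carrier R \<times> res_gens R A k"
      "res_vanishes R A k (formal_sum R l)" using u by auto
    let ?l = "map (map_prod (\<lambda>a. a) (map_gen h)) l"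
    have "formal_sum R l \<in> carrier (free_res R A k)" using formal_sum_free[OF l(2)] by (simp add: free_res_def)
    then have "res_vanishes R B k (formal_sum R ?l)"
      using Suc l(3) res_map_formal_sum[OF l(2), of h] by metis
    moreover have "set ?l \<subseteq> carrier R \<times> res_gens R B k" using l(2) Suc by auto
    moreover have "map_gen h u = Syz ?l" by (simp add: l(1) id_def)
    ultimately show ?thesis by auto
  qed
  have "lin R (free_res R A k) (free_res R B k) (res_map R h)"
    unfolding free_res_def by (rule res_map_lin) (use Suc in blast)
  from lin_zero[OF module_free_res module_free_res this]
  have "res_map R h (\<lambda>u. \<zero>) = (\<lambda>u. \<zero>)" by (simp add: free_res_def)
  moreover have "res_d R (res_map R h z) = res_map R h (res_d R z)"
    if "z \<in> carrier (free_res R A (Suc k))" for z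
    by (rule res_d_map_aux[OF _ g that]) (use Suc in auto)
  ultimately show ?case using g by (simp add: res_vanishes_def del: res_gens.simps)
qed

lemma res_gens_map: "u \<in> res_gens R A k \<Longrightarrow> map_gen h u \<in> res_gens R B k"
  using res_map_natural by blast

lemma lin_res_map: "lin R (free_res R A k) (free_res R B k) (res_map R h)"
  unfolding free_res_def by (rule res_map_lin) (rule res_gens_map)

lemma res_d_map:
  "z \<in> carrier (free_res R A (Suc k)) \<Longrightarrow> res_d R (res_map R h z) = res_map R h (res_d R z)"
  by (rule res_d_map_aux[OF res_gens_map res_gens_map])

end

text \<open>Projections between quotients obey the identity and composition laws on carriers only,
  so the laws for \<open>res_map\<close> and \<open>Ext_map\<close> must allow maps that differ
  elsewhere.\<close>

lemma map_gen_cong_res: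
  assumes "\<And>x. x \<in> carrier A \<Longrightarrow> h x = h' x" "u \<in> res_gens R A k"
  shows "map_gen h u = map_gen h' u"
  using assms(2)
proof (induction k arbitrary: u)
  case 0
  then show ?case using assms(1) by auto
next
  case (Suc k)
  then show ?case by fastforce
qed

lemma res_map_cong:
  assumes "\<And>x. x \<in> carrier A \<Longrightarrow> h x = h' x" "z \<in> carrier (free_res R A k)"
  shows "res_map R h z = res_map R h' z"
proof -
  have "u \<in> res_gens R A k" if "z u \<noteq> \<zero>" for u
    using assms(2) that by (auto simp: free_res_def free_carrier_iff)
  then have "map_gen h u = map_gen h' u" if "z u \<noteq> \<zero>" for u
    using map_gen_cong_res[of A h h'] assms(1) that by blast
  then have "{u. z u \<noteq> \<zero> \<and> map_gen h u = v} = {u. z u \<noteq> \<zero> \<and> map_gen h' u = v}" for v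
    by auto
  then show ?thesis by (simp add: res_map_def)
qed

lemma res_map_id:
  assumes "\<And>x. x \<in> carrier A \<Longrightarrow> h x = x" "z \<in> carrier (free_res R A k)"
  shows "res_map R h z = z"
proof -
  have z: "z u \<in> carrier R" for u using assms(2) by (auto simp: free_res_def free_closed)
  have "res_map R (\<lambda>x. x) z = z"
  proof
    fix v
    have "{u. z u \<noteq> \<zero> \<and> map_gen (\<lambda>x. x) u = v} = (if z v = \<zero> then {} else {v})"
      by (auto simp: gen.map_ident)
    then show "res_map R (\<lambda>x. x) z v = z v" using z by (auto simp: res_map_def finsum_insert)
  qed
  then show ?thesis using res_map_cong[of A h "\<lambda>x. x"] assms by auto
qed

lemma res_map_comp:
  assumes "z \<in> carrier (free_res R A k)"
  shows "res_map R g (res_map R h z) = res_map R (\<lambda>x. g (h x)) z"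
proof -
  obtain l where l: "set l \<subseteq> carrier R \<times> res_gens R A k" "formal_sum R l = z"
    using assms formal_sum_surj by (auto simp: free_res_def)
  \<comment> \<open>With \<open>UNIV\<close> as the set of generators, nothing has to be known about
    where \<open>map_gen h\<close> sends \<open>res_gens\<close>.\<close>
  have "set (map (map_prod (\<lambda>a. a) (map_gen h)) l) \<subseteq> carrier R \<times> UNIV" using l by auto
  then show ?thesis
    unfolding l(2)[symmetric] res_map_formal_sum[OF l(1)]
    by (simp add: res_map_formal_sum gen.map_comp comp_def map_prod_def case_prod_unfold)
qed

end

declare free_simps [simp del]

lemma (in abelian_group) minus_eq_zero_iff:
  "a \<in> carrier G \<Longrightarrow> b \<in> carrier G \<Longrightarrow> a \<ominus> b = \<zero> \<longleftrightarrow> a = b"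
  by (metis a_minus_def minus_equality minus_minus r_neg a_inv_closed)

lemma (in abelian_group) minus_plus_cancel:
  "a \<in> carrier G \<Longrightarrow> b \<in> carrier G \<Longrightarrow> (a \<ominus> b) \<oplus> b = a"
  by (simp add: a_minus_def a_assoc l_neg)

lemma (in abelian_group) plus_minus_cancel:
  "a \<in> carrier G \<Longrightarrow> b \<in> carrier G \<Longrightarrow> b \<oplus> (a \<ominus> b) = a"
  using minus_plus_cancel a_comm by simp

lemma (in abelian_group) minus_zero_right: "a \<in> carrier G \<Longrightarrow> a \<ominus> \<zero> = a"
  using minus_plus_cancel[of a \<zero>] by simp

section \<open>Torsion cohomology\<close>

text \<open>Stated for an arbitrary complex, since it is applied both to resolutions and to the
  cone. Values are compared on carriers only, so \<open>f\<close> need not be extensional.\<close>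

definition coboundary ::
    "('r, 'x) ring_scheme \<Rightarrow> (nat \<Rightarrow> ('r, 'a, 'y) module_scheme) \<Rightarrow> ('a \<Rightarrow> 'a)
      \<Rightarrow> ('r, 'n, 'z) module_scheme \<Rightarrow> nat \<Rightarrow> ('a \<Rightarrow> 'n) \<Rightarrow> bool" where
  "coboundary R F d N j f \<longleftrightarrow>
     (case j of
        0 \<Rightarrow> \<forall>z\<in>carrier (F 0). f z = \<zero>\<^bsub>N\<^esub>
      | Suc i \<Rightarrow> \<exists>g. lin R (F i) N g \<and> (\<forall>z\<in>carrier (F (Suc i)). f z = g (d z)))"

lemma coboundary_0: "coboundary R F d N 0 f \<longleftrightarrow> (\<forall>z\<in>carrier (F 0). f z = \<zero>\<^bsub>N\<^esub>)"
  and coboundary_Suc: "coboundary R F d N (Suc i) f \<longleftrightarrow>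
    (\<exists>g. lin R (F i) N g \<and> (\<forall>z\<in>carrier (F (Suc i)). f z = g (d z)))"
  by (simp_all add: coboundary_def)

text \<open>Expresses that the degree \<open>j\<close> cohomology of Hom(F, N) is torsion with
  respect to \<open>S\<close>, through cocycles alone and without forming the cohomology
  module.\<close>

definition torsion_coh ::
    "('r, 'x) ring_scheme \<Rightarrow> 'r set \<Rightarrow> (nat \<Rightarrow> ('r, 'a, 'y) module_scheme) \<Rightarrow> ('a \<Rightarrow> 'a)
      \<Rightarrow> ('r, 'n, 'z) module_scheme \<Rightarrow> nat \<Rightarrow> bool" where
  "torsion_coh R S F d N j \<longleftrightarrow>
     (\<forall>f. lin R (F j) N f \<and> (\<forall>z\<in>carrier (F (Suc j)). f (d z) = \<zero>\<^bsub>N\<^esub>) \<longrightarrow>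
        (\<exists>s\<in>S. coboundary R F d N j (\<lambda>z. s \<odot>\<^bsub>N\<^esub> f z)))"

text \<open>\<open>P\<close> resolves the image of \<open>aug\<close>, a submodule of
  \<open>L\<close>. \<open>C\<close> is exact except in degree one, where \<open>eps\<close>
  identifies cycles modulo boundaries with that same image. Neither map has to be onto
  \<open>L\<close>: in the application \<open>L\<close> is \<open>A\<close>, and the image is the
  kernel of the surjection.\<close>

locale shifted_resolution = cring R + L: module R L
  for R :: "('r, 'x) ring_scheme" (structure) and L :: "('r, 'l, 'y) module_scheme" +
  fixes BP :: "nat \<Rightarrow> 'b set" and dP :: "('b \<Rightarrow> 'r) \<Rightarrow> ('b \<Rightarrow> 'r)" and aug :: "('b \<Rightarrow> 'r) \<Rightarrow> 'l"
    and BC :: "nat \<Rightarrow> 'c set" and dC :: "('c \<Rightarrow> 'r) \<Rightarrow> ('c \<Rightarrow> 'r)" and eps :: "('c \<Rightarrow> 'r) \<Rightarrow> 'l"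
    and P C
  defines "P \<equiv> \<lambda>j. free_module R (BP j)" and "C \<equiv> \<lambda>j. free_module R (BC j)"
  assumes linP: "lin R (P (Suc j)) (P j) dP"
    and ddP: "z \<in> carrier (P (Suc (Suc j))) \<Longrightarrow> dP (dP z) = \<zero>\<^bsub>P j\<^esub>"
    and exP: "z \<in> carrier (P (Suc j)) \<Longrightarrow> dP z = \<zero>\<^bsub>P j\<^esub> \<Longrightarrow> z \<in> dP ` carrier (P (Suc (Suc j)))"
    and linC: "lin R (C (Suc j)) (C j) dC"
    and ddC: "x \<in> carrier (C (Suc (Suc j))) \<Longrightarrow> dC (dC x) = \<zero>\<^bsub>C j\<^esub>"
    and exC: "x \<in> carrier (C (Suc (Suc j))) \<Longrightarrow> dC x = \<zero>\<^bsub>C (Suc j)\<^esub> \<Longrightarrow>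
      x \<in> dC ` carrier (C (Suc (Suc (Suc j))))"
    and surjC: "carrier (C 0) \<subseteq> dC ` carrier (C (Suc 0))"
    and lin_aug: "lin R (P 0) L aug"
    and aug_d: "z \<in> carrier (P (Suc 0)) \<Longrightarrow> aug (dP z) = \<zero>\<^bsub>L\<^esub>"
    and ex_aug: "z \<in> carrier (P 0) \<Longrightarrow> aug z = \<zero>\<^bsub>L\<^esub> \<Longrightarrow> z \<in> dP ` carrier (P (Suc 0))"
    and lin_eps: "lin R (C (Suc 0)) L eps"
    and eps_d: "x \<in> carrier (C (Suc (Suc 0))) \<Longrightarrow> eps (dC x) = \<zero>\<^bsub>L\<^esub>"
    and ex_eps: "x \<in> carrier (C (Suc 0)) \<Longrightarrow> dC x = \<zero>\<^bsub>C 0\<^esub> \<Longrightarrow> eps x = \<zero>\<^bsub>L\<^esub> \<Longrightarrow>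
      x \<in> dC ` carrier (C (Suc (Suc 0)))"
    and eps_aug: "x \<in> carrier (C (Suc 0)) \<Longrightarrow> dC x = \<zero>\<^bsub>C 0\<^esub> \<Longrightarrow> eps x \<in> aug ` carrier (P 0)"
    and aug_eps: "z \<in> carrier (P 0) \<Longrightarrow> \<exists>x\<in>carrier (C (Suc 0)). dC x = \<zero>\<^bsub>C 0\<^esub> \<and> eps x = aug z"
begin

lemma modP: "module R (P j)" unfolding P_def by (rule module_free)
lemma modC: "module R (C j)" unfolding C_def by (rule module_free)

lemma P_lift:
  assumes "module R U" "module R W" "lin R W U f" "lin R (P j) U g"
    and "\<And>z. z \<in> carrier (P j) \<Longrightarrow> g z \<in> f ` carrier W"
  shows "\<exists>k. lin R (P j) W k \<and> (\<forall>z\<in>carrier (P j). f (k z) = g z)"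
  using assms unfolding P_def by (rule free_lift)

lemma C_lift:
  assumes "module R U" "module R W" "lin R W U f" "lin R (C j) U g"
    and "\<And>z. z \<in> carrier (C j) \<Longrightarrow> g z \<in> f ` carrier W"
  shows "\<exists>k. lin R (C j) W k \<and> (\<forall>z\<in>carrier (C j). f (k z) = g z)"
  using assms unfolding C_def by (rule free_lift)

text \<open>
  The maps \<open>g : P \<rightarrow> C[1]\<close>, \<open>a : C[1] \<rightarrow> P\<close> and the homotopy \<open>h\<close> between \<open>g a\<close> and the identity
  are built degree by degree; the last three conditions are what the next degree needs.
\<close>

definition partial_homotopy ::
    "nat \<Rightarrow> (('b \<Rightarrow> 'r) \<Rightarrow> ('c \<Rightarrow> 'r)) \<Rightarrow> (('c \<Rightarrow> 'r) \<Rightarrow> ('b \<Rightarrow> 'r)) \<Rightarrow> (('c \<Rightarrow> 'r) \<Rightarrow> ('c \<Rightarrow> 'r)) \<Rightarrow> bool" where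
  "partial_homotopy j g a h \<longleftrightarrow>
     lin R (P j) (C (Suc j)) g \<and> lin R (C (Suc j)) (P j) a \<and> lin R (C (Suc j)) (C (Suc (Suc j))) h \<and>
     (\<forall>z\<in>carrier (P (Suc j)). g (dP z) \<in> dC ` carrier (C (Suc (Suc j)))) \<and>
     (\<forall>x\<in>carrier (C (Suc (Suc j))). a (dC x) \<in> dP ` carrier (P (Suc j))) \<and>
     (\<forall>x\<in>carrier (C (Suc (Suc j))). dC x = dC (h (dC x)) \<oplus>\<^bsub>C (Suc j)\<^esub> g (a (dC x)))"

text \<open>Degree one of \<open>C\<close> is treated separately: it carries the homology, and the
  degree below it has no counterpart in \<open>P\<close>. The extra homotopy \<open>h0\<close> takes
  care of that lower degree.\<close>

lemma homotopy_0:
  "\<exists>h0 g a h. partial_homotopy 0 g a h \<and> lin R (C 0) (C (Suc 0)) h0 \<and>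
     (\<forall>x\<in>carrier (C (Suc 0)). x = dC (h x) \<oplus>\<^bsub>C (Suc 0)\<^esub> (h0 (dC x) \<oplus>\<^bsub>C (Suc 0)\<^esub> g (a x)))"
proof -
  interpret C0: module R "C 0" by (rule modC)
  interpret C1: module R "C (Suc 0)" by (rule modC)
  interpret C2: module R "C (Suc (Suc 0))" by (rule modC)
  interpret P0: module R "P 0" by (rule modP)
  note dcl = lin_closed[OF linC]
  \<comment> \<open>\<open>dC\<close> maps onto the free module \<open>C 0\<close>, so it has a
    linear section.\<close>
  obtain h0 where h0: "lin R (C 0) (C (Suc 0)) h0" "\<forall>x\<in>carrier (C 0). dC (h0 x) = x"
    using C_lift[OF modC modC linC lin_id] surjC by blast
  note h0c = lin_closed[OF h0(1)]
  \<comment> \<open>\<open>g\<close> must take values in cycles, so \<open>aug\<close> is lifted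
    through the restriction of \<open>eps\<close> to the module of cycles.\<close>
  let ?Z = "{x \<in> carrier (C (Suc 0)). dC x = \<zero>\<^bsub>C 0\<^esub>}"
  let ?K = "submod (C (Suc 0)) ?Z"
  have K: "module R ?K"
    by (rule module_submod[OF modC submodule_ker[OF modC modC linC]])
  have "lin R ?K L eps" using lin_eps by (auto simp: lin_def)
  moreover have "aug z \<in> eps ` carrier ?K" if "z \<in> carrier (P 0)" for z
    using aug_eps[OF that] by force
  ultimately obtain g where g: "lin R (P 0) ?K g" "\<forall>z\<in>carrier (P 0). eps (g z) = aug z"
    using P_lift[OF L.module_axioms K _ lin_aug] by blast
  have gl: "lin R (P 0) (C (Suc 0)) g" using g(1) by (auto simp: lin_def)
  have gd: "dC (g z) = \<zero>\<^bsub>C 0\<^esub>" if "z \<in> carrier (P 0)" for z using lin_closed[OF g(1) that] by simp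
  note gc = lin_closed[OF gl]
  \<comment> \<open>Subtracting \<open>h0 (dC x)\<close> turns \<open>x\<close> into a cycle, and on
    cycles the values of \<open>eps\<close> lie in the image of \<open>aug\<close>.\<close>
  have z1: "dC (x \<ominus>\<^bsub>C (Suc 0)\<^esub> h0 (dC x)) = \<zero>\<^bsub>C 0\<^esub>" if "x \<in> carrier (C (Suc 0))" for x
    using that dcl[OF that] h0 h0c by (simp add: lin_minus[OF modC modC linC] C0.minus_eq_zero_iff)
  have l1: "lin R (C (Suc 0)) (C (Suc 0)) (\<lambda>x. x \<ominus>\<^bsub>C (Suc 0)\<^esub> h0 (dC x))"
    by (intro lin_diff modC lin_id lin_comp[OF linC h0(1)])
  obtain a where a: "lin R (C (Suc 0)) (P 0) a"
      "\<forall>x\<in>carrier (C (Suc 0)). aug (a x) = eps (x \<ominus>\<^bsub>C (Suc 0)\<^esub> h0 (dC x))"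
    using C_lift[OF L.module_axioms modP lin_aug lin_comp[OF l1 lin_eps]] eps_aug z1 lin_closed[OF l1]
    by blast
  note ac = lin_closed[OF a(1)]
  \<comment> \<open>After subtraction of \<open>?r x\<close>, what remains of \<open>x\<close> is a
    cycle killed by \<open>eps\<close>, hence a boundary; \<open>h\<close> chooses preimages
    linearly.\<close>
  let ?r = "\<lambda>x. h0 (dC x) \<oplus>\<^bsub>C (Suc 0)\<^esub> g (a x)"
  have rl: "lin R (C (Suc 0)) (C (Suc 0)) ?r"
    by (intro lin_plus modC lin_comp[OF linC h0(1)] lin_comp[OF a(1) gl])
  have "x \<ominus>\<^bsub>C (Suc 0)\<^esub> ?r x \<in> dC ` carrier (C (Suc (Suc 0)))" if x: "x \<in> carrier (C (Suc 0))" for x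
  proof (rule ex_eps)
    note c = dcl[OF x] h0c[OF dcl[OF x]] ac[OF x] gc[OF ac[OF x]]
    show "x \<ominus>\<^bsub>C (Suc 0)\<^esub> ?r x \<in> carrier (C (Suc 0))" using x c by simp
    show "dC (x \<ominus>\<^bsub>C (Suc 0)\<^esub> ?r x) = \<zero>\<^bsub>C 0\<^esub>"
      using x c h0(2) gd by (simp add: lin_minus[OF modC modC linC] lin_add[OF linC] C0.minus_eq_zero_iff)
    have "eps (?r x) = eps (h0 (dC x)) \<oplus>\<^bsub>L\<^esub> (eps x \<ominus>\<^bsub>L\<^esub> eps (h0 (dC x)))"
      using x c g(2) a(2) by (simp add: lin_add[OF lin_eps] lin_minus[OF modC L.module_axioms lin_eps])
    also have "\<dots> = eps x" using x c lin_closed[OF lin_eps] by (simp add: L.M.plus_minus_cancel)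
    finally show "eps (x \<ominus>\<^bsub>C (Suc 0)\<^esub> ?r x) = \<zero>\<^bsub>L\<^esub>"
      using x c lin_closed[OF lin_eps] by (simp add: lin_minus[OF modC L.module_axioms lin_eps] L.M.minus_eq_zero_iff)
  qed
  then obtain h where h: "lin R (C (Suc 0)) (C (Suc (Suc 0))) h"
      "\<forall>x\<in>carrier (C (Suc 0)). dC (h x) = x \<ominus>\<^bsub>C (Suc 0)\<^esub> ?r x"
    using C_lift[OF modC modC linC lin_diff[OF modC lin_id rl]] by blast
  have main: "x = dC (h x) \<oplus>\<^bsub>C (Suc 0)\<^esub> ?r x" if "x \<in> carrier (C (Suc 0))" for x
    using h(2) that lin_closed[OF rl that] by (simp add: C1.M.minus_plus_cancel)
  have "g (dP z) \<in> dC ` carrier (C (Suc (Suc 0)))" if "z \<in> carrier (P (Suc 0))" for z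
    using lin_closed[OF linP that] g(2) gd gc aug_d[OF that] by (intro ex_eps) auto
  moreover have "a (dC x) \<in> dP ` carrier (P (Suc 0))" if "x \<in> carrier (C (Suc (Suc 0)))" for x
    using ac dcl[OF that] a(2) ddC[OF that] lin_zero[OF modC modC h0(1)] eps_d[OF that]
    by (intro ex_aug) (auto simp: C1.M.minus_zero_right)
  moreover have "dC x = dC (h (dC x)) \<oplus>\<^bsub>C (Suc 0)\<^esub> g (a (dC x))" if "x \<in> carrier (C (Suc (Suc 0)))" for x
    using main[OF dcl[OF that]] ddC[OF that] lin_zero[OF modC modC h0(1)] gc ac dcl[OF that]
    by simp
  ultimately have "partial_homotopy 0 g a h"
    unfolding partial_homotopy_def using gl a(1) h(1) by blast
  then show ?thesis using h0(1) main by blast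
qed

text \<open>\<open>g'\<close>, \<open>a'\<close> and \<open>h'\<close> are lifts through
  differentials. The conditions kept in \<open>partial_homotopy\<close> put the maps for
  \<open>g'\<close> and \<open>a'\<close> into the required images; its last condition says that
  \<open>x\<close> minus \<open>h (dC x)\<close> minus \<open>g' (a' x)\<close> is a cycle, so
  exactness of \<open>C\<close> provides \<open>h'\<close>.\<close>

lemma homotopy_Suc:
  assumes "partial_homotopy j g a h"
  shows "\<exists>g' a' h'. partial_homotopy (Suc j) g' a' h' \<and>
     (\<forall>x\<in>carrier (C (Suc (Suc j))). dP (a' x) = a (dC x)) \<and>
     (\<forall>x\<in>carrier (C (Suc (Suc j))).
        x = dC (h' x) \<oplus>\<^bsub>C (Suc (Suc j))\<^esub> (h (dC x) \<oplus>\<^bsub>C (Suc (Suc j))\<^esub> g' (a' x)))"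
proof -
  interpret C1: module R "C (Suc j)" by (rule modC)
  interpret C2: module R "C (Suc (Suc j))" by (rule modC)
  from assms have g: "lin R (P j) (C (Suc j)) g" and a: "lin R (C (Suc j)) (P j) a"
    and h: "lin R (C (Suc j)) (C (Suc (Suc j))) h"
    and gd: "\<And>z. z \<in> carrier (P (Suc j)) \<Longrightarrow> g (dP z) \<in> dC ` carrier (C (Suc (Suc j)))"
    and ad: "\<And>x. x \<in> carrier (C (Suc (Suc j))) \<Longrightarrow> a (dC x) \<in> dP ` carrier (P (Suc j))"
    and hd: "\<And>x. x \<in> carrier (C (Suc (Suc j))) \<Longrightarrow> dC x = dC (h (dC x)) \<oplus>\<^bsub>C (Suc j)\<^esub> g (a (dC x))"
    unfolding partial_homotopy_def by blast+
  note dcl = lin_closed[OF linC]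
  obtain g' where g': "lin R (P (Suc j)) (C (Suc (Suc j))) g'"
      "\<forall>z\<in>carrier (P (Suc j)). dC (g' z) = g (dP z)"
    using P_lift[OF modC modC linC lin_comp[OF linP g] gd] by blast
  obtain a' where a': "lin R (C (Suc (Suc j))) (P (Suc j)) a'"
      "\<forall>x\<in>carrier (C (Suc (Suc j))). dP (a' x) = a (dC x)"
    using C_lift[OF modP modP linP lin_comp[OF linC a] ad] by blast
  note gc = lin_closed[OF g'(1)] and ac = lin_closed[OF a'(1)] and hc = lin_closed[OF h]
  let ?r = "\<lambda>x. h (dC x) \<oplus>\<^bsub>C (Suc (Suc j))\<^esub> g' (a' x)"
  have rl: "lin R (C (Suc (Suc j))) (C (Suc (Suc j))) ?r"
    by (intro lin_plus modC lin_comp[OF linC h] lin_comp[OF a'(1) g'(1)])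
  have "x \<ominus>\<^bsub>C (Suc (Suc j))\<^esub> ?r x \<in> dC ` carrier (C (Suc (Suc (Suc j))))"
    if x: "x \<in> carrier (C (Suc (Suc j)))" for x
  proof (rule exC)
    note c = dcl[OF x] hc[OF dcl[OF x]] ac[OF x] gc[OF ac[OF x]]
    show "x \<ominus>\<^bsub>C (Suc (Suc j))\<^esub> ?r x \<in> carrier (C (Suc (Suc j)))" using x c by simp
    have "dC (?r x) = dC (h (dC x)) \<oplus>\<^bsub>C (Suc j)\<^esub> g (a (dC x))"
      using x c g'(2) a'(2) by (simp add: lin_add[OF linC])
    then show "dC (x \<ominus>\<^bsub>C (Suc (Suc j))\<^esub> ?r x) = \<zero>\<^bsub>C (Suc j)\<^esub>"
      using hd[OF x] x c lin_closed[OF rl x] dcl[OF lin_closed[OF rl x]]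
      by (simp add: lin_minus[OF modC modC linC] C1.M.minus_eq_zero_iff)
  qed
  then obtain h' where h': "lin R (C (Suc (Suc j))) (C (Suc (Suc (Suc j)))) h'"
      "\<forall>x\<in>carrier (C (Suc (Suc j))). dC (h' x) = x \<ominus>\<^bsub>C (Suc (Suc j))\<^esub> ?r x"
    using C_lift[OF modC modC linC lin_diff[OF modC lin_id rl]] by blast
  have main: "x = dC (h' x) \<oplus>\<^bsub>C (Suc (Suc j))\<^esub> ?r x" if "x \<in> carrier (C (Suc (Suc j)))" for x
    using h'(2) that lin_closed[OF rl that] by (simp add: C2.M.minus_plus_cancel)
  have "g' (dP z) \<in> dC ` carrier (C (Suc (Suc (Suc j))))" if "z \<in> carrier (P (Suc (Suc j)))" for z
    using lin_closed[OF linP that] g'(2) gc ddP[OF that] lin_zero[OF modP modC g] by (intro exC) auto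
  moreover have "a' (dC x) \<in> dP ` carrier (P (Suc (Suc j)))" if "x \<in> carrier (C (Suc (Suc (Suc j))))" for x
    using ac dcl[OF that] a'(2) ddC[OF that] lin_zero[OF modC modP a] by (intro exP) auto
  moreover have "dC x = dC (h' (dC x)) \<oplus>\<^bsub>C (Suc (Suc j))\<^esub> g' (a' (dC x))"
    if "x \<in> carrier (C (Suc (Suc (Suc j))))" for x
    using main[OF dcl[OF that]] ddC[OF that] lin_zero[OF modC modC h] gc ac dcl[OF that] by simp
  ultimately have "partial_homotopy (Suc j) g' a' h'"
    unfolding partial_homotopy_def using g'(1) a'(1) h'(1) by blast
  then show ?thesis using a'(2) main by blast
qed

lemma homotopy_ex: "\<exists>g a h. partial_homotopy j g a h"
proof (induction j)
  case 0
  then show ?case using homotopy_0 by blast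
next
  case (Suc j)
  then show ?case using homotopy_Suc by blast
qed

text \<open>For a cocycle \<open>c\<close> on \<open>C\<close>, the composite \<open>c g\<close> is
  a cocycle on \<open>P\<close>, and the homotopy shows that \<open>c\<close> and
  \<open>c g a\<close> differ by a coboundary. Hence the homotopy between \<open>g a\<close> and the
  identity is enough; none is needed for \<open>a g\<close>.\<close>

theorem torsion_shift:
  assumes N: "module R N" and S: "S \<subseteq> carrier R" and tors: "torsion_coh R S P dP N j"
  shows "torsion_coh R S C dC N (Suc j)"
  unfolding torsion_coh_def
proof (intro allI impI, elim conjE)
  interpret N: module R N by fact
  fix c assume c: "lin R (C (Suc j)) N c" and cd: "\<forall>x\<in>carrier (C (Suc (Suc j))). c (dC x) = \<zero>\<^bsub>N\<^esub>"
  note dcl = lin_closed[OF linC] and cc = lin_closed[OF c]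
  \<comment> \<open>The computation common to both cases. \<open>e\<close> is the zero map for
    \<open>j = 0\<close>, and otherwise the cochain on \<open>P\<close> that bounds a multiple of
    \<open>c g\<close>, pulled back along \<open>a\<close>.\<close>
  have conclude: "\<exists>s\<in>S. \<exists>e. lin R (C j) N e \<and> (\<forall>x\<in>carrier (C (Suc j)). s \<odot>\<^bsub>N\<^esub> c x = e (dC x))"
    if s: "s \<in> S" and e: "lin R (C j) N e" and h: "lin R (C j) (C (Suc j)) h"
      and h': "lin R (C (Suc j)) (C (Suc (Suc j))) h'" and ga: "lin R (C (Suc j)) (C (Suc j)) ga"
      and ge: "\<And>x. x \<in> carrier (C (Suc j)) \<Longrightarrow> s \<odot>\<^bsub>N\<^esub> c (ga x) = e (dC x)"
      and main: "\<And>x. x \<in> carrier (C (Suc j)) \<Longrightarrow>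
         x = dC (h' x) \<oplus>\<^bsub>C (Suc j)\<^esub> (h (dC x) \<oplus>\<^bsub>C (Suc j)\<^esub> ga x)"
    for s e h h' ga
  proof (rule bexI[OF _ s], intro exI conjI ballI)
    interpret C1: module R "C (Suc j)" by (rule modC)
    show "lin R (C j) N (\<lambda>y. s \<odot>\<^bsub>N\<^esub> c (h y) \<oplus>\<^bsub>N\<^esub> e y)"
      using s S by (intro lin_plus N lin_scale e lin_comp[OF h c]) auto
    fix x assume x: "x \<in> carrier (C (Suc j))"
    have k: "h' x \<in> carrier (C (Suc (Suc j)))" "dC (h' x) \<in> carrier (C (Suc j))"
      "h (dC x) \<in> carrier (C (Suc j))" "ga x \<in> carrier (C (Suc j))"
      using x dcl lin_closed[OF h] lin_closed[OF h'] lin_closed[OF ga] by auto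
    have "c x = c (h (dC x)) \<oplus>\<^bsub>N\<^esub> c (ga x)"
      using arg_cong[OF main[OF x], of c] k cd cc by (simp add: lin_add[OF c])
    then show "s \<odot>\<^bsub>N\<^esub> c x = s \<odot>\<^bsub>N\<^esub> c (h (dC x)) \<oplus>\<^bsub>N\<^esub> e (dC x)"
      using k cc s S ge[OF x] by (auto simp: N.smult_r_distr subset_iff)
  qed
  show "\<exists>s\<in>S. coboundary R C dC N (Suc j) (\<lambda>x. s \<odot>\<^bsub>N\<^esub> c x)"
  proof (cases j)
    case 0
    obtain h0 g a h where *: "partial_homotopy 0 g a h" "lin R (C 0) (C (Suc 0)) h0"
      "\<And>x. x \<in> carrier (C (Suc 0)) \<Longrightarrow> x = dC (h x) \<oplus>\<^bsub>C (Suc 0)\<^esub> (h0 (dC x) \<oplus>\<^bsub>C (Suc 0)\<^esub> g (a x))"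
      using homotopy_0 by blast
    have g: "lin R (P 0) (C (Suc 0)) g" and a: "lin R (C (Suc 0)) (P 0) a"
      and h: "lin R (C (Suc 0)) (C (Suc (Suc 0))) h"
      and gd: "\<And>z. z \<in> carrier (P (Suc 0)) \<Longrightarrow> g (dP z) \<in> dC ` carrier (C (Suc (Suc 0)))"
      using *(1) unfolding partial_homotopy_def by blast+
    have "c (g (dP z)) = \<zero>\<^bsub>N\<^esub>" if "z \<in> carrier (P (Suc 0))" for z
      using gd[OF that] cd 0 by auto
    then obtain s where s: "s \<in> S" "\<forall>z\<in>carrier (P 0). s \<odot>\<^bsub>N\<^esub> c (g z) = \<zero>\<^bsub>N\<^esub>"
      using tors lin_comp[OF g c[unfolded 0]] unfolding torsion_coh_def 0 coboundary_0 by fastforce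
    show ?thesis
      unfolding coboundary_Suc using conclude[OF s(1) lin_const_zero[OF N], of h0 h "\<lambda>x. g (a x)"] * h s(2)
        lin_closed[OF a] lin_comp[OF a g] 0 by auto
  next
    case (Suc i)
    \<comment> \<open>The maps in two adjacent degrees have to fit together, so existence is used
      one degree lower and extended once by \<open>homotopy_Suc\<close>.\<close>
    obtain g a h where 1: "partial_homotopy i g a h" using homotopy_ex by blast
    obtain g' a' h' where 2: "partial_homotopy j g' a' h'"
      "\<And>x. x \<in> carrier (C (Suc j)) \<Longrightarrow> dP (a' x) = a (dC x)"
      "\<And>x. x \<in> carrier (C (Suc j)) \<Longrightarrow>
        x = dC (h' x) \<oplus>\<^bsub>C (Suc j)\<^esub> (h (dC x) \<oplus>\<^bsub>C (Suc j)\<^esub> g' (a' x))"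
      using homotopy_Suc[OF 1] unfolding Suc by blast
    have a: "lin R (C j) (P i) a" and h: "lin R (C j) (C (Suc j)) h"
      using 1 unfolding partial_homotopy_def Suc by blast+
    have g': "lin R (P j) (C (Suc j)) g'" and a': "lin R (C (Suc j)) (P j) a'"
      and h': "lin R (C (Suc j)) (C (Suc (Suc j))) h'"
      and gd: "\<And>z. z \<in> carrier (P (Suc j)) \<Longrightarrow> g' (dP z) \<in> dC ` carrier (C (Suc (Suc j)))"
      using 2(1) unfolding partial_homotopy_def by blast+
    have "c (g' (dP z)) = \<zero>\<^bsub>N\<^esub>" if "z \<in> carrier (P (Suc j))" for z
      using gd[OF that] cd by auto
    then obtain s v where s: "s \<in> S" "lin R (P i) N v"
        "\<forall>z\<in>carrier (P j). s \<odot>\<^bsub>N\<^esub> c (g' z) = v (dP z)"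
      using tors lin_comp[OF g' c] unfolding torsion_coh_def Suc coboundary_Suc by fastforce
    show ?thesis
      unfolding coboundary_Suc using conclude[OF s(1) lin_comp[OF a s(2)] h h' lin_comp[OF a' g']] s(3) 2(2,3) lin_closed[OF a']
      by auto
  qed
qed

end

section \<open>The cone of a surjection\<close>

context cring
begin

text \<open>In degree zero \<open>res_d\<close> is the zero map and not the augmentation. This keeps
  the formula for the cone differential uniform in all degrees.\<close>

lemma res_d_degree_0:
  assumes "z \<in> carrier (free_res R A 0)"
  shows "res_d R z = (\<lambda>u. \<zero>)"
proof -
  have "z u \<otimes> res_d_gen R u v = \<zero>" if "z u \<noteq> \<zero>" for u v
    using that assms free_closed[of z] by (auto simp: free_res_def free_carrier_iff subset_iff)
  then have "(\<Oplus>u\<in>{u. z u \<noteq> \<zero>}. z u \<otimes> res_d_gen R u v) = (\<Oplus>u\<in>{u. z u \<noteq> \<zero>}. \<zero>)" for v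
    by (intro add.finprod_cong) (auto simp: simp_implies_def)
  then show ?thesis by (simp add: res_d_def)
qed

lemma res_d_d:
  assumes "module R A" "z \<in> carrier (free_res R A (Suc k))"
  shows "res_d R (res_d R z) = (\<lambda>u. \<zero>)"
proof (cases k)
  case 0
  then show ?thesis using lin_closed[OF lin_res_d[OF assms(1)] assms(2)] res_d_degree_0 by simp
next
  case (Suc i)
  then show ?thesis using res_vanishes_d[OF assms] by (simp add: res_vanishes_def)
qed

end

locale module_surjection = cring R + A: module R A + B: module R B
  for R :: "('r, 'x) ring_scheme" (structure) and A :: "('r, 'm, 'y) module_scheme"
    and B :: "('r, 'n, 'z) module_scheme" +
  fixes h
  assumes h: "lin R A B h" and surj: "carrier B \<subseteq> h ` carrier A"
begin

lemmas modA = A.module_axioms and modB = B.module_axioms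
lemmas dA = lin_res_d[OF modA] and dB = lin_res_d[OF modB]
lemmas augA = lin_res_aug[OF modA] and augB = lin_res_aug[OF modB]
lemmas mapAB = lin_res_map[OF modA modB h]
lemmas d_map = res_d_map[OF modA modB h] and aug_map = res_aug_map[OF modA modB h]

abbreviation FA where "FA \<equiv> free_res R A"
abbreviation FB where "FB \<equiv> free_res R B"

definition Ker :: "('r, 'm, 'y) module_scheme" where
  "Ker = submod A {x \<in> carrier A. h x = \<zero>\<^bsub>B\<^esub>}"

lemma module_Ker: "module R Ker"
  unfolding Ker_def
  by (rule module_submod[OF modA submodule_ker[OF modA modB h]])

lemma carrier_Ker: "x \<in> carrier Ker \<longleftrightarrow> x \<in> carrier A \<and> h x = \<zero>\<^bsub>B\<^esub>"
  by (simp add: Ker_def)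

definition gens' :: "nat \<Rightarrow> ('r, 'm) gen set" where
  "gens' j = (case j of 0 \<Rightarrow> {} | Suc i \<Rightarrow> res_gens R A i)"

definition cone :: "nat \<Rightarrow> ('r, ('r, 'n) gen + ('r, 'm) gen \<Rightarrow> 'r) module" where
  "cone j = free_module R (res_gens R B j <+> gens' j)"

text \<open>The sign makes the square zero: in the first component \<open>h (d y)\<close> from the
  chain map meets \<open>h (- d y)\<close> from the second component.\<close>

definition cone_d ::
    "(('r, 'n) gen + ('r, 'm) gen \<Rightarrow> 'r) \<Rightarrow> (('r, 'n) gen + ('r, 'm) gen \<Rightarrow> 'r)" where
  "cone_d z = case_sum (\<lambda>b. res_d R (\<lambda>b. z (Inl b)) b \<oplus> res_map R h (\<lambda>b. z (Inr b)) b)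
     (\<lambda>b. \<ominus> res_d R (\<lambda>b. z (Inr b)) b)"

lemma lin_d': "lin R (free_module R (gens' (Suc j))) (free_module R (gens' j)) (res_d R)"
proof (cases j)
  case 0
  have "lin R (free_module R (gens' (Suc j))) (free_module R (gens' j))
      (\<lambda>x. \<zero>\<^bsub>free_module R (gens' j)\<^esub>)"
    by (rule lin_const_zero[OF module_free])
  moreover have "res_d R x = \<zero>\<^bsub>free_module R (gens' j)\<^esub>" if "x \<in> carrier (free_module R (gens' (Suc j)))" for x
    using res_d_degree_0[of x A] that 0 by (simp add: gens'_def free_res_def free_simps del: res_gens.simps)
  ultimately show ?thesis
    by (subst lin_cong[OF module_free, where g = "\<lambda>x. \<zero>\<^bsub>free_module R (gens' j)\<^esub>"])
next
  case (Suc i)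
  then show ?thesis using dA[of i] by (simp add: gens'_def free_res_def del: res_gens.simps)
qed

lemma lin_map': "lin R (free_module R (gens' (Suc j))) (FB j) (res_map R h)"
  using mapAB[of j] by (simp add: gens'_def free_res_def)

lemma fst_lin: "lin R (cone j) (FB j) (\<lambda>z b. z (Inl b))"
  unfolding cone_def free_res_def by (rule free_proj_Inl)

lemma snd_lin: "lin R (cone j) (free_module R (gens' j)) (\<lambda>z b. z (Inr b))"
  unfolding cone_def by (rule free_proj_Inr)

lemma snd_closed: "z \<in> carrier (cone (Suc j)) \<Longrightarrow> (\<lambda>b. z (Inr b)) \<in> carrier (FA j)"
  using lin_closed[OF snd_lin, of z "Suc j"] by (simp add: gens'_def free_res_def)

lemma pair_closed:
  "x \<in> carrier (FB (Suc j)) \<Longrightarrow> y \<in> carrier (FA j) \<Longrightarrow>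
    case_sum x y \<in> carrier (cone (Suc j))"
  unfolding cone_def free_res_def gens'_def by (simp add: free_pair_closed del: res_gens.simps)

lemma cone_d_pair:
  "cone_d (case_sum x y) = case_sum (\<lambda>b. res_d R x b \<oplus> res_map R h y b) (\<lambda>b. \<ominus> res_d R y b)"
  by (simp add: cone_d_def)

lemma cone_d_lin: "lin R (cone (Suc j)) (cone j) cone_d"
proof -
  have 1: "lin R (cone (Suc j)) (free_module R (res_gens R B j)) (\<lambda>z. res_d R (\<lambda>b. z (Inl b)))"
    using lin_comp[OF fst_lin dB] by (simp only: free_res_def)
  have 2: "lin R (cone (Suc j)) (free_module R (res_gens R B j)) (\<lambda>z. res_map R h (\<lambda>b. z (Inr b)))"
    using lin_comp[OF snd_lin lin_map'] by (simp only: free_res_def)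
  have 3: "lin R (cone (Suc j)) (free_module R (gens' j)) (\<lambda>z. res_d R (\<lambda>b. z (Inr b)))"
    by (rule lin_comp[OF snd_lin lin_d'])
  have "lin R (cone (Suc j)) (cone j)
    (\<lambda>z. case_sum (res_d R (\<lambda>b. z (Inl b)) \<oplus>\<^bsub>free_module R (res_gens R B j)\<^esub> res_map R h (\<lambda>b. z (Inr b)))
        (\<ominus>\<^bsub>free_module R (gens' j)\<^esub> res_d R (\<lambda>b. z (Inr b))))"
    unfolding cone_def[of j]
    by (intro free_pair_lin lin_plus[OF module_free] lin_uminus[OF module_free] 1 2 3)
  moreover have "cone_d z = case_sum (res_d R (\<lambda>b. z (Inl b)) \<oplus>\<^bsub>free_module R (res_gens R B j)\<^esub> res_map R h (\<lambda>b. z (Inr b)))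
        (\<ominus>\<^bsub>free_module R (gens' j)\<^esub> res_d R (\<lambda>b. z (Inr b)))" if "z \<in> carrier (cone (Suc j))" for z
    using lin_closed[OF 3 that] by (simp add: cone_d_def free_simps free_uminus)
  moreover have "module R (cone (Suc j))" unfolding cone_def by (rule module_free)
  ultimately show ?thesis by (subst lin_cong) auto
qed

lemma free_res_zero: "\<zero>\<^bsub>free_res R U j\<^esub> = (\<lambda>u. \<zero>)"
  and cone_zero: "\<zero>\<^bsub>cone j\<^esub> = (\<lambda>u. \<zero>)"
  by (simp_all add: free_res_def cone_def free_simps)

lemma free_res_simps:
  "z \<oplus>\<^bsub>free_res R U j\<^esub> w = (\<lambda>b. z b \<oplus> w b)"
  "z \<in> carrier (free_res R U j) \<Longrightarrow> \<ominus>\<^bsub>free_res R U j\<^esub> z = (\<lambda>b. \<ominus> z b)"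
  by (simp_all add: free_res_def free_simps free_uminus)

lemma free_res_closed: "z \<in> carrier (free_res R U j) \<Longrightarrow> z b \<in> carrier R"
  by (simp add: free_res_def free_closed)

text \<open>Write \<open>y = d y'\<close>; then \<open>x + h y'\<close> is a cycle, hence
  \<open>d x'\<close>, and \<open>(x', - y')\<close> is the preimage. Phrasing the hypothesis by
  \<open>res_vanishes\<close> covers degree one, where it concerns the augmentation, together with
  the higher degrees.\<close>

lemma cone_exact:
  assumes x: "x \<in> carrier (FB (Suc j))" and y: "y \<in> carrier (FA j)"
    and van: "res_vanishes R A j y" and eq: "\<And>b. res_d R x b \<oplus> res_map R h y b = \<zero>"
  shows "case_sum x y \<in> cone_d ` carrier (cone (Suc (Suc j)))"
proof -
  interpret FA: module R "FA (Suc j)" by (rule module_free_res)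
  interpret FA0: module R "FA j" by (rule module_free_res)
  interpret FB: module R "FB (Suc j)" by (rule module_free_res)
  obtain y' where y': "y' \<in> carrier (FA (Suc j))" "res_d R y' = y"
    using res_vanishes_imp_d[OF modA y van] by blast
  note my = lin_closed[OF mapAB y'(1)]
  let ?w = "x \<oplus>\<^bsub>FB (Suc j)\<^esub> res_map R h y'"
  have "res_d R ?w = (\<lambda>b. \<zero>)"
    using lin_add[OF dB x my] d_map[OF y'(1)] y'(2) eq
    by (simp add: free_res_simps)
  then obtain x' where x': "x' \<in> carrier (FB (Suc (Suc j)))" "res_d R x' = ?w"
    using res_vanishes_imp_d[OF modB, of ?w "Suc j"] x my by (auto simp: res_vanishes_def)
  let ?y = "\<ominus>\<^bsub>FA (Suc j)\<^esub> y'"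
  have "res_map R h ?y = (\<lambda>b. \<ominus> res_map R h y' b)" "res_d R ?y = (\<lambda>b. \<ominus> y b)"
    using lin_a_inv[OF module_free_res module_free_res mapAB y'(1)] lin_a_inv[OF module_free_res module_free_res dA y'(1)]
      my y y'(2) by (simp_all add: free_res_simps)
  then have "cone_d (case_sum x' ?y) = case_sum x y"
    using x' x y my by (simp add: cone_d_pair free_res_simps free_res_closed a_assoc r_neg)
  moreover have "case_sum x' ?y \<in> carrier (cone (Suc (Suc j)))"
    using x' y' by (intro pair_closed) auto
  ultimately show ?thesis by (metis imageI)
qed

lemma cone_cycle:
  assumes z: "z \<in> carrier (cone (Suc j))" and d: "cone_d z = (\<lambda>b. \<zero>)"
  shows "res_d R (\<lambda>b. z (Inr b)) = (\<lambda>b. \<zero>)"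
    and "res_d R (\<lambda>b. z (Inl b)) b \<oplus> res_map R h (\<lambda>b. z (Inr b)) b = \<zero>"
proof -
  have c: "res_d R (\<lambda>b. z (Inr b)) b \<in> carrier R" for b
    using free_closed[OF lin_closed[OF lin_comp[OF snd_lin lin_d'] z]] .
  have "\<ominus> res_d R (\<lambda>b. z (Inr b)) b = \<zero>" for b using fun_cong[OF d, of "Inr b"] by (simp add: cone_d_def)
  then show "res_d R (\<lambda>b. z (Inr b)) = (\<lambda>b. \<zero>)" using c by (metis minus_minus minus_zero)
  show "res_d R (\<lambda>b. z (Inl b)) b \<oplus> res_map R h (\<lambda>b. z (Inr b)) b = \<zero>"
    using fun_cong[OF d, of "Inl b"] by (simp add: cone_d_def)
qed

lemma cone_d_d:
  assumes z: "z \<in> carrier (cone (Suc (Suc j)))"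
  shows "cone_d (cone_d z) = (\<lambda>b. \<zero>)"
proof -
  define x y where "x = (\<lambda>b. z (Inl b))" and "y = (\<lambda>b. z (Inr b))"
  have x: "x \<in> carrier (FB (Suc (Suc j)))" and y: "y \<in> carrier (FA (Suc j))"
    using lin_closed[OF fst_lin z] snd_closed[OF z] by (auto simp: x_def y_def)
  have zz: "z = case_sum x y" by (simp add: x_def y_def free_pair_eta)
  note c = lin_closed[OF dA y] lin_closed[OF dB x] lin_closed[OF mapAB y]
  have "res_d R (res_d R x \<oplus>\<^bsub>FB (Suc j)\<^esub> res_map R h y)
      = (\<lambda>u. \<zero>) \<oplus>\<^bsub>FB j\<^esub> res_map R h (res_d R y)"
    using lin_add[OF dB c(2,3)] res_d_d[OF modB x] d_map[OF y]
    by simp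
  then have "res_d R (res_d R x \<oplus>\<^bsub>FB (Suc j)\<^esub> res_map R h y) = (\<lambda>b. res_map R h (res_d R y) b)"
    using lin_closed[OF mapAB c(1)] by (simp add: free_res_simps free_res_closed)
  moreover have "res_map R h (\<ominus>\<^bsub>FA j\<^esub> res_d R y) = (\<lambda>b. \<ominus> res_map R h (res_d R y) b)"
    using c lin_closed[OF mapAB c(1)] lin_a_inv[OF module_free_res module_free_res mapAB c(1)]
    by (simp add: free_res_simps)
  moreover have "res_d R (\<ominus>\<^bsub>FA j\<^esub> res_d R y) = (\<lambda>b. \<zero>)"
  proof -
    interpret FA: module R "FA j" by (rule module_free_res)
    have "res_d R (\<ominus>\<^bsub>FA (Suc j)\<^esub> y) = \<ominus>\<^bsub>FA j\<^esub> res_d R y"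
      by (rule lin_a_inv[OF module_free_res module_free_res dA y])
    then show ?thesis
      using res_d_d[OF modA, of "\<ominus>\<^bsub>FA (Suc j)\<^esub> y" j]
        module.axioms(2)[OF module_free_res[of A "Suc j"]] y by (simp add: abelian_group.a_inv_closed)
  qed
  ultimately have eqs: "res_d R (\<lambda>b. res_d R x b \<oplus> res_map R h y b) = (\<lambda>b. res_map R h (res_d R y) b)"
      "res_map R h (\<lambda>b. \<ominus> res_d R y b) = (\<lambda>b. \<ominus> res_map R h (res_d R y) b)"
      "res_d R (\<lambda>b. \<ominus> res_d R y b) = (\<lambda>b. \<zero>)"
    using c by (simp_all only: free_res_simps)
  have "cone_d (cone_d z) = case_sum (\<lambda>b. \<zero>) (\<lambda>b. \<zero>)"
    unfolding zz cone_d_pair eqs using free_res_closed[OF lin_closed[OF mapAB c(1)]]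
    by (simp only: r_neg minus_zero)
  then show ?thesis by (auto simp: fun_eq_iff split: sum.split)
qed

text \<open>Surjectivity of \<open>h\<close> enters here: the augmentation of \<open>x\<close> is
  \<open>h l\<close> for some \<open>l\<close> in \<open>A\<close>, and subtracting the image of a
  lift of \<open>l\<close> leaves augmentation zero, hence a boundary.\<close>

lemma cone_surj: "carrier (cone 0) \<subseteq> cone_d ` carrier (cone (Suc 0))"
proof
  fix z assume z: "z \<in> carrier (cone 0)"
  interpret F: module R "FB 0" by (rule module_free_res)
  define x where "x = (\<lambda>b. z (Inl b))"
  have x: "x \<in> carrier (FB 0)" using lin_closed[OF fst_lin z] by (simp add: x_def)
  have "(\<lambda>b. z (Inr b)) \<in> carrier (free_module R (gens' 0))" by (rule lin_closed[OF snd_lin z])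
  then have zr: "z (Inr b) = \<zero>" for b by (auto simp: gens'_def free_carrier_iff)
  have "res_aug R B x \<in> carrier B" using lin_closed[OF augB x] .
  then obtain l where l: "l \<in> carrier A" "res_aug R B x = h l" using surj by blast
  obtain y where y: "y \<in> carrier (FA 0)" "res_aug R A y = l"
    using A.res_aug_surj l(1) by (metis imageE)
  note my = lin_closed[OF mapAB y(1)]
  have "res_aug R B (x \<ominus>\<^bsub>FB 0\<^esub> res_map R h y) = \<zero>\<^bsub>B\<^esub>"
    using x my y l lin_closed[OF h l(1)] aug_map[OF y(1)]
    by (simp add: lin_minus[OF module_free_res modB augB] B.M.minus_eq_zero_iff)
  then obtain x' where x': "x' \<in> carrier (FB (Suc 0))"
      "res_d R x' = x \<ominus>\<^bsub>FB 0\<^esub> res_map R h y"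
    using res_vanishes_imp_d[OF modB, of "x \<ominus>\<^bsub>FB 0\<^esub> res_map R h y" 0] x my
    by (auto simp: res_vanishes_def)
  have "(\<lambda>b. res_d R x' b \<oplus> res_map R h y b) = x"
    using F.M.minus_plus_cancel[OF x my] x'(2) by (simp add: free_res_simps)
  then have "cone_d (case_sum x' y) = case_sum x (\<lambda>b. \<zero>)"
    by (simp add: cone_d_pair res_d_degree_0[OF y(1)])
  also have "\<dots> = z" using zr by (auto simp: x_def fun_eq_iff split: sum.split)
  finally show "z \<in> cone_d ` carrier (cone (Suc 0))"
    using pair_closed[OF x'(1) y(1)] by (metis imageI)
qed

text \<open>With \<open>A\<close> in the place of \<open>L\<close>, \<open>aug\<close> has image
  \<open>Ker\<close> and \<open>eps\<close> reads off the component of the cone over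
  \<open>A\<close>. A cycle \<open>(x, y)\<close> in degree one has \<open>d x + h y = 0\<close>, so
  \<open>h\<close> kills the augmentation of \<open>y\<close>. Conversely, an element of
  \<open>Ker\<close> lifts to some \<open>y\<close> for which \<open>h y\<close> is a
  boundary.\<close>

sublocale shifted: shifted_resolution R A "res_gens R Ker" "res_d R" "res_aug R Ker"
  "\<lambda>j. res_gens R B j <+> gens' j" cone_d "\<lambda>z. res_aug R A (\<lambda>b. z (Inr b))" "free_res R Ker" cone
proof (unfold_locales, unfold free_res_def[symmetric] cone_def[symmetric])
  note dK = lin_res_d[OF module_Ker]
  note aK = lin_res_aug[OF module_Ker]
  show "lin R (free_res R Ker (Suc j)) (free_res R Ker j) (res_d R)" for j by (rule dK)
  show "res_d R (res_d R z) = \<zero>\<^bsub>free_res R Ker j\<^esub>"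
    if "z \<in> carrier (free_res R Ker (Suc (Suc j)))" for z j
    using res_d_d[OF module_Ker that] by (simp add: free_res_zero)
  show "z \<in> res_d R ` carrier (free_res R Ker (Suc (Suc j)))"
    if "z \<in> carrier (free_res R Ker (Suc j))" "res_d R z = \<zero>\<^bsub>free_res R Ker j\<^esub>" for z j
    using res_vanishes_imp_d[OF module_Ker that(1)] that(2) by (simp add: res_vanishes_def free_res_zero)
  show "lin R (cone (Suc j)) (cone j) cone_d" for j by (rule cone_d_lin)
  show "cone_d (cone_d x) = \<zero>\<^bsub>cone j\<^esub>" if "x \<in> carrier (cone (Suc (Suc j)))" for x j
    using cone_d_d[OF that] by (simp add: cone_zero)
  show "x \<in> cone_d ` carrier (cone (Suc (Suc (Suc j))))"
    if x: "x \<in> carrier (cone (Suc (Suc j)))" and d: "cone_d x = \<zero>\<^bsub>cone (Suc j)\<^esub>" for x j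
    using cone_exact[OF lin_closed[OF fst_lin x] snd_closed[OF x]] cone_cycle[OF x] d
    by (simp add: cone_zero res_vanishes_def free_pair_eta)
  show "carrier (cone 0) \<subseteq> cone_d ` carrier (cone (Suc 0))" by (rule cone_surj)
  have KA: "lin R Ker A (\<lambda>x. x)" by (auto simp: Ker_def intro!: linI)
  show "lin R (free_res R Ker 0) A (res_aug R Ker)" using lin_comp[OF aK KA] by simp
  show "res_aug R Ker (res_d R z) = \<zero>\<^bsub>A\<^esub>" if "z \<in> carrier (free_res R Ker (Suc 0))" for z
    using res_vanishes_d[OF module_Ker that] by (simp add: res_vanishes_def Ker_def)
  show "z \<in> res_d R ` carrier (free_res R Ker (Suc 0))"
    if "z \<in> carrier (free_res R Ker 0)" "res_aug R Ker z = \<zero>\<^bsub>A\<^esub>" for z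
    using res_vanishes_imp_d[OF module_Ker that(1)] that(2) by (simp add: res_vanishes_def Ker_def)
  have sl: "lin R (cone (Suc 0)) (FA 0) (\<lambda>z b. z (Inr b))"
    using snd_lin[of "Suc 0"] by (simp add: gens'_def free_res_def)
  show "lin R (cone (Suc 0)) A (\<lambda>z. res_aug R A (\<lambda>b. z (Inr b)))"
    by (rule lin_comp[OF sl augA])
  show "res_aug R A (\<lambda>b. cone_d x (Inr b)) = \<zero>\<^bsub>A\<^esub>" if x: "x \<in> carrier (cone (Suc (Suc 0)))" for x
  proof -
    note y = snd_closed[OF x]
    have "(\<lambda>b. cone_d x (Inr b)) = \<ominus>\<^bsub>FA 0\<^esub> res_d R (\<lambda>b. x (Inr b))"
      using lin_closed[OF dA y] by (simp add: cone_d_def free_res_simps)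
    then show ?thesis
      using lin_a_inv[OF module_free_res modA augA lin_closed[OF dA y]]
        res_vanishes_d[OF modA y] by (simp add: res_vanishes_def)
  qed
  show "x \<in> cone_d ` carrier (cone (Suc (Suc 0)))"
    if x: "x \<in> carrier (cone (Suc 0))" and d: "cone_d x = \<zero>\<^bsub>cone 0\<^esub>"
      and e: "res_aug R A (\<lambda>b. x (Inr b)) = \<zero>\<^bsub>A\<^esub>" for x
    using cone_exact[OF lin_closed[OF fst_lin x] snd_closed[OF x]] cone_cycle[OF x] d e
    by (simp add: cone_zero res_vanishes_def free_pair_eta)
  have augK: "res_aug R Ker ` carrier (free_res R Ker 0) = carrier Ker"
    by (rule module.res_aug_surj[OF module_Ker])
  interpret FB: module R "FB 0" by (rule module_free_res)
  interpret FB1: module R "FB (Suc 0)" by (rule module_free_res)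
  show "res_aug R A (\<lambda>b. x (Inr b)) \<in> res_aug R Ker ` carrier (free_res R Ker 0)"
    if x: "x \<in> carrier (cone (Suc 0))" and d: "cone_d x = \<zero>\<^bsub>cone 0\<^esub>" for x
  proof -
    let ?x = "\<lambda>b. x (Inl b)" and ?y = "\<lambda>b. x (Inr b)"
    note y = snd_closed[OF x] and xx = lin_closed[OF fst_lin x]
    note c = lin_closed[OF dB xx] lin_closed[OF mapAB y]
    have "res_d R ?x \<oplus>\<^bsub>FB 0\<^esub> res_map R h ?y = \<zero>\<^bsub>FB 0\<^esub>"
      using cone_cycle(2)[OF x] d by (simp add: free_res_simps cone_zero free_res_zero)
    then have "res_aug R B (res_d R ?x) \<oplus>\<^bsub>B\<^esub> res_aug R B (res_map R h ?y) = \<zero>\<^bsub>B\<^esub>"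
      using lin_add[OF augB c] lin_zero[OF module_free_res modB augB] by simp
    then have "h (res_aug R A ?y) = \<zero>\<^bsub>B\<^esub>"
      using res_vanishes_d[OF modB xx] lin_closed[OF augB c(2)]
        aug_map[OF y] by (simp add: res_vanishes_def)
    then show ?thesis using lin_closed[OF augA y] by (simp add: augK carrier_Ker)
  qed
  show "\<exists>x\<in>carrier (cone (Suc 0)). cone_d x = \<zero>\<^bsub>cone 0\<^esub> \<and> res_aug R A (\<lambda>b. x (Inr b)) = res_aug R Ker z"
    if "z \<in> carrier (free_res R Ker 0)" for z
  proof -
    have k: "res_aug R Ker z \<in> carrier A" "h (res_aug R Ker z) = \<zero>\<^bsub>B\<^esub>"
      using augK that carrier_Ker by auto
    obtain y where y: "y \<in> carrier (FA 0)" "res_aug R A y = res_aug R Ker z"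
      using A.res_aug_surj k(1) by (metis imageE)
    note my = lin_closed[OF mapAB y(1)]
    have "res_aug R B (res_map R h y) = \<zero>\<^bsub>B\<^esub>"
      using aug_map[OF y(1)] y(2) k by simp
    then obtain x where x: "x \<in> carrier (FB (Suc 0))" "res_d R x = res_map R h y"
      using res_vanishes_imp_d[OF modB my] by (auto simp: res_vanishes_def)
    let ?x = "\<ominus>\<^bsub>FB (Suc 0)\<^esub> x"
    have "res_d R ?x = (\<lambda>b. \<ominus> res_map R h y b)"
      using lin_a_inv[OF module_free_res module_free_res dB x(1)] x(2) my by (simp add: free_res_simps)
    then have "cone_d (case_sum ?x y) = (\<lambda>b. \<zero>)"
      using my by (auto simp: cone_d_pair res_d_degree_0[OF y(1)] free_res_closed l_neg fun_eq_iff split: sum.split)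
    moreover have "case_sum ?x y \<in> carrier (cone (Suc 0))" using x y by (intro pair_closed) auto
    ultimately show ?thesis using y(2) by (intro bexI[of _ "case_sum ?x y"]) (auto simp: cone_zero)
  qed
qed

end

section \<open>Long exact sequence arguments\<close>

definition ext_torsion ::
    "('r, 'x) ring_scheme \<Rightarrow> 'r set \<Rightarrow> ('r, 'm, 'y) module_scheme \<Rightarrow> ('r, 'n, 'z) module_scheme
      \<Rightarrow> nat \<Rightarrow> bool" where
  "ext_torsion R S A N j = torsion_coh R S (free_res R A) (res_d R) N j"

abbreviation ext_coboundary ::
    "('r, 'x) ring_scheme \<Rightarrow> ('r, 'm, 'y) module_scheme \<Rightarrow> ('r, 'n, 'z) module_scheme \<Rightarrow> nat
      \<Rightarrow> ((('r, 'm) gen \<Rightarrow> 'r) \<Rightarrow> 'n) \<Rightarrow> bool" where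
  "ext_coboundary R A N j f \<equiv> coboundary R (free_res R A) (res_d R) N j f"

context module_surjection
begin

definition inl :: "(('r, 'n) gen \<Rightarrow> 'r) \<Rightarrow> (('r, 'n) gen + ('r, 'm) gen \<Rightarrow> 'r)" where
  "inl x = case_sum x (\<lambda>b. \<zero>)"

definition inr :: "(('r, 'm) gen \<Rightarrow> 'r) \<Rightarrow> (('r, 'n) gen + ('r, 'm) gen \<Rightarrow> 'r)" where
  "inr y = case_sum (\<lambda>b. \<zero>) y"

lemma module_cone: "module R (cone i)"
  unfolding cone_def by (rule module_free)

lemma inl_lin: "lin R (FB i) (cone i) inl"
  using free_pair_lin[OF lin_id lin_const_zero[OF module_free], of "res_gens R B i" "gens' i"]
  by (simp add: cone_def free_res_def free_simps inl_def[abs_def])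

lemma inr_lin: "lin R (FA i) (cone (Suc i)) inr"
  using free_pair_lin[OF lin_const_zero[OF module_free] lin_id, of "gens' (Suc i)" "res_gens R B (Suc i)"]
  by (simp add: cone_def free_res_def free_simps gens'_def inr_def[abs_def] del: res_gens.simps)

lemma map_zero: "res_map R h (\<lambda>b. \<zero>) = (\<lambda>b. \<zero>)"
  using lin_zero[OF module_free_res module_free_res mapAB] by (simp add: free_res_zero)

lemma cone_d_inl: "x \<in> carrier (FB (Suc i)) \<Longrightarrow> cone_d (inl x) = inl (res_d R x)"
  using lin_closed[OF dB, of x i] by (simp add: inl_def cone_d_pair res_d_zero map_zero free_res_closed)

lemma cone_d_inr_0: "y \<in> carrier (FA 0) \<Longrightarrow> cone_d (inr y) = inl (res_map R h y)"
  using lin_closed[OF mapAB, of y 0]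
  by (simp add: inl_def inr_def cone_d_pair res_d_zero res_d_degree_0 free_res_closed)

text \<open>\<open>inl\<close> commutes with the differentials, but \<open>inr\<close> does so only
  up to sign and up to a term coming from \<open>h\<close>. That term links cochains on
  \<open>A\<close> with cochains on \<open>B\<close>.\<close>

lemma cone_d_inr:
  assumes y: "y \<in> carrier (FA (Suc i))"
  shows "cone_d (inr y) = inl (res_map R h y) \<ominus>\<^bsub>cone (Suc i)\<^esub> inr (res_d R y)"
proof -
  note c = lin_closed[OF mapAB y] lin_closed[OF dA y]
  have "\<ominus>\<^bsub>cone (Suc i)\<^esub> inr (res_d R y) = (\<lambda>b. \<ominus> inr (res_d R y) b)"
    using lin_closed[OF inr_lin c(2)] by (simp add: cone_def free_uminus)
  then show ?thesis
    using c by (auto simp: a_minus_def inl_def inr_def cone_d_pair res_d_zero cone_def free_simps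
        free_res_closed fun_eq_iff split: sum.split)
qed

lemma snd_cone_d:
  assumes u: "u \<in> carrier (cone (Suc (Suc i)))"
  shows "(\<lambda>b. cone_d u (Inr b)) = \<ominus>\<^bsub>FA i\<^esub> res_d R (\<lambda>b. u (Inr b))"
  using lin_closed[OF dA snd_closed[OF u]] by (simp add: cone_d_def free_res_simps)

lemma fst_cone_d:
  "(\<lambda>b. cone_d u (Inl b)) = res_d R (\<lambda>b. u (Inl b)) \<oplus>\<^bsub>FB i\<^esub> res_map R h (\<lambda>b. u (Inr b))"
  by (simp add: cone_d_def free_res_simps)

lemma snd_lin': "lin R (cone (Suc i)) (FA i) (\<lambda>z b. z (Inr b))"
  using snd_lin[of "Suc i"] by (simp add: gens'_def free_res_def)

end

text \<open>Exactness up to torsion of Ext^(t-1)(Ker, N) -> Ext^t(B, N) -> Ext^t(A, N): a class on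
  \<open>B\<close> that dies on \<open>A\<close> comes from the kernel. The connecting map itself is
  not constructed; the cohomology of the cone replaces Ext of \<open>Ker\<close>.\<close>

lemma (in module_surjection) ext_torsion_connecting:
  assumes N: "module R N" and S: "submonoid S R"
    and K: "\<And>i. t = Suc i \<Longrightarrow> ext_torsion R S Ker N i"
    and f: "lin R (FB t) N f"
    and fd: "\<And>z. z \<in> carrier (FB (Suc t)) \<Longrightarrow> f (res_d R z) = \<zero>\<^bsub>N\<^esub>"
    and cb: "ext_coboundary R A N t (\<lambda>z. f (res_map R h z))"
  shows "\<exists>s\<in>S. ext_coboundary R B N t (\<lambda>z. s \<odot>\<^bsub>N\<^esub> f z)"
proof -
  interpret N: module R N by fact
  have S1: "\<one> \<in> S" "S \<subseteq> carrier R" using S by (auto simp: submonoid_def)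
  show ?thesis
  proof (cases t)
    case 0
    \<comment> \<open>In degree zero \<open>cone_surj\<close> gives \<open>z = d x + h y\<close>,
      and \<open>f\<close> kills both terms, so the scalar one suffices.\<close>
    have "f z = \<zero>\<^bsub>N\<^esub>" if z: "z \<in> carrier (FB 0)" for z
    proof -
      obtain u where u: "u \<in> carrier (cone (Suc 0))" "cone_d u = inl z"
        using cone_surj lin_closed[OF inl_lin z] by force
      let ?x = "\<lambda>b. u (Inl b)" and ?y = "\<lambda>b. u (Inr b)"
      have x: "?x \<in> carrier (FB (Suc 0))" and y: "?y \<in> carrier (FA 0)"
        using lin_closed[OF fst_lin u(1)] snd_closed[OF u(1)] by auto
      have "z = res_d R ?x \<oplus>\<^bsub>FB 0\<^esub> res_map R h ?y"
        using fst_cone_d[of u 0] u(2) by (simp add: inl_def)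
      then show ?thesis
        using lin_add[OF f, of "res_d R ?x" "res_map R h ?y"] lin_closed[OF dB x] lin_closed[OF mapAB y]
          fd[of ?x] x y cb 0 by (simp add: coboundary_0)
    qed
    then show ?thesis using S1 0 by (intro bexI[of _ \<one>]) (auto simp: coboundary_0)
  next
    case (Suc i)
    obtain g where g: "lin R (FA i) N g"
      "\<And>z. z \<in> carrier (FA (Suc i)) \<Longrightarrow> f (res_map R h z) = g (res_d R z)"
      using cb by (auto simp: Suc coboundary_Suc)
    \<comment> \<open>A cocycle on the cone: on \<open>(d x + h y, - d y)\<close> it takes the value
      \<open>f (h y) - g (d y)\<close>, because \<open>f\<close> kills \<open>d x\<close>.
      Restricting a bounding cochain along \<open>inl\<close> then treats \<open>f\<close>.\<close>
    let ?c = "\<lambda>z. f (\<lambda>b. z (Inl b)) \<oplus>\<^bsub>N\<^esub> g (\<lambda>b. z (Inr b))"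
    have c: "lin R (cone (Suc i)) N ?c"
      by (intro lin_plus N lin_comp[OF fst_lin f[unfolded Suc]] lin_comp[OF snd_lin' g(1)])
    have "?c (cone_d u) = \<zero>\<^bsub>N\<^esub>" if u: "u \<in> carrier (cone (Suc (Suc i)))" for u
    proof -
      let ?x = "\<lambda>b. u (Inl b)" and ?y = "\<lambda>b. u (Inr b)"
      have x: "?x \<in> carrier (FB (Suc (Suc i)))" and y: "?y \<in> carrier (FA (Suc i))"
        using lin_closed[OF fst_lin u] snd_closed[OF u] by auto
      note k = lin_closed[OF dB x] lin_closed[OF mapAB y] lin_closed[OF dA y]
      have "?c (cone_d u) = g (res_d R ?y) \<oplus>\<^bsub>N\<^esub> \<ominus>\<^bsub>N\<^esub> g (res_d R ?y)"
        unfolding fst_cone_d[of u "Suc i"] snd_cone_d[OF u]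
        using k lin_add[OF f[unfolded Suc] k(1,2)] fd[of ?x] x y g(2) lin_closed[OF g(1) k(3)] Suc
          lin_a_inv[OF module_free_res N g(1) k(3)] by simp
      then show ?thesis using lin_closed[OF g(1) k(3)] by (simp add: N.M.r_neg)
    qed
    moreover have "torsion_coh R S cone cone_d N (Suc i)"
      by (rule shifted.torsion_shift[OF N S1(2) K[OF Suc, unfolded ext_torsion_def]])
    ultimately obtain s e where s: "s \<in> S" "lin R (cone i) N e"
      "\<And>u. u \<in> carrier (cone (Suc i)) \<Longrightarrow> s \<odot>\<^bsub>N\<^esub> ?c u = e (cone_d u)"
      using c unfolding torsion_coh_def coboundary_Suc by blast
    have "s \<odot>\<^bsub>N\<^esub> f x = e (inl (res_d R x))" if x: "x \<in> carrier (FB (Suc i))" for x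
      using s(3)[OF lin_closed[OF inl_lin x]] cone_d_inl[OF x] lin_closed[OF f[unfolded Suc] x]
        lin_zero[OF module_free_res N g(1)] by (simp add: free_res_zero inl_def)
    then show ?thesis
      unfolding Suc coboundary_Suc using s(1) lin_comp[OF inl_lin s(2)] by blast
  qed
qed

corollary (in module_surjection) ext_torsion_quotient:
  assumes N: "module R N" and S: "submonoid S R"
    and K: "\<And>i. t = Suc i \<Longrightarrow> ext_torsion R S Ker N i" and A: "ext_torsion R S A N t"
  shows "ext_torsion R S B N t"
  unfolding ext_torsion_def torsion_coh_def
proof (intro allI impI, elim conjE)
  interpret N: module R N by fact
  have S1: "\<one> \<in> S" "S \<subseteq> carrier R" "\<And>s t. s \<in> S \<Longrightarrow> t \<in> S \<Longrightarrow> s \<otimes> t \<in> S"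
    using S by (auto simp: submonoid_def)
  fix f assume f: "lin R (FB t) N f"
    and fd: "\<forall>z\<in>carrier (FB (Suc t)). f (res_d R z) = \<zero>\<^bsub>N\<^esub>"
  have "f (res_map R h (res_d R z)) = \<zero>\<^bsub>N\<^esub>" if "z \<in> carrier (FA (Suc t))" for z
    using fd lin_closed[OF mapAB that] d_map[OF that] by metis
  then obtain s where s: "s \<in> S" "ext_coboundary R A N t (\<lambda>z. s \<odot>\<^bsub>N\<^esub> f (res_map R h z))"
    using A lin_comp[OF mapAB f] unfolding ext_torsion_def torsion_coh_def by blast
  have s': "s \<in> carrier R" using s S1 by auto
  have "\<exists>s'\<in>S. ext_coboundary R B N t (\<lambda>z. s' \<odot>\<^bsub>N\<^esub> (s \<odot>\<^bsub>N\<^esub> f z))"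
    by (rule ext_torsion_connecting[OF N S K lin_scale[OF N f s'] _ s(2)]) (use fd s' in auto)
  then obtain s2 where s2: "s2 \<in> S"
    "ext_coboundary R B N t (\<lambda>z. s2 \<odot>\<^bsub>N\<^esub> (s \<odot>\<^bsub>N\<^esub> f z))" by blast
  have "s2 \<odot>\<^bsub>N\<^esub> (s \<odot>\<^bsub>N\<^esub> f z) = (s2 \<otimes> s) \<odot>\<^bsub>N\<^esub> f z" if "z \<in> carrier (FB t)" for z
    using lin_closed[OF f that] s' s2 S1 by (auto simp: N.smult_assoc1)
  then have "ext_coboundary R B N t (\<lambda>z. (s2 \<otimes> s) \<odot>\<^bsub>N\<^esub> f z)"
    using s2(2) by (auto simp: coboundary_def split: nat.splits)
  then show "\<exists>s\<in>S. ext_coboundary R B N t (\<lambda>z. s \<odot>\<^bsub>N\<^esub> f z)"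
    using s2(1) s(1) S1(3) by blast
qed

text \<open>Exactness in the middle. Composed with the projection of the cone to its
  \<open>A\<close> component, \<open>f\<close> becomes a cocycle one degree higher, so a multiple of
  it is \<open>e\<close> after \<open>cone_d\<close>. The restriction of \<open>e\<close> to the
  resolution of \<open>B\<close> is a cocycle, and torsion for \<open>B\<close> applies to
  it.\<close>

lemma (in module_surjection) ext_torsion_extension:
  assumes N: "module R N" and S: "submonoid S R"
    and K: "ext_torsion R S Ker N t" and B: "ext_torsion R S B N t"
  shows "ext_torsion R S A N t"
  unfolding ext_torsion_def torsion_coh_def
proof (intro allI impI, elim conjE)
  interpret N: module R N by fact
  have S1: "\<one> \<in> S" "S \<subseteq> carrier R" "\<And>s t. s \<in> S \<Longrightarrow> t \<in> S \<Longrightarrow> s \<otimes> t \<in> S"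
    using S by (auto simp: submonoid_def)
  fix f assume f: "lin R (FA t) N f"
    and fd: "\<forall>z\<in>carrier (FA (Suc t)). f (res_d R z) = \<zero>\<^bsub>N\<^esub>"
  have "f (\<lambda>b. cone_d u (Inr b)) = \<zero>\<^bsub>N\<^esub>" if u: "u \<in> carrier (cone (Suc (Suc t)))" for u
    unfolding snd_cone_d[OF u]
    using lin_a_inv[OF module_free_res N f lin_closed[OF dA snd_closed[OF u]]] fd snd_closed[OF u] by simp
  moreover have "torsion_coh R S cone cone_d N (Suc t)"
    by (rule shifted.torsion_shift[OF N S1(2) K[unfolded ext_torsion_def]])
  ultimately obtain s e where s: "s \<in> S" "lin R (cone t) N e"
    "\<And>u. u \<in> carrier (cone (Suc t)) \<Longrightarrow> s \<odot>\<^bsub>N\<^esub> f (\<lambda>b. u (Inr b)) = e (cone_d u)"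
    using lin_comp[OF snd_lin' f] unfolding torsion_coh_def coboundary_Suc by blast
  have s': "s \<in> carrier R" using s S1 by auto
  note e1 = lin_comp[OF inl_lin s(2)]
  have "e (inl (res_d R x)) = \<zero>\<^bsub>N\<^esub>" if x: "x \<in> carrier (FB (Suc t))" for x
    using s(3)[OF lin_closed[OF inl_lin x]] cone_d_inl[OF x] lin_zero[OF module_free_res N f] s'
    by (simp add: free_res_zero inl_def)
  then obtain s2 where s2: "s2 \<in> S" "ext_coboundary R B N t (\<lambda>x. s2 \<odot>\<^bsub>N\<^esub> e (inl x))"
    using B e1 unfolding ext_torsion_def torsion_coh_def by blast
  have s2': "s2 \<in> carrier R" using s2 S1 by auto
  have fe: "(s2 \<otimes> s) \<odot>\<^bsub>N\<^esub> f y = s2 \<odot>\<^bsub>N\<^esub> e (cone_d (inr y))" if y: "y \<in> carrier (FA t)" for y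
    using s(3)[OF lin_closed[OF inr_lin y]] lin_closed[OF f y] s' s2' by (simp add: N.smult_assoc1 inr_def)
  have "ext_coboundary R A N t (\<lambda>z. (s2 \<otimes> s) \<odot>\<^bsub>N\<^esub> f z)"
  proof (cases t)
    case 0
    then show ?thesis
      using fe s2(2) lin_closed[OF mapAB] by (auto simp: coboundary_0 cone_d_inr_0)
  next
    case (Suc i)
    obtain g where g: "lin R (FB i) N g"
      "\<And>x. x \<in> carrier (FB (Suc i)) \<Longrightarrow> s2 \<odot>\<^bsub>N\<^esub> e (inl x) = g (res_d R x)"
      using s2(2) by (auto simp: Suc coboundary_Suc)
    note e2 = lin_comp[OF inr_lin s(2)[unfolded Suc]]
    \<comment> \<open>The cone differential of \<open>inr y\<close> has a part in \<open>B\<close>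
      and a part in \<open>A\<close>. After multiplication by \<open>s2\<close>, both contributions
      become functions of \<open>d y\<close>.\<close>
    have "(s2 \<otimes> s) \<odot>\<^bsub>N\<^esub> f y = g (res_map R h (res_d R y)) \<ominus>\<^bsub>N\<^esub> s2 \<odot>\<^bsub>N\<^esub> e (inr (res_d R y))"
      if y: "y \<in> carrier (FA (Suc i))" for y
    proof -
      note k = lin_closed[OF mapAB y] lin_closed[OF dA y]
      have "e (cone_d (inr y)) = e (inl (res_map R h y)) \<ominus>\<^bsub>N\<^esub> e (inr (res_d R y))"
        unfolding cone_d_inr[OF y]
        by (rule lin_minus[OF module_cone N s(2)[unfolded Suc] lin_closed[OF inl_lin k(1)] lin_closed[OF inr_lin k(2)]])
      then show ?thesis
        using fe[of y] y Suc s2' lin_closed[OF e1[unfolded Suc] k(1)] lin_closed[OF e2 k(2)] g(2)[OF k(1)] d_map[OF y]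
        by (simp add: a_minus_def N.smult_r_distr N.smult_r_minus)
    qed
    moreover have "lin R (FA i) N (\<lambda>y. g (res_map R h y) \<ominus>\<^bsub>N\<^esub> s2 \<odot>\<^bsub>N\<^esub> e (inr y))"
      by (intro lin_diff N lin_comp[OF mapAB g(1)] lin_scale e2 s2')
    ultimately show ?thesis unfolding Suc coboundary_Suc by blast
  qed
  then show "\<exists>s\<in>S. ext_coboundary R A N t (\<lambda>z. s \<odot>\<^bsub>N\<^esub> f z)"
    using s2(1) s(1) S1(3) by blast
qed

section \<open>Quotients\<close>

text \<open>The target is not yet known to be a module; its axioms are transported along the
  surjection. This makes quotients modules.\<close>

lemma module_image:
  fixes f :: "'a \<Rightarrow> 'b" and R :: "('r, 'x) ring_scheme"
    and A :: "('r, 'a, 'y) module_scheme" and B :: "('r, 'b, 'z) module_scheme"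
  assumes "module R A" and im: "f ` carrier A = carrier B"
    and add: "\<And>x y. x \<in> carrier A \<Longrightarrow> y \<in> carrier A \<Longrightarrow> f (x \<oplus>\<^bsub>A\<^esub> y) = f x \<oplus>\<^bsub>B\<^esub> f y"
    and smult: "\<And>r x. r \<in> carrier R \<Longrightarrow> x \<in> carrier A \<Longrightarrow> f (r \<odot>\<^bsub>A\<^esub> x) = r \<odot>\<^bsub>B\<^esub> f x"
    and zero: "f \<zero>\<^bsub>A\<^esub> = \<zero>\<^bsub>B\<^esub>"
  shows "module R B"
proof -
  interpret A: module R A by fact
  have ex: "\<exists>a\<in>carrier A. x = f a" if "x \<in> carrier B" for x using that im by blast
  have cl: "f a \<in> carrier B" if "a \<in> carrier A" for a using that im by blast
  note f = add[symmetric] smult[symmetric] zero[symmetric]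
  show ?thesis
  proof (rule moduleI)
    show "abelian_group B"
    proof (rule abelian_groupI)
      fix x assume "x \<in> carrier B"
      then obtain a where a: "a \<in> carrier A" "x = f a" using ex by blast
      then show "\<exists>y\<in>carrier B. y \<oplus>\<^bsub>B\<^esub> x = \<zero>\<^bsub>B\<^esub>"
        using cl by (intro bexI[of _ "f (\<ominus>\<^bsub>A\<^esub> a)"]) (auto simp: f A.M.l_neg)
    qed (auto dest!: ex simp: f cl A.M.a_ac)
  qed (auto dest!: ex simp: f cl A.smult_l_distr A.smult_r_distr A.smult_assoc1 A.R.is_cring)
qed

context module
begin

lemma submodule_zero_mem: "submodule H R M \<Longrightarrow> \<zero>\<^bsub>M\<^esub> \<in> H"
  using submoduleE(1,2,4)[of H] smult_l_null by (metis R.zero_closed all_not_in_conv subsetD)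

lemma submodule_abelian_subgroup: "submodule H R M \<Longrightarrow> abelian_subgroup H M"
  by (intro abelian_subgroupI3 additive_subgroupI submodule.axioms(1) M.abelian_group_axioms)

context
  fixes H assumes H: "submodule H R M"
begin

interpretation H: abelian_subgroup H M by (rule submodule_abelian_subgroup[OF H])

lemma quot_carrier: "carrier (quot_module M H) = (\<lambda>x. H +>\<^bsub>M\<^esub> x) ` carrier M"
  by (auto simp: quot_module_def A_RCOSETS_def')

lemma quot_zero: "\<zero>\<^bsub>quot_module M H\<^esub> = H"
  by (simp add: quot_module_def)

lemma quot_eq_iff:
  assumes "x \<in> carrier M" "y \<in> carrier M"
  shows "H +>\<^bsub>M\<^esub> x = H +>\<^bsub>M\<^esub> y \<longleftrightarrow> x \<ominus>\<^bsub>M\<^esub> y \<in> H"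
  using assms H.a_rcos_module[of y x] H.a_repr_independence'[of x y] H.a_rcos_self[of x]
  by (auto simp: a_minus_def)

lemma quot_eq_zero_iff: "x \<in> carrier M \<Longrightarrow> H +>\<^bsub>M\<^esub> x = H \<longleftrightarrow> x \<in> H"
  using H.a_rcos_const H.a_rcos_self by blast

lemma coset_subset: "x \<in> carrier M \<Longrightarrow> y \<in> H +>\<^bsub>M\<^esub> x \<Longrightarrow> y \<in> carrier M"
  using H.a_elemrcos_carrier by blast

lemma quot_add:
  "x \<in> carrier M \<Longrightarrow> y \<in> carrier M \<Longrightarrow>
    (H +>\<^bsub>M\<^esub> x) \<oplus>\<^bsub>quot_module M H\<^esub> (H +>\<^bsub>M\<^esub> y) = H +>\<^bsub>M\<^esub> (x \<oplus>\<^bsub>M\<^esub> y)"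
  by (simp add: quot_module_def H.a_rcos_sum)

text \<open>Scalar multiplication in \<open>quot_module\<close>, the projections
  \<open>quot_proj\<close> and \<open>Ext_map\<close> are all unions over a coset, so this reduces
  their well-definedness to independence of the representative.\<close>

lemma coset_UN_eq:
  assumes x: "x \<in> carrier M" and f: "\<And>y. y \<in> H +>\<^bsub>M\<^esub> x \<Longrightarrow> f y = f x"
  shows "(\<Union>y\<in>H +>\<^bsub>M\<^esub> x. f y) = f x"
proof -
  have "(\<Union>y\<in>H +>\<^bsub>M\<^esub> x. f y) = (\<Union>y\<in>H +>\<^bsub>M\<^esub> x. f x)" by (intro SUP_cong refl f)
  also have "\<dots> = f x" using H.a_rcos_self[OF x] by blast
  finally show ?thesis .
qed

lemma quot_smult:
  assumes r: "r \<in> carrier R" and x: "x \<in> carrier M"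
  shows "r \<odot>\<^bsub>quot_module M H\<^esub> (H +>\<^bsub>M\<^esub> x) = H +>\<^bsub>M\<^esub> (r \<odot>\<^bsub>M\<^esub> x)"
proof -
  have "H +>\<^bsub>M\<^esub> (r \<odot>\<^bsub>M\<^esub> y) = H +>\<^bsub>M\<^esub> (r \<odot>\<^bsub>M\<^esub> x)" if y: "y \<in> H +>\<^bsub>M\<^esub> x" for y
  proof -
    have c: "y \<in> carrier M" using coset_subset[OF x y] .
    have "y \<ominus>\<^bsub>M\<^esub> x \<in> H" using H.a_rcos_module[OF x c] y by (simp add: a_minus_def)
    then have "r \<odot>\<^bsub>M\<^esub> (y \<ominus>\<^bsub>M\<^esub> x) \<in> H" using submoduleE(4)[OF H r] by blast
    then show ?thesis
      using c x r by (simp add: quot_eq_iff a_minus_def smult_r_distr smult_r_minus)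
  qed
  then show ?thesis unfolding quot_module_def mk_module_simps by (rule coset_UN_eq[OF x])
qed

lemma module_quot: "module R (quot_module M H)"
  by (rule module_image[OF module_axioms quot_carrier[symmetric]])
    (use quot_add quot_smult quot_zero H.a_rcos_const[OF H.zero_closed] in auto)

lemma quot_lin: "lin R M (quot_module M H) (\<lambda>x. H +>\<^bsub>M\<^esub> x)"
  by (rule linI) (use quot_add quot_smult quot_carrier in auto)

end

lemma quot_proj_coset:
  assumes H: "submodule H R M" and H': "submodule H' R M" "H' \<subseteq> H" and x: "x \<in> carrier M"
  shows "quot_proj M H (H' +>\<^bsub>M\<^esub> x) = H +>\<^bsub>M\<^esub> x"
  unfolding quot_proj_def
proof (rule coset_UN_eq[OF H'(1) x])
  fix y assume y: "y \<in> H' +>\<^bsub>M\<^esub> x"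
  have c: "y \<in> carrier M" using coset_subset[OF H'(1) x y] .
  have "y \<ominus>\<^bsub>M\<^esub> x \<in> H'"
    using abelian_subgroup.a_rcos_module[OF submodule_abelian_subgroup[OF H'(1)] x c] y by (simp add: a_minus_def)
  then show "H +>\<^bsub>M\<^esub> y = H +>\<^bsub>M\<^esub> x" using quot_eq_iff[OF H c x] H'(2) by auto
qed

lemma quot_proj_lin:
  assumes H: "submodule H R M" and H': "submodule H' R M" "H' \<subseteq> H"
  shows "lin R (quot_module M H') (quot_module M H) (quot_proj M H)"
  by (rule linI)
    (auto simp: quot_carrier[OF H] quot_carrier[OF H'(1)] quot_proj_coset[OF H H'] quot_add[OF H]
      quot_add[OF H'(1)] quot_smult[OF H] quot_smult[OF H'(1)])

lemma quot_proj_surjection: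
  assumes H: "submodule H R M" and H': "submodule H' R M" "H' \<subseteq> H"
  shows "module_surjection R (quot_module M H') (quot_module M H) (quot_proj M H)"
proof -
  have "carrier (quot_module M H) \<subseteq> quot_proj M H ` carrier (quot_module M H')"
    by (auto simp: quot_carrier[OF H] quot_carrier[OF H'(1)] quot_proj_coset[OF H H'] image_iff)
  then show ?thesis
    by (intro module_surjection.intro module_surjection_axioms.intro quot_proj_lin assms module_quot
      R.is_cring)
qed

end

lemma submodule_preimage:
  assumes "module R A" "module R B" "lin R A B f" "submodule H R B"
  shows "submodule {x \<in> carrier A. f x \<in> H} R A"
proof -
  interpret A: module R A by fact
  interpret B: module R B by fact
  show ?thesis
    using B.submodule_zero_mem[OF assms(4)] B.submoduleE[OF assms(4)]
    by (intro A.submoduleI)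
      (auto simp: lin_zero[OF assms(1-3)] lin_a_inv[OF assms(1-3)] lin_add[OF assms(3)] lin_smult[OF assms(3)])
qed

section \<open>Submodules spanned by lists\<close>

text \<open>One generator is added at a time, so the spans of the tails of the list filter the
  module with cyclic factors, and induction on the list runs along this filtration.\<close>

primrec lspan :: "('r, 'x) ring_scheme \<Rightarrow> ('r, 'm, 'y) module_scheme \<Rightarrow> 'm list \<Rightarrow> 'm set" where
  "lspan R A [] = {\<zero>\<^bsub>A\<^esub>}"
| "lspan R A (x # xs) = {y \<oplus>\<^bsub>A\<^esub> r \<odot>\<^bsub>A\<^esub> x | y r. y \<in> lspan R A xs \<and> r \<in> carrier R}"

definition fg :: "('r, 'x) ring_scheme \<Rightarrow> ('r, 'm, 'y) module_scheme \<Rightarrow> bool" where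
  "fg R A \<longleftrightarrow> (\<exists>xs. set xs \<subseteq> carrier A \<and> carrier A = lspan R A xs)"

lemma lspan_restrict: "lspan R (submod A H) xs = lspan R A xs"
  by (induction xs) auto

context module
begin

text \<open>\<open>Y + R x\<close> is the preimage in \<open>M\<close> of the submodule of M/Y
  generated by the class of \<open>x\<close>; no closure property is checked by hand.\<close>

lemma submodule_sum_cyclic:
  assumes Y: "submodule Y R M" and x: "x \<in> carrier M"
  shows "submodule {y \<oplus>\<^bsub>M\<^esub> r \<odot>\<^bsub>M\<^esub> x | y r. y \<in> Y \<and> r \<in> carrier R} R M"
    (is "submodule ?H R M")
proof -
  interpret RM: module R "ring_module R" by (rule module_ring_module)
  let ?c = "\<lambda>a. Y +>\<^bsub>M\<^esub> a"
  have "(\<exists>r\<in>carrier R. ?c a = ?c (r \<odot>\<^bsub>M\<^esub> x)) \<longleftrightarrow> a \<in> ?H" if a: "a \<in> carrier M" for a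
  proof
    assume "\<exists>r\<in>carrier R. ?c a = ?c (r \<odot>\<^bsub>M\<^esub> x)"
    then obtain r where r: "r \<in> carrier R" "a \<ominus>\<^bsub>M\<^esub> r \<odot>\<^bsub>M\<^esub> x \<in> Y" using quot_eq_iff[OF Y a] x by auto
    have "a = (a \<ominus>\<^bsub>M\<^esub> r \<odot>\<^bsub>M\<^esub> x) \<oplus>\<^bsub>M\<^esub> r \<odot>\<^bsub>M\<^esub> x" using a r(1) x by (simp add: M.minus_plus_cancel)
    then show "a \<in> ?H" using r by blast
  next
    assume "a \<in> ?H"
    then obtain y r where yr: "y \<in> Y" "r \<in> carrier R" "a = y \<oplus>\<^bsub>M\<^esub> r \<odot>\<^bsub>M\<^esub> x" by blast
    have "y \<in> carrier M" using submoduleE(1)[OF Y] yr(1) by blast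
    then have "a \<ominus>\<^bsub>M\<^esub> r \<odot>\<^bsub>M\<^esub> x = y" using yr(2,3) x by (simp add: a_minus_def M.a_assoc M.r_neg)
    then show "\<exists>r\<in>carrier R. ?c a = ?c (r \<odot>\<^bsub>M\<^esub> x)" using quot_eq_iff[OF Y a] yr(1,2) x by auto
  qed
  moreover have "?H \<subseteq> carrier M" using submoduleE(1)[OF Y] x by auto
  ultimately have "{a \<in> carrier M. ?c a \<in> (\<lambda>r. ?c (r \<odot>\<^bsub>M\<^esub> x)) ` carrier R} = ?H" by blast
  then show ?thesis
    using submodule_preimage[OF module_axioms module_quot[OF Y] quot_lin[OF Y]
        submodule_image[OF module_ring_module module_quot[OF Y]
          lin_comp[OF lin_scalars[OF module_axioms x] quot_lin[OF Y]] RM.carrier_is_submodule]]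
    by simp
qed

lemma submodule_zero: "submodule {\<zero>\<^bsub>M\<^esub>} R M"
  by (rule submoduleI) auto

lemma lspan_submodule: "set xs \<subseteq> carrier M \<Longrightarrow> submodule (lspan R M xs) R M"
  by (induction xs) (simp_all add: submodule_zero submodule_sum_cyclic)

lemma lspan_minimal:
  assumes "submodule H R M" "set xs \<subseteq> H"
  shows "lspan R M xs \<subseteq> H"
  using assms(2)
proof (induction xs)
  case Nil
  then show ?case using submodule_zero_mem[OF assms(1)] by simp
next
  case (Cons x xs)
  then show ?case using submoduleE(4,5)[OF assms(1)] by auto
qed

lemma lspan_Cons_subset:
  assumes "x \<in> carrier M" "set xs \<subseteq> carrier M"
  shows "lspan R M xs \<subseteq> lspan R M (x # xs)"
proof
  fix y assume y: "y \<in> lspan R M xs"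
  then have "y = y \<oplus>\<^bsub>M\<^esub> \<zero> \<odot>\<^bsub>M\<^esub> x"
    using assms submoduleE(1)[OF lspan_submodule[OF assms(2)]] by auto
  with y show "y \<in> lspan R M (x # xs)" by auto
qed

lemma lspan_self: "set xs \<subseteq> carrier M \<Longrightarrow> set xs \<subseteq> lspan R M xs"
proof (induction xs)
  case (Cons x xs)
  then have "x = \<zero>\<^bsub>M\<^esub> \<oplus>\<^bsub>M\<^esub> \<one> \<odot>\<^bsub>M\<^esub> x" "\<zero>\<^bsub>M\<^esub> \<in> lspan R M xs"
    using submodule_zero_mem[OF lspan_submodule] by auto
  then have "x \<in> lspan R M (x # xs)" by auto
  with Cons lspan_Cons_subset[of x xs] show ?case by auto
qed simp

lemma fin_gen_imp_fg:
  assumes "fin_gen_module R M"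
  shows "fg R M"
proof -
  obtain S where S: "finite S" "S \<subseteq> carrier M" "submodule_span R M S = carrier M"
    using assms by (auto simp: fin_gen_module_def)
  obtain xs where xs: "set xs = S" using finite_list[OF S(1)] by blast
  have "carrier M \<subseteq> lspan R M xs"
    unfolding S(3)[symmetric] submodule_span_def
    using lspan_submodule[of xs] lspan_self[of xs] S(2) xs by blast
  then show ?thesis
    using submoduleE(1)[OF lspan_submodule[of xs]] S(2) xs by (auto simp: fg_def)
qed

end

lemma lspan_image:
  assumes "module R A" "module R B" "lin R A B f" "set xs \<subseteq> carrier A"
  shows "lspan R B (map f xs) = f ` lspan R A xs"
  using assms(4)
proof (induction xs)
  case Nil
  then show ?case using lin_zero[OF assms(1-3)] by simp
next
  case (Cons x xs)
  interpret A: module R A by fact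
  have y: "y \<in> lspan R A xs \<Longrightarrow> y \<in> carrier A" for y
    using A.submoduleE(1)[OF A.lspan_submodule] Cons.prems by auto
  have "f (y \<oplus>\<^bsub>A\<^esub> r \<odot>\<^bsub>A\<^esub> x) = f y \<oplus>\<^bsub>B\<^esub> r \<odot>\<^bsub>B\<^esub> f x" if "y \<in> lspan R A xs" "r \<in> carrier R" for y r
    using that y Cons.prems by (simp add: lin_add[OF assms(3)] lin_smult[OF assms(3)])
  moreover have "lspan R B (map f xs) = f ` lspan R A xs" using Cons by simp
  ultimately show ?case by (auto simp: image_iff) metis+
qed

lemma fg_image:
  assumes "module R A" "module R B" "lin R A B f" "carrier B \<subseteq> f ` carrier A" "fg R A"
  shows "fg R B"
proof -
  obtain xs where xs: "set xs \<subseteq> carrier A" "carrier A = lspan R A xs"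
    using assms(5) by (auto simp: fg_def)
  have "set (map f xs) \<subseteq> carrier B" using xs(1) lin_closed[OF assms(3)] by auto
  moreover have "f ` carrier A \<subseteq> carrier B" using lin_closed[OF assms(3)] by auto
  then have "carrier B = lspan R B (map f xs)"
    using lspan_image[OF assms(1-3) xs(1)] assms(4) xs(2) by auto
  ultimately show ?thesis unfolding fg_def by blast
qed

section \<open>Ideals and cyclic modules\<close>

definition cyc :: "('r, 'x) ring_scheme \<Rightarrow> 'r set \<Rightarrow> ('r, 'r set) module" where
  "cyc R J = quot_module (ring_module R) J"

context cring
begin

lemma submodule_ring_iff: "submodule J R (ring_module R) \<longleftrightarrow> ideal J R"
proof
  interpret RM: module R "ring_module R" by (rule module_ring_module)
  assume J: "submodule J R (ring_module R)"
  note E = RM.submoduleE[OF J]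
  have "subgroup J (add_monoid R)"
    using submodule.axioms(1)[OF J] by (simp add: ring_module_def subgroup_def m_inv_def)
  moreover have "x \<otimes> a \<in> J" "a \<otimes> x \<in> J" if "a \<in> J" "x \<in> carrier R" for a x
    using E(1) E(4)[of x a] m_comm[of a x] that by auto
  ultimately show "ideal J R" by (intro idealI ring_axioms)
next
  interpret RM: module R "ring_module R" by (rule module_ring_module)
  assume "ideal J R"
  then interpret J: ideal J R .
  show "submodule J R (ring_module R)"
    by (rule RM.submoduleI) (auto simp: J.I_l_closed J.a_subset[THEN subsetD])
qed

lemma module_cyc: "ideal J R \<Longrightarrow> module R (cyc R J)"
  unfolding cyc_def using module.module_quot[OF module_ring_module] submodule_ring_iff by blast

lemma ideal_quotient:
  assumes "module R A" "submodule Y R A" "x \<in> carrier A"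
  shows "ideal {r \<in> carrier R. r \<odot>\<^bsub>A\<^esub> x \<in> Y} R"
  using submodule_preimage[OF module_ring_module assms(1) lin_scalars[OF assms(1,3)] assms(2)]
  by (simp add: submodule_ring_iff)

end

text \<open>With \<open>Y\<close> the span of the tail, induction generates the intersection of
  \<open>H\<close> with \<open>Y\<close>, and finitely many elements of \<open>H\<close> take care
  of the ideal of coefficients at \<open>x\<close>.\<close>

lemma fg_submodule_aux:
  assumes noeth: "noetherian_ring R" and A: "module R A"
    and "set xs \<subseteq> carrier A" "submodule H R A" "H \<subseteq> lspan R A xs"
  shows "\<exists>ys. set ys \<subseteq> H \<and> H = lspan R A ys"
  using assms(3-5)
proof (induction xs arbitrary: H)
  interpret A: module R A by fact
  case Nil
  then show ?case using A.submodule_zero_mem by (intro exI[of _ "[]"]) auto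
next
  interpret A: module R A by fact
  case (Cons x xs)
  let ?Y = "lspan R A xs"
  have x: "x \<in> carrier A" and xs: "set xs \<subseteq> carrier A" using Cons.prems by auto
  have Y: "submodule ?Y R A" by (rule A.lspan_submodule[OF xs])
  \<comment> \<open>The coefficients at \<open>x\<close>, modulo \<open>Y\<close>, of the elements
    of \<open>G\<close>. The set is an ideal for every submodule \<open>G\<close>, and it is used
    for \<open>H\<close> and for the span of the chosen generators.\<close>
  define J where "J G = {r \<in> carrier R. ?Y +>\<^bsub>A\<^esub> r \<odot>\<^bsub>A\<^esub> x \<in> (\<lambda>y. ?Y +>\<^bsub>A\<^esub> y) ` G}" for G
  have J_ideal: "ideal (J G) R" if G: "submodule G R A" for G
    using submodule_preimage[OF A.module_ring_module A.module_quot[OF Y]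
        lin_comp[OF A.lin_scalars[OF A x] A.quot_lin[OF Y]] submodule_image[OF A A.module_quot[OF Y] A.quot_lin[OF Y] G]]
    by (simp add: J_def A.submodule_ring_iff)
  have J_iff: "r \<in> J G \<longleftrightarrow> (\<exists>g\<in>G. g \<ominus>\<^bsub>A\<^esub> r \<odot>\<^bsub>A\<^esub> x \<in> ?Y)"
    if "submodule G R A" "r \<in> carrier R" for G r
  proof -
    have "?Y +>\<^bsub>A\<^esub> r \<odot>\<^bsub>A\<^esub> x = ?Y +>\<^bsub>A\<^esub> g \<longleftrightarrow> g \<ominus>\<^bsub>A\<^esub> r \<odot>\<^bsub>A\<^esub> x \<in> ?Y" if "g \<in> G" for g
      using A.quot_eq_iff[OF Y, of g "r \<odot>\<^bsub>A\<^esub> x"] A.submoduleE(1)[OF \<open>submodule G R A\<close>] that \<open>r \<in> carrier R\<close> x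
      by (auto simp: subset_iff)
    then show ?thesis using that by (auto simp: J_def image_iff)
  qed
  obtain T where T: "T \<subseteq> carrier R" "finite T" "J H = Idl\<^bsub>R\<^esub> T"
    using noetherian_ring.finetely_gen[OF noeth J_ideal[OF Cons.prems(2)]] by blast
  have "\<forall>t\<in>T. \<exists>g. g \<in> H \<and> g \<ominus>\<^bsub>A\<^esub> t \<odot>\<^bsub>A\<^esub> x \<in> ?Y"
    using J_iff[OF Cons.prems(2)] T A.genideal_self[OF T(1)] by blast
  then obtain g where g: "\<And>t. t \<in> T \<Longrightarrow> g t \<in> H" "\<And>t. t \<in> T \<Longrightarrow> g t \<ominus>\<^bsub>A\<^esub> t \<odot>\<^bsub>A\<^esub> x \<in> ?Y" by metis
  obtain ts where ts: "set ts = T" using finite_list[OF T(2)] by blast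
  note EH = A.submoduleE[OF Cons.prems(2)] and EY = A.submoduleE[OF Y]
  have HY: "submodule (H \<inter> ?Y) R A"
    using A.submodule_zero_mem[OF Cons.prems(2)] A.submodule_zero_mem[OF Y] EH EY
    by (intro A.submoduleI) auto
  obtain ys where ys: "set ys \<subseteq> H \<inter> ?Y" "H \<inter> ?Y = lspan R A ys"
    using Cons.IH[OF xs HY] by blast
  define zs where "zs = map g ts @ ys"
  have zsH: "set zs \<subseteq> H" using ys(1) g(1) ts by (auto simp: zs_def)
  then have zsA: "set zs \<subseteq> carrier A" using EH(1) by blast
  define G where "G = lspan R A zs"
  have G: "submodule G R A" unfolding G_def by (rule A.lspan_submodule[OF zsA])
  have zsG: "set zs \<subseteq> G" unfolding G_def by (rule A.lspan_self[OF zsA])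
  have "G \<subseteq> H" unfolding G_def by (rule A.lspan_minimal[OF Cons.prems(2) zsH])
  moreover have "H \<subseteq> G"
  proof
    fix h assume h: "h \<in> H"
    then obtain y r where yr: "h = y \<oplus>\<^bsub>A\<^esub> r \<odot>\<^bsub>A\<^esub> x" "y \<in> ?Y" "r \<in> carrier R" using Cons.prems(3) by auto
    have yc: "y \<in> carrier A" using yr EY(1) by blast
    have hr: "h \<ominus>\<^bsub>A\<^esub> r \<odot>\<^bsub>A\<^esub> x = y"
      using yr yc x by (simp add: a_minus_def A.M.a_assoc A.M.r_neg)
    then have "r \<in> J H" using J_iff[OF Cons.prems(2) yr(3)] h yr(2) by auto
    \<comment> \<open>Containing the generators of \<open>J H\<close> suffices because
      \<open>J G\<close> is an ideal; no coefficient is expanded in terms of \<open>T\<close>.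
      Afterwards some \<open>k\<close> in \<open>G\<close> has the same coefficient as
      \<open>h\<close>, and \<open>h - k\<close> lies in \<open>Y\<close>.\<close>
    moreover have "T \<subseteq> J G"
    proof
      fix t assume t: "t \<in> T"
      then have "g t \<in> G" using zsG ts by (auto simp: zs_def)
      then show "t \<in> J G" using J_iff[OF G, of t] g(2)[OF t] t T(1) by blast
    qed
    then have "Idl\<^bsub>R\<^esub> T \<subseteq> J G" by (rule A.genideal_minimal[OF J_ideal[OF G]])
    ultimately obtain k where k: "k \<in> G" "k \<ominus>\<^bsub>A\<^esub> r \<odot>\<^bsub>A\<^esub> x \<in> ?Y" using J_iff[OF G yr(3)] T(3) by blast
    have kH: "k \<in> H" using k \<open>G \<subseteq> H\<close> by blast
    have c: "h \<in> carrier A" "k \<in> carrier A" "r \<odot>\<^bsub>A\<^esub> x \<in> carrier A" using h kH EH(1) yr(3) x by auto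
    have "h \<ominus>\<^bsub>A\<^esub> k = (h \<ominus>\<^bsub>A\<^esub> r \<odot>\<^bsub>A\<^esub> x) \<oplus>\<^bsub>A\<^esub> \<ominus>\<^bsub>A\<^esub> (k \<ominus>\<^bsub>A\<^esub> r \<odot>\<^bsub>A\<^esub> x)"
      using c by (simp add: a_minus_def A.M.minus_add A.M.a_ac A.M.r_neg2 A.M.r_neg1 A.M.r_neg)
    then have "h \<ominus>\<^bsub>A\<^esub> k \<in> ?Y" using EY(3)[OF k(2)] EY(5) hr yr(2) by simp
    moreover have "h \<ominus>\<^bsub>A\<^esub> k \<in> H" using h kH EH by (simp add: a_minus_def)
    ultimately have "h \<ominus>\<^bsub>A\<^esub> k \<in> lspan R A ys" using ys(2) by blast
    moreover have "lspan R A ys \<subseteq> G"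
      by (rule A.lspan_minimal[OF G]) (use zsG in \<open>auto simp: zs_def\<close>)
    ultimately have "(h \<ominus>\<^bsub>A\<^esub> k) \<oplus>\<^bsub>A\<^esub> k \<in> G" using A.submoduleE(5)[OF G] k(1) by blast
    then show "h \<in> G" using c by (simp add: A.M.minus_plus_cancel)
  qed
  ultimately show ?case using zsH unfolding G_def by blast
qed

lemma fg_submodule:
  assumes "noetherian_ring R" "module R A" "fg R A" "submodule H R A"
  shows "fg R (submod A H)"
proof -
  interpret A: module R A by fact
  obtain xs where xs: "set xs \<subseteq> carrier A" "carrier A = lspan R A xs"
    using assms(3) by (auto simp: fg_def)
  then show ?thesis
    using fg_submodule_aux[OF assms(1,2) xs(1) assms(4)] A.submoduleE(1)[OF assms(4)]
    by (auto simp: fg_def lspan_restrict)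
qed

section \<open>Vanishing below a given degree\<close>

text \<open>The isomorphism of (Y + R x)/Y with R/(Y : x), packaged as a surjection with kernel
  \<open>Y\<close>, the shape that \<open>below_extension\<close> takes. The value at
  \<open>x\<close> serves to see that a map is nonzero.\<close>

lemma (in cring) cyclic_quotient:
  assumes L: "module R L" and Y: "submodule Y R L" and x: "x \<in> carrier L"
  defines "J \<equiv> {r \<in> carrier R. r \<odot>\<^bsub>L\<^esub> x \<in> Y}"
    and "H \<equiv> {y \<oplus>\<^bsub>L\<^esub> r \<odot>\<^bsub>L\<^esub> x | y r. y \<in> Y \<and> r \<in> carrier R}"
  shows "\<exists>p. module_surjection R (submod L H) (cyc R J) p \<and>
    {a \<in> H. p a = \<zero>\<^bsub>cyc R J\<^esub>} = Y \<and> p x = J +>\<^bsub>ring_module R\<^esub> \<one>"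
proof -
  interpret L: module R L by fact
  interpret RM: module R "ring_module R" by (rule module_ring_module)
  have J: "ideal J R" unfolding J_def by (rule ideal_quotient[OF L Y x])
  then have J': "submodule J R (ring_module R)" by (simp add: submodule_ring_iff)
  have H: "submodule H R L" unfolding H_def by (rule L.submodule_sum_cyclic[OF Y x])
  have LH: "module R (submod L H)" by (rule module_submod[OF L H])
  note EY = L.submoduleE[OF Y]
  have Yc: "y \<in> Y \<Longrightarrow> y \<in> carrier L" for y using EY(1) by blast
  let ?d = "\<lambda>r. J +>\<^bsub>ring_module R\<^esub> r" and ?c = "\<lambda>a. Y +>\<^bsub>L\<^esub> a"
  have eq: "?d r = ?d s \<longleftrightarrow> ?c (r \<odot>\<^bsub>L\<^esub> x) = ?c (s \<odot>\<^bsub>L\<^esub> x)" if "r \<in> carrier R" "s \<in> carrier R" for r s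
    using that x RM.quot_eq_iff[OF J', of r s] L.quot_eq_iff[OF Y, of "r \<odot>\<^bsub>L\<^esub> x" "s \<odot>\<^bsub>L\<^esub> x"]
    by (simp add: J_def a_minus_def L.smult_l_distr L.smult_l_minus)
  \<comment> \<open>The coefficient of an element at \<open>x\<close> is determined only modulo
    \<open>J\<close>, so any choice of it has the same class.\<close>
  define p where "p a = ?d (SOME r. r \<in> carrier R \<and> ?c a = ?c (r \<odot>\<^bsub>L\<^esub> x))" for a
  have p: "p (y \<oplus>\<^bsub>L\<^esub> r \<odot>\<^bsub>L\<^esub> x) = ?d r" if y: "y \<in> Y" and r: "r \<in> carrier R" for y r
  proof -
    let ?a = "y \<oplus>\<^bsub>L\<^esub> r \<odot>\<^bsub>L\<^esub> x"
    have "?a \<ominus>\<^bsub>L\<^esub> r \<odot>\<^bsub>L\<^esub> x = y" using Yc[OF y] r x by (simp add: a_minus_def L.M.a_assoc L.M.r_neg)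
    then have c: "?c ?a = ?c (r \<odot>\<^bsub>L\<^esub> x)" using L.quot_eq_iff[OF Y, of ?a "r \<odot>\<^bsub>L\<^esub> x"] Yc[OF y] y r x by simp
    define s where "s = (SOME s. s \<in> carrier R \<and> ?c ?a = ?c (s \<odot>\<^bsub>L\<^esub> x))"
    have "s \<in> carrier R \<and> ?c ?a = ?c (s \<odot>\<^bsub>L\<^esub> x)" unfolding s_def by (rule someI[of _ r]) (use r c in simp)
    then have "?d s = ?d r" using eq[of s r] c r by simp
    then show ?thesis by (simp only: p_def s_def)
  qed
  have rep: "\<exists>y r. y \<in> Y \<and> r \<in> carrier R \<and> a = y \<oplus>\<^bsub>L\<^esub> r \<odot>\<^bsub>L\<^esub> x" if "a \<in> H" for a
    using that by (auto simp: H_def)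
  have ms: "module_surjection R (submod L H) (cyc R J) p"
  proof (intro module_surjection.intro module_surjection_axioms.intro is_cring LH module_cyc[OF J] linI)
    fix a assume "a \<in> carrier (submod L H)"
    then obtain y r where a: "y \<in> Y" "r \<in> carrier R" "a = y \<oplus>\<^bsub>L\<^esub> r \<odot>\<^bsub>L\<^esub> x" using rep[of a] by auto
    then show "p a \<in> carrier (cyc R J)"
      using lin_closed[OF RM.quot_lin[OF J'], of r] p by (simp add: cyc_def)
    {
      fix b assume "b \<in> carrier (submod L H)"
      then obtain z s where b: "z \<in> Y" "s \<in> carrier R" "b = z \<oplus>\<^bsub>L\<^esub> s \<odot>\<^bsub>L\<^esub> x" using rep[of b] by auto
      have "a \<oplus>\<^bsub>L\<^esub> b = (y \<oplus>\<^bsub>L\<^esub> z) \<oplus>\<^bsub>L\<^esub> (r \<oplus> s) \<odot>\<^bsub>L\<^esub> x"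
        using a b x Yc by (simp add: L.smult_l_distr L.M.a_ac)
      then show "p (a \<oplus>\<^bsub>submod L H\<^esub> b) = p a \<oplus>\<^bsub>cyc R J\<^esub> p b"
        using p[of "y \<oplus>\<^bsub>L\<^esub> z" "r \<oplus> s"] p[of y r] p[of z s] a b EY(5) RM.quot_add[OF J', of r s]
        by (simp add: cyc_def)
    }
    fix s assume s: "s \<in> carrier R"
    have "s \<odot>\<^bsub>L\<^esub> a = s \<odot>\<^bsub>L\<^esub> y \<oplus>\<^bsub>L\<^esub> (s \<otimes> r) \<odot>\<^bsub>L\<^esub> x"
      using a x s Yc by (simp add: L.smult_r_distr L.smult_assoc1)
    then show "p (s \<odot>\<^bsub>submod L H\<^esub> a) = s \<odot>\<^bsub>cyc R J\<^esub> p a"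
      using p[of "s \<odot>\<^bsub>L\<^esub> y" "s \<otimes> r"] p[of y r] a s EY(4)[OF s] RM.quot_smult[OF J' s, of r]
      by (simp add: cyc_def)
  next
    show "carrier (cyc R J) \<subseteq> p ` carrier (submod L H)"
    proof
      fix Q assume "Q \<in> carrier (cyc R J)"
      then obtain r where r: "r \<in> carrier R" "Q = J +>\<^bsub>ring_module R\<^esub> r"
        unfolding cyc_def RM.quot_carrier[OF J'] by auto
      have "\<zero>\<^bsub>L\<^esub> \<oplus>\<^bsub>L\<^esub> r \<odot>\<^bsub>L\<^esub> x \<in> H" using r L.submodule_zero_mem[OF Y] by (auto simp: H_def)
      then show "Q \<in> p ` carrier (submod L H)"
        using p[OF L.submodule_zero_mem[OF Y] r(1)] r(2) by force
    qed
  qed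
  have "{a \<in> H. p a = \<zero>\<^bsub>cyc R J\<^esub>} = Y"
  proof (intro equalityI subsetI)
    fix a assume "a \<in> {a \<in> H. p a = \<zero>\<^bsub>cyc R J\<^esub>}"
    then obtain y r where a: "y \<in> Y" "r \<in> carrier R" "a = y \<oplus>\<^bsub>L\<^esub> r \<odot>\<^bsub>L\<^esub> x" "p a = J"
      using rep[of a] RM.quot_zero[OF J'] by (auto simp: cyc_def)
    then have "r \<in> J" using p[of y r] RM.quot_eq_zero_iff[OF J', of r] by simp
    then show "a \<in> Y" using a EY(5) by (simp add: J_def)
  next
    fix a assume a: "a \<in> Y"
    have e: "a = a \<oplus>\<^bsub>L\<^esub> \<zero> \<odot>\<^bsub>L\<^esub> x" using Yc[OF a] x by simp
    have "\<zero> \<in> J" using L.submodule_zero_mem[OF Y] x by (simp add: J_def)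
    then have "p a = J" using p[OF a, of \<zero>] e RM.quot_eq_zero_iff[OF J', of \<zero>] by simp
    moreover have "a \<in> H" unfolding H_def using a e by blast
    ultimately show "a \<in> {a \<in> H. p a = \<zero>\<^bsub>cyc R J\<^esub>}" using RM.quot_zero[OF J'] by (simp add: cyc_def)
  qed
  moreover have "p x = J +>\<^bsub>ring_module R\<^esub> \<one>"
    using p[OF L.submodule_zero_mem[OF Y] one_closed] x by simp
  ultimately show ?thesis using ms by blast
qed

locale ext_setting = cring R + N: module R N
  for R :: "('r, 'x) ring_scheme" (structure) and N :: "('r, 'n, 'z) module_scheme" +
  fixes S :: "'r set"
  assumes S: "submonoid S R" and noeth: "noetherian_ring R"
begin

definition below :: "('r, 'm, 'y) module_scheme \<Rightarrow> nat \<Rightarrow> bool" where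
  "below A t \<longleftrightarrow> (\<forall>j<t. ext_torsion R S A N j)"

lemma below_0: "below A 0"
  by (simp add: below_def)

lemma below_mono: "below A t \<Longrightarrow> i \<le> t \<Longrightarrow> below A i"
  by (auto simp: below_def)

lemma below_extension:
  assumes "module_surjection R A B h" "below (submod A {x \<in> carrier A. h x = \<zero>\<^bsub>B\<^esub>}) t" "below B t"
  shows "below A t"
proof -
  interpret module_surjection R A B h by fact
  show ?thesis
    using assms(2,3) ext_torsion_extension[OF N.module_axioms S] by (simp add: below_def Ker_def)
qed

lemma below_quotient:
  assumes "module_surjection R A B h" "below (submod A {x \<in> carrier A. h x = \<zero>\<^bsub>B\<^esub>}) t"
    and "below A (Suc t)"
  shows "below B (Suc t)"
proof -
  interpret module_surjection R A B h by fact
  show ?thesis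
    using assms(2,3) ext_torsion_quotient[OF N.module_axioms S] by (auto simp: below_def Ker_def)
qed

text \<open>The functorial resolution of a zero module need not be zero, so the claim is not
  immediate. It follows from the zero map \<open>A -> Z\<close>, whose kernel is all of
  \<open>A\<close>.\<close>

lemma below_zero_module:
  assumes A: "module R A" "below A t" and Z: "module R Z" "carrier Z = {\<zero>\<^bsub>Z\<^esub>}"
  shows "below Z t"
proof (cases t)
  case (Suc i)
  interpret A: module R A by fact
  have "module_surjection R A Z (\<lambda>x. \<zero>\<^bsub>Z\<^esub>)"
    by (intro module_surjection.intro module_surjection_axioms.intro is_cring A Z lin_const_zero)
      (use Z(2) in \<open>auto intro: A.M.zero_closed\<close>)
  from below_quotient[OF this, of i] show ?thesis using A(2) Suc below_mono[OF A(2), of i] by simp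
qed (simp add: below_0)

lemma below_cyclic_step:
  assumes L: "module R L" and Y: "submodule Y R L" and x: "x \<in> carrier L"
    and bY: "below (submod L Y) t" and bJ: "below (cyc R {r \<in> carrier R. r \<odot>\<^bsub>L\<^esub> x \<in> Y}) t"
  shows "below (submod L {y \<oplus>\<^bsub>L\<^esub> r \<odot>\<^bsub>L\<^esub> x | y r. y \<in> Y \<and> r \<in> carrier R}) t"
proof -
  obtain p where "module_surjection R (submod L {y \<oplus>\<^bsub>L\<^esub> r \<odot>\<^bsub>L\<^esub> x | y r. y \<in> Y \<and> r \<in> carrier R})
      (cyc R {r \<in> carrier R. r \<odot>\<^bsub>L\<^esub> x \<in> Y}) p"
    "{a \<in> {y \<oplus>\<^bsub>L\<^esub> r \<odot>\<^bsub>L\<^esub> x | y r. y \<in> Y \<and> r \<in> carrier R}.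
      p a = \<zero>\<^bsub>cyc R {r \<in> carrier R. r \<odot>\<^bsub>L\<^esub> x \<in> Y}\<^esub>} = Y"
    using cyclic_quotient[OF L Y x] by blast
  from below_extension[OF this(1), of t] this(2) show ?thesis using bY bJ by simp
qed

text \<open>Each factor of the filtration is R/J with J = (Y : x), and J contains \<open>I\<close>
  because \<open>I\<close> kills \<open>L\<close>.\<close>

lemma below_filtration:
  assumes L: "module R L" and ann: "\<And>r x. r \<in> I \<Longrightarrow> x \<in> carrier L \<Longrightarrow> r \<odot>\<^bsub>L\<^esub> x = \<zero>\<^bsub>L\<^esub>"
    and I: "I \<subseteq> carrier R" and cyc: "\<And>J. ideal J R \<Longrightarrow> I \<subseteq> J \<Longrightarrow> below (cyc R J) t"
    and xs: "set xs \<subseteq> carrier L"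
  shows "below (submod L (lspan R L xs)) t"
  using xs
proof (induction xs)
  interpret L: module R L by fact
  case Nil
  have "module R (submod L {\<zero>\<^bsub>L\<^esub>})"
    by (rule module_submod[OF L L.submodule_zero])
  \<comment> \<open>The unit ideal contains \<open>I\<close>, so its cyclic module is available as
    the auxiliary module.\<close>
  from below_zero_module[OF module_cyc[OF oneideal] cyc[OF oneideal I] this] show ?case by simp
next
  interpret L: module R L by fact
  case (Cons x xs)
  then have x: "x \<in> carrier L" and xs: "set xs \<subseteq> carrier L" by auto
  note Y = L.lspan_submodule[OF xs]
  have "I \<subseteq> {r \<in> carrier R. r \<odot>\<^bsub>L\<^esub> x \<in> lspan R L xs}"
    using I ann[OF _ x] L.submodule_zero_mem[OF Y] by auto
  from cyc[OF ideal_quotient[OF L Y x] this] show ?case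
    using below_cyclic_step[OF L Y x] Cons.IH[OF xs] by simp
qed

lemma below_fg:
  assumes "module R L" "fg R L" "\<And>r x. r \<in> I \<Longrightarrow> x \<in> carrier L \<Longrightarrow> r \<odot>\<^bsub>L\<^esub> x = \<zero>\<^bsub>L\<^esub>"
    and "I \<subseteq> carrier R" "\<And>J. ideal J R \<Longrightarrow> I \<subseteq> J \<Longrightarrow> below (cyc R J) t"
  shows "below L t"
proof -
  obtain xs where xs: "set xs \<subseteq> carrier L" "carrier L = lspan R L xs"
    using assms(2) by (auto simp: fg_def)
  have "submod L (lspan R L xs) = L" unfolding xs(2)[symmetric] by simp
  then show ?thesis using below_filtration[OF assms(1,3-5) xs(1)] by simp
qed

end

section \<open>Nonzero maps into R/q for a prime q\<close>

context cring
begin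

text \<open>Let \<open>Y\<close> be the span of the tail. If (Y : x) lies in \<open>q\<close>, the
  composite H -> H/Y = R/(Y : x) -> R/q is nonzero at \<open>x\<close>. Otherwise some
  \<open>s\<close> outside \<open>q\<close> multiplies \<open>H\<close> into \<open>Y\<close>, and
  the map given by induction on \<open>Y\<close> is composed with multiplication by
  \<open>s\<close>.\<close>

lemma hom_to_prime_quotient:
  assumes A: "module R A" and q: "primeideal q R"
    and "set xs \<subseteq> carrier A"
    and "\<And>r. r \<in> carrier R \<Longrightarrow> (\<And>a. a \<in> lspan R A xs \<Longrightarrow> r \<odot>\<^bsub>A\<^esub> a = \<zero>\<^bsub>A\<^esub>) \<Longrightarrow> r \<in> q"
  shows "\<exists>f. lin R (submod A (lspan R A xs)) (cyc R q) f \<and> (\<exists>a\<in>lspan R A xs. f a \<noteq> q)"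
  using assms(3,4)
proof (induction xs)
  interpret A: module R A by fact
  interpret q: primeideal q R by fact
  case Nil
  \<comment> \<open>The premise fails for the zero module: everything annihilates it, so
    \<open>q\<close> would contain one.\<close>
  have "\<one> \<in> q" by (rule Nil.prems) auto
  then have "carrier R = q" using q.one_imp_carrier by simp
  then show ?case using q.I_notcarr by simp
next
  interpret A: module R A by fact
  interpret q: primeideal q R by fact
  interpret RM: module R "ring_module R" by (rule module_ring_module)
  case (Cons x xs)
  then have x: "x \<in> carrier A" and xs: "set xs \<subseteq> carrier A" by auto
  let ?Y = "lspan R A xs" and ?H = "lspan R A (x # xs)"
  have Y: "submodule ?Y R A" by (rule A.lspan_submodule[OF xs])
  have H: "submodule ?H R A" by (rule A.lspan_submodule) (use Cons.prems in auto)
  note EY = A.submoduleE[OF Y]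
  have Yc: "y \<in> ?Y \<Longrightarrow> y \<in> carrier A" for y using EY(1) by blast
  let ?J = "{r \<in> carrier R. r \<odot>\<^bsub>A\<^esub> x \<in> ?Y}"
  have q': "submodule q R (ring_module R)" using q.is_ideal by (simp add: submodule_ring_iff)
  show ?case
  proof (cases "?J \<subseteq> q")
    case True
    have J': "submodule ?J R (ring_module R)" using ideal_quotient[OF A Y x] by (simp add: submodule_ring_iff)
    obtain p where p: "lin R (submod A ?H) (cyc R ?J) p" "p x = ?J +>\<^bsub>ring_module R\<^esub> \<one>"
      using cyclic_quotient[OF A Y x] module_surjection.h by force
    have "x \<in> ?H" using A.lspan_self[of "x # xs"] Cons.prems(1) by auto
    moreover have "\<one> \<notin> q" using q.one_imp_carrier q.I_notcarr by auto
    then have "quot_proj (ring_module R) q (p x) \<noteq> q"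
      using p(2) RM.quot_proj_coset[OF q' J' True, of \<one>] RM.quot_eq_zero_iff[OF q', of \<one>] by simp
    moreover have "lin R (submod A ?H) (cyc R q) (\<lambda>a. quot_proj (ring_module R) q (p a))"
      using lin_comp[OF p(1)] RM.quot_proj_lin[OF q' J' True] by (simp add: cyc_def)
    ultimately show ?thesis by blast
  next
    case False
    then obtain s where s: "s \<in> carrier R" "s \<odot>\<^bsub>A\<^esub> x \<in> ?Y" "s \<notin> q" by blast
    have sH: "s \<odot>\<^bsub>A\<^esub> a \<in> ?Y" if aH: "a \<in> ?H" for a
    proof -
      obtain y r where a: "y \<in> ?Y" "r \<in> carrier R" "a = y \<oplus>\<^bsub>A\<^esub> r \<odot>\<^bsub>A\<^esub> x" using aH by auto
      then have "s \<odot>\<^bsub>A\<^esub> a = s \<odot>\<^bsub>A\<^esub> y \<oplus>\<^bsub>A\<^esub> r \<odot>\<^bsub>A\<^esub> (s \<odot>\<^bsub>A\<^esub> x)"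
        using s x Yc by (simp add: A.smult_r_distr A.smult_assoc1[symmetric] m_comm)
      then show ?thesis using EY(4)[OF s(1) a(1)] EY(4)[OF a(2) s(2)] EY(5) by simp
    qed
    \<comment> \<open>If \<open>r\<close> kills \<open>Y\<close>, then \<open>r s\<close> kills
      \<open>?H\<close>; so \<open>r s\<close> lies in \<open>q\<close>, and \<open>s\<close> does
      not.\<close>
    have "r \<in> q" if r: "r \<in> carrier R" and 0: "\<And>a. a \<in> ?Y \<Longrightarrow> r \<odot>\<^bsub>A\<^esub> a = \<zero>\<^bsub>A\<^esub>" for r
    proof -
      have "r \<otimes> s \<in> q"
      proof (rule Cons.prems(2))
        fix a assume a: "a \<in> ?H"
        then have "a \<in> carrier A" using A.submoduleE(1)[OF H] by blast
        then show "(r \<otimes> s) \<odot>\<^bsub>A\<^esub> a = \<zero>\<^bsub>A\<^esub>" using 0[OF sH[OF a]] r s by (simp add: A.smult_assoc1)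
      qed (use r s in simp)
      then show ?thesis using q.I_prime[OF r s(1)] s(3) by blast
    qed
    from Cons.IH[OF xs this] obtain f y where f: "lin R (submod A ?Y) (cyc R q) f" "y \<in> ?Y" "f y \<noteq> q"
      by blast
    have "lin R (submod A ?H) (submod A ?Y) (\<lambda>a. s \<odot>\<^bsub>A\<^esub> a)"
      using lin_scale[OF A lin_submodule[OF A.submoduleE(1)[OF H]] s(1)] sH
      by (simp add: lin_def del: lspan.simps)
    from lin_comp[OF this f(1)] have "lin R (submod A ?H) (cyc R q) (\<lambda>a. f (s \<odot>\<^bsub>A\<^esub> a))" .
    moreover have "y \<in> ?H" using A.lspan_Cons_subset[OF x xs] f(2) by blast
    \<comment> \<open>Multiplication by an element outside the prime \<open>q\<close> is injective
      on R/q, so the nonzero value at \<open>y\<close> survives.\<close>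
    moreover have "f (s \<odot>\<^bsub>A\<^esub> y) \<noteq> q"
    proof -
      have "f y \<in> carrier (cyc R q)" using lin_closed[OF f(1), of y] f(2) by simp
      then obtain c where c: "c \<in> carrier R" "f y = q +>\<^bsub>ring_module R\<^esub> c"
        unfolding cyc_def RM.quot_carrier[OF q'] by auto
      have "c \<notin> q" using c f(3) RM.quot_eq_zero_iff[OF q', of c] by auto
      then have "s \<otimes> c \<notin> q" using q.I_prime[OF s(1) c(1)] s(3) by blast
      moreover have "f (s \<odot>\<^bsub>A\<^esub> y) = q +>\<^bsub>ring_module R\<^esub> (s \<otimes> c)"
        using lin_smult[OF f(1) s(1), of y] f(2) c RM.quot_smult[OF q' s(1), of c] by (simp add: cyc_def)
      ultimately show ?thesis using RM.quot_eq_zero_iff[OF q', of "s \<otimes> c"] s(1) c(1) by simp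
    qed
    ultimately show ?thesis by blast
  qed
qed

end

section \<open>Transfer of vanishing along annihilators\<close>

context ext_setting
begin

text \<open>The quotient of R/J by \<open>D\<close> is R/J' for the preimage J' of \<open>D\<close>,
  so R/J is an extension of R/J' by \<open>D\<close>.\<close>

lemma below_cyc_step:
  assumes J: "ideal J R" and D: "submodule D R (cyc R J)"
  defines "J' \<equiv> {r \<in> carrier R. J +>\<^bsub>ring_module R\<^esub> r \<in> D}"
  assumes bD: "below (submod (cyc R J) D) t" and bJ: "below (cyc R J') t"
  shows "below (cyc R J) t"
proof -
  interpret RM: module R "ring_module R" by (rule module_ring_module)
  interpret C: module R "cyc R J" by (rule module_cyc[OF J])
  have Js: "submodule J R (ring_module R)" using J by (simp add: submodule_ring_iff)
  have J's: "submodule J' R (ring_module R)"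
    using submodule_preimage[OF module_ring_module C.module_axioms[unfolded cyc_def] RM.quot_lin[OF Js] D[unfolded cyc_def]]
    by (simp add: J'_def)
  have zD: "J \<in> D" using C.submodule_zero_mem[OF D] RM.quot_zero[OF Js] by (simp add: cyc_def)
  have sub: "J \<subseteq> J'"
  proof
    fix r assume r: "r \<in> J"
    then have rc: "r \<in> carrier R" using RM.submoduleE(1)[OF Js] by auto
    then show "r \<in> J'" using r zD RM.quot_eq_zero_iff[OF Js, of r] by (simp add: J'_def)
  qed
  have "{z \<in> carrier (cyc R J). quot_proj (ring_module R) J' z = \<zero>\<^bsub>cyc R J'\<^esub>} = D"
  proof -
    have "quot_proj (ring_module R) J' z = J' \<longleftrightarrow> z \<in> D" if z: "z \<in> carrier (cyc R J)" for z
    proof -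
      obtain r where r: "r \<in> carrier R" "z = J +>\<^bsub>ring_module R\<^esub> r"
        using z unfolding cyc_def RM.quot_carrier[OF Js] by auto
      then show ?thesis
        using RM.quot_proj_coset[OF J's Js sub, of r] RM.quot_eq_zero_iff[OF J's, of r] by (simp add: J'_def)
    qed
    then show ?thesis using C.submoduleE(1)[OF D] RM.quot_zero[OF J's] by (auto simp: cyc_def)
  qed
  then show ?thesis
    using below_extension[OF RM.quot_proj_surjection[OF J's Js sub], folded cyc_def, of t] bD bJ by simp
qed

theorem below_cyc:
  assumes A: "module R A" and fgA: "fg R A"
  defines "I \<equiv> {r \<in> carrier R. \<forall>x\<in>carrier A. r \<odot>\<^bsub>A\<^esub> x = \<zero>\<^bsub>A\<^esub>}"
  assumes "below A t" "ideal J R" "I \<subseteq> J"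
  shows "below (cyc R J) t"
  using assms(4-6)
proof (induction t arbitrary: J)
  case 0
  show ?case by (rule below_0)
next
  case (Suc t)
  interpret A: module R A by fact
  interpret RM: module R "ring_module R" by (rule module_ring_module)
  have Ic: "I \<subseteq> carrier R" by (auto simp: I_def)
  \<comment> \<open>One degree lower the claim is known for every ideal containing \<open>I\<close>;
    through \<open>below_fg\<close> this covers the kernel that appears at the end.\<close>
  have IH: "below (cyc R J) t" if "ideal J R" "I \<subseteq> J" for J
    using Suc.IH that below_mono[OF Suc.prems(1)] by simp
  define Bad where "Bad = {J. ideal J R \<and> I \<subseteq> J \<and> \<not> below (cyc R J) (Suc t)}"
  have "Bad = {}"
  proof (rule ccontr)
    assume ne: "Bad \<noteq> {}"
    \<comment> \<open>In a noetherian ring a nonempty chain of ideals contains its union, so Zorn's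
      lemma applies.\<close>
    have "\<exists>J\<in>Bad. \<forall>K\<in>Bad. J \<subseteq> K \<longrightarrow> K = J"
    proof (rule subset_Zorn_nonempty[OF ne])
      fix C assume C: "C \<noteq> {}" "subset.chain Bad C"
      then have "subset.chain {I. ideal I R} C" by (auto simp: subset.chain_def Bad_def)
      from noetherian_ring.ideal_chain_is_trivial[OF noeth C(1) this] show "\<Union>C \<in> Bad"
        using C(2) by (auto simp: subset.chain_def)
    qed
    then obtain J where JB: "J \<in> Bad" and max: "\<And>K. K \<in> Bad \<Longrightarrow> J \<subseteq> K \<Longrightarrow> K = J" by blast
    have J: "ideal J R" "I \<subseteq> J" "\<not> below (cyc R J) (Suc t)" using JB by (auto simp: Bad_def)
    then interpret J: ideal J R by simp
    interpret C: module R "cyc R J" by (rule module_cyc[OF J(1)])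
    have Js: "submodule J R (ring_module R)" using J(1) by (simp add: submodule_ring_iff)
    let ?cls = "\<lambda>r. J +>\<^bsub>ring_module R\<^esub> r"
    have cls_lin: "lin R (ring_module R) (cyc R J) ?cls" unfolding cyc_def by (rule RM.quot_lin[OF Js])
    have cls0: "?cls r = \<zero>\<^bsub>cyc R J\<^esub> \<longleftrightarrow> r \<in> J" if "r \<in> carrier R" for r
      using RM.quot_eq_zero_iff[OF Js, of r] RM.quot_zero[OF Js] that by (simp add: cyc_def)
    have up: "below (cyc R K) (Suc t)" if "ideal K R" "J \<subset> K" for K
      using max[of K] that J(2) by (auto simp: Bad_def)
    \<comment> \<open>The quotient of R/J by a nonzero submodule is R/J' with J' strictly larger
      than J, hence good by maximality; were the submodule good as well, so would be R/J.\<close>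
    have no_sub: "\<not> below (submod (cyc R J) D) (Suc t)"
      if D: "submodule D R (cyc R J)" and ex: "\<exists>d\<in>D. d \<noteq> \<zero>\<^bsub>cyc R J\<^esub>" for D
    proof
      assume b: "below (submod (cyc R J) D) (Suc t)"
      let ?J' = "{r \<in> carrier R. ?cls r \<in> D}"
      have "ideal ?J' R"
        using submodule_preimage[OF module_ring_module C.module_axioms cls_lin D] by (simp add: submodule_ring_iff)
      moreover have "J \<subseteq> ?J'"
      proof
        fix r assume r: "r \<in> J"
        then have "r \<in> carrier R" using J.a_subset by blast
        with r show "r \<in> ?J'" using cls0[of r] C.submodule_zero_mem[OF D] by simp
      qed
      moreover obtain d where d: "d \<in> D" "d \<noteq> \<zero>\<^bsub>cyc R J\<^esub>" using ex by blast
      then obtain r where r: "r \<in> carrier R" "d = ?cls r"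
        using C.submoduleE(1)[OF D] RM.quot_carrier[OF Js] by (auto simp: cyc_def)
      then have "r \<in> ?J'" "r \<notin> J" using d cls0 by auto
      ultimately have "below (cyc R ?J') (Suc t)" by (intro up) auto
      then show False using below_cyc_step[OF J(1) D b] J(3) by simp
    qed
    \<comment> \<open>The quotient by the unit ideal is zero, and \<open>A\<close> maps onto it, so
      it is no counterexample.\<close>
    have "carrier R \<noteq> J"
    proof
      assume e: "carrier R = J"
      have "module_surjection R A (cyc R J) (\<lambda>x. \<zero>\<^bsub>cyc R J\<^esub>)"
        using cls0 RM.quot_carrier[OF Js] e A.M.zero_closed
        by (intro module_surjection.intro module_surjection_axioms.intro is_cring A C.module_axioms lin_const_zero C.module_axioms)
          (auto simp: cyc_def)
      from below_quotient[OF this, of t] show False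
        using Suc.prems(1) J(3) below_mono[OF Suc.prems(1), of t] by simp
    qed
    moreover have "a \<in> J \<or> b \<in> J" if ab: "a \<in> carrier R" "b \<in> carrier R" "a \<otimes> b \<in> J" for a b
    proof (rule ccontr)
      assume n: "\<not> (a \<in> J \<or> b \<in> J)"
      let ?Z = "{\<zero>\<^bsub>cyc R J\<^esub>}"
      have ca: "?cls a \<in> carrier (cyc R J)" using lin_closed[OF cls_lin, of a] ab by simp
      \<comment> \<open>The ideal (J : a): the class of \<open>a\<close> generates a copy of R/(J :
        a) inside R/J. It contains \<open>b\<close> as well as \<open>J\<close>, so it is strictly
        larger than \<open>J\<close>.\<close>
      let ?K = "{r \<in> carrier R. r \<odot>\<^bsub>cyc R J\<^esub> ?cls a \<in> ?Z}"
      have Kid: "ideal ?K R" by (rule ideal_quotient[OF C.module_axioms C.submodule_zero ca])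
      have K_iff: "r \<in> ?K \<longleftrightarrow> r \<otimes> a \<in> J" if "r \<in> carrier R" for r
        using cls0[of "r \<otimes> a"] lin_smult[OF cls_lin that, of a] that ab by simp
      have "J \<subseteq> ?K"
      proof
        fix r assume r: "r \<in> J"
        then have "r \<in> carrier R" using J.a_subset by blast
        then show "r \<in> ?K" using K_iff J.I_r_closed[OF r ab(1)] by blast
      qed
      moreover have "b \<in> ?K" using K_iff[OF ab(2)] ab m_comm by simp
      ultimately have bK: "below (cyc R ?K) (Suc t)" using n by (intro up[OF Kid]) blast
      have "module R (submod (cyc R J) ?Z)"
        by (rule module_submod[OF C.module_axioms C.submodule_zero])
      then have bZ: "below (submod (cyc R J) ?Z) (Suc t)"
        by (rule below_zero_module[OF module_cyc[OF Kid] bK]) simp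
      let ?D = "{y \<oplus>\<^bsub>cyc R J\<^esub> r \<odot>\<^bsub>cyc R J\<^esub> ?cls a | y r. y \<in> ?Z \<and> r \<in> carrier R}"
      have "below (submod (cyc R J) ?D) (Suc t)"
        by (rule below_cyclic_step[OF C.module_axioms C.submodule_zero ca bZ bK])
      moreover have "?cls a = \<zero>\<^bsub>cyc R J\<^esub> \<oplus>\<^bsub>cyc R J\<^esub> \<one> \<odot>\<^bsub>cyc R J\<^esub> ?cls a" using ca by simp
      then have "?cls a \<in> ?D" by blast
      moreover have "?cls a \<noteq> \<zero>\<^bsub>cyc R J\<^esub>" using cls0[OF ab(1)] n by blast
      ultimately show False using no_sub[OF C.submodule_sum_cyclic[OF C.submodule_zero ca]] by blast
    qed
    ultimately have prime: "primeideal J R" by (intro primeidealI J(1) is_cring) auto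
    obtain xs where xs: "set xs \<subseteq> carrier A" "carrier A = lspan R A xs" using fgA by (auto simp: fg_def)
    have AA: "submod A (lspan R A xs) = A" unfolding xs(2)[symmetric] by simp
    have "\<exists>f. lin R (submod A (lspan R A xs)) (cyc R J) f \<and> (\<exists>a\<in>lspan R A xs. f a \<noteq> J)"
      by (rule hom_to_prime_quotient[OF A prime xs(1)]) (use J(2) xs(2) in \<open>auto simp: I_def\<close>)
    then obtain f a where f: "lin R A (cyc R J) f" "a \<in> carrier A" "f a \<noteq> J"
      using AA xs(2) by auto
    let ?D = "f ` carrier A"
    have D: "submodule ?D R (cyc R J)"
      by (rule submodule_image[OF A C.module_axioms f(1) A.carrier_is_submodule])
    have ms: "module_surjection R A (submod (cyc R J) ?D) f"
      using f(1) module_submod[OF C.module_axioms D]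
      by (intro module_surjection.intro module_surjection_axioms.intro is_cring A) (auto simp: lin_def)
    let ?K = "{x \<in> carrier A. f x = \<zero>\<^bsub>cyc R J\<^esub>}"
    have K: "submodule ?K R A" by (rule submodule_ker[OF A C.module_axioms f(1)])
    \<comment> \<open>The bound \<open>t\<close> suffices for the kernel, because left exactness in
      a degree involves the kernel only one degree lower.\<close>
    have "below (submod A ?K) t"
      by (rule below_fg[OF module_submod[OF A K] fg_submodule[OF noeth A fgA K] _ Ic IH])
        (auto simp: I_def)
    then have "below (submod (cyc R J) ?D) (Suc t)"
      using below_quotient[OF ms, of t] Suc.prems(1) by simp
    moreover have "f a \<noteq> \<zero>\<^bsub>cyc R J\<^esub>" using f(3) RM.quot_zero[OF Js] by (simp add: cyc_def)
    ultimately show False using no_sub[OF D] f(2) by blast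
  qed
  then show ?case using Suc.prems(2,3) by (auto simp: Bad_def)
qed

corollary below_transfer:
  assumes "module R A" "fg R A" "below A t" "module R L" "fg R L"
    and "\<And>r x. r \<in> carrier R \<Longrightarrow> (\<And>a. a \<in> carrier A \<Longrightarrow> r \<odot>\<^bsub>A\<^esub> a = \<zero>\<^bsub>A\<^esub>) \<Longrightarrow>
      x \<in> carrier L \<Longrightarrow> r \<odot>\<^bsub>L\<^esub> x = \<zero>\<^bsub>L\<^esub>"
  shows "below L t"
  by (rule below_fg[OF assms(4,5) _ _ below_cyc[OF assms(1-3)]]) (use assms(6) in auto)

end

section \<open>Supports\<close>

context module
begin

text \<open>The fraction x/1 vanishes exactly when some element outside the prime kills
  \<open>x\<close>. From here on support is spoken of through torsion only.\<close>

lemma Supp_iff: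
  "\<pp> \<in> Supp R M \<longleftrightarrow> primeideal \<pp> R \<and> \<not> (\<forall>x\<in>carrier M. \<exists>s\<in>carrier R - \<pp>. s \<odot>\<^bsub>M\<^esub> x = \<zero>\<^bsub>M\<^esub>)"
proof (cases "primeideal \<pp> R")
  case True
  then interpret p: primeideal \<pp> R .
  let ?S = "carrier R - \<pp>" and ?L = "loc_module R (carrier R - \<pp>) M"
  let ?rel = "frac_rel R ?S M"
  have one: "\<one> \<in> ?S" using p.one_imp_carrier p.I_notcarr by auto
  have mult: "s \<otimes> t \<in> ?S" if "s \<in> ?S" "t \<in> ?S" for s t using that p.I_prime by auto
  have carr: "carrier ?L = (carrier M \<times> ?S) // ?rel" and zero: "\<zero>\<^bsub>?L\<^esub> = ?rel `` {(\<zero>\<^bsub>M\<^esub>, \<one>)}"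
    by (simp_all add: loc_module_def)
  have "carrier ?L = {\<zero>\<^bsub>?L\<^esub>} \<longleftrightarrow> (\<forall>x\<in>carrier M. \<exists>s\<in>?S. s \<odot>\<^bsub>M\<^esub> x = \<zero>\<^bsub>M\<^esub>)"
  proof
    assume eq: "carrier ?L = {\<zero>\<^bsub>?L\<^esub>}"
    show "\<forall>x\<in>carrier M. \<exists>s\<in>?S. s \<odot>\<^bsub>M\<^esub> x = \<zero>\<^bsub>M\<^esub>"
    proof
      fix x assume x: "x \<in> carrier M"
      have "?rel `` {(x, \<one>)} \<in> carrier ?L" unfolding carr using x one by (intro quotientI) simp
      then have "?rel `` {(x, \<one>)} = ?rel `` {(\<zero>\<^bsub>M\<^esub>, \<one>)}" using eq zero by simp
      moreover have "((x, \<one>), (x, \<one>)) \<in> ?rel"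
        using x one by (auto simp: frac_rel_def a_minus_def M.r_neg intro!: bexI[of _ \<one>])
      ultimately have "((\<zero>\<^bsub>M\<^esub>, \<one>), (x, \<one>)) \<in> ?rel" by auto
      then obtain u where u: "u \<in> ?S" "u \<odot>\<^bsub>M\<^esub> (\<ominus>\<^bsub>M\<^esub> x) = \<zero>\<^bsub>M\<^esub>"
        using x by (auto simp: frac_rel_def a_minus_def)
      then have "\<ominus>\<^bsub>M\<^esub> (u \<odot>\<^bsub>M\<^esub> x) = \<zero>\<^bsub>M\<^esub>" using x by (simp add: smult_r_minus)
      then have "u \<odot>\<^bsub>M\<^esub> x = \<zero>\<^bsub>M\<^esub>" using u(1) x by (metis DiffD1 M.minus_equality M.l_zero M.zero_closed M.minus_minus smult_closed)
      then show "\<exists>s\<in>?S. s \<odot>\<^bsub>M\<^esub> x = \<zero>\<^bsub>M\<^esub>" using u(1) by blast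
    qed
  next
    assume tors: "\<forall>x\<in>carrier M. \<exists>s\<in>?S. s \<odot>\<^bsub>M\<^esub> x = \<zero>\<^bsub>M\<^esub>"
    \<comment> \<open>If every element is torsion, any two fractions are equivalent, so there is a
      single class.\<close>
    have all: "((x, s), (y, t)) \<in> ?rel" if "x \<in> carrier M" "s \<in> ?S" "y \<in> carrier M" "t \<in> ?S" for x s y t
    proof -
      have "t \<odot>\<^bsub>M\<^esub> x \<ominus>\<^bsub>M\<^esub> s \<odot>\<^bsub>M\<^esub> y \<in> carrier M" using that by simp
      then show ?thesis using tors that unfolding frac_rel_def by blast
    qed
    have "?rel `` {z} = carrier M \<times> ?S" if "z \<in> carrier M \<times> ?S" for z
      using all that by (auto simp: frac_rel_def)
    then show "carrier ?L = {\<zero>\<^bsub>?L\<^esub>}"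
      unfolding carr zero quotient_def using one M.zero_closed by auto
  qed
  then show ?thesis using True by (simp add: Supp_def)
qed (simp add: Supp_def)

end

section \<open>The Ext modules\<close>

lemma (in primeideal) compl_submonoid: "submonoid (carrier R - I) R"
  using one_imp_carrier I_notcarr I_prime by (intro submonoid.intro) auto

abbreviation cochains ::
    "('r, 'x) ring_scheme \<Rightarrow> ('r, 'm, 'y) module_scheme \<Rightarrow> ('r, 'n, 'z) module_scheme \<Rightarrow> nat
      \<Rightarrow> ('r, (('r, 'm) gen \<Rightarrow> 'r) \<Rightarrow> 'n) module" where
  "cochains R A N j \<equiv> Hom_module R (free_res R A j) N"

context cring
begin

lemma Hom_module_simps:
  "carrier (Hom_module R A N) = mod_hom R A N"
  "\<zero>\<^bsub>Hom_module R A N\<^esub> = (\<lambda>x\<in>carrier A. \<zero>\<^bsub>N\<^esub>)"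
  "f \<oplus>\<^bsub>Hom_module R A N\<^esub> g = (\<lambda>x\<in>carrier A. f x \<oplus>\<^bsub>N\<^esub> g x)"
  "r \<odot>\<^bsub>Hom_module R A N\<^esub> f = (\<lambda>x\<in>carrier A. r \<odot>\<^bsub>N\<^esub> f x)"
  by (simp_all add: Hom_module_def)

lemma module_Hom:
  assumes A: "module R A" and N: "module R N"
  shows "module R (Hom_module R A N)"
proof -
  let ?H = "Hom_module R A N"
  interpret A: module R A by fact
  interpret N: module R N by fact
  have lin: "lin R A N f" if "f \<in> mod_hom R A N" for f using that by (simp add: mod_hom_iff)
  note c = lin_closed[OF lin]
  \<comment> \<open>Adding zero or scaling by one returns the same function only because both sides
    are \<open>undefined\<close> outside the carrier.\<close>
  have ext: "f x = undefined" if "f \<in> mod_hom R A N" "x \<notin> carrier A" for f x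
    using that by (auto simp: mod_hom_iff extensional_def)
  show ?thesis
  proof (rule moduleI)
    show "abelian_group (?H)"
    proof (rule abelian_groupI)
      fix f g assume f: "f \<in> carrier (?H)" and g: "g \<in> carrier (?H)"
      show "f \<oplus>\<^bsub>?H\<^esub> g \<in> carrier (?H)"
        using f g lin_plus[OF N lin lin] by (simp add: Hom_module_simps mod_hom_iff lin_restrict[OF A])
      show "f \<oplus>\<^bsub>?H\<^esub> g = g \<oplus>\<^bsub>?H\<^esub> f"
        using f g c by (auto simp: Hom_module_simps restrict_def N.M.a_comm fun_eq_iff)
      {
        fix k assume k: "k \<in> carrier (?H)"
        show "f \<oplus>\<^bsub>?H\<^esub> g \<oplus>\<^bsub>?H\<^esub> k =
            f \<oplus>\<^bsub>?H\<^esub> (g \<oplus>\<^bsub>?H\<^esub> k)"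
          using f g k c by (auto simp: Hom_module_simps restrict_def N.M.a_assoc fun_eq_iff)
      }
    next
      show "\<zero>\<^bsub>?H\<^esub> \<in> carrier (?H)"
        using lin_const_zero[OF N] by (simp add: Hom_module_simps mod_hom_iff lin_restrict[OF A])
    next
      fix f assume f: "f \<in> carrier (?H)"
      show "\<zero>\<^bsub>?H\<^esub> \<oplus>\<^bsub>?H\<^esub> f = f"
        using f ext[of f] c by (auto simp: Hom_module_simps restrict_def fun_eq_iff)
      show "\<exists>g\<in>carrier (?H). g \<oplus>\<^bsub>?H\<^esub> f = \<zero>\<^bsub>?H\<^esub>"
      proof
        show "(\<lambda>x\<in>carrier A. \<ominus>\<^bsub>N\<^esub> f x) \<in> carrier (?H)"
          using f lin_uminus[OF N lin] by (simp add: Hom_module_simps mod_hom_iff lin_restrict[OF A])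
        show "(\<lambda>x\<in>carrier A. \<ominus>\<^bsub>N\<^esub> f x) \<oplus>\<^bsub>?H\<^esub> f = \<zero>\<^bsub>?H\<^esub>"
          using f c by (auto simp: Hom_module_simps N.M.l_neg intro!: restrict_ext)
      qed
    qed
  next
    fix r f assume r: "r \<in> carrier R" and f: "f \<in> carrier (?H)"
    show "r \<odot>\<^bsub>?H\<^esub> f \<in> carrier (?H)"
      using f r lin_scale[OF N lin] by (simp add: Hom_module_simps mod_hom_iff lin_restrict[OF A])
    {
      fix s assume s: "s \<in> carrier R"
      show "(r \<oplus> s) \<odot>\<^bsub>?H\<^esub> f =
          r \<odot>\<^bsub>?H\<^esub> f \<oplus>\<^bsub>?H\<^esub> s \<odot>\<^bsub>?H\<^esub> f"
        using r s f c by (auto simp: Hom_module_simps restrict_def N.smult_l_distr fun_eq_iff)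
      show "(r \<otimes> s) \<odot>\<^bsub>?H\<^esub> f =
          r \<odot>\<^bsub>?H\<^esub> (s \<odot>\<^bsub>?H\<^esub> f)"
        using r s f c by (auto simp: Hom_module_simps restrict_def N.smult_assoc1 fun_eq_iff)
    }
    fix g assume g: "g \<in> carrier (?H)"
    show "r \<odot>\<^bsub>?H\<^esub> (f \<oplus>\<^bsub>?H\<^esub> g) =
        r \<odot>\<^bsub>?H\<^esub> f \<oplus>\<^bsub>?H\<^esub> r \<odot>\<^bsub>?H\<^esub> g"
      using r f g c by (auto simp: Hom_module_simps restrict_def N.smult_r_distr fun_eq_iff)
  next
    fix f assume f: "f \<in> carrier (?H)"
    show "\<one> \<odot>\<^bsub>?H\<^esub> f = f"
      using f ext[of f] c by (auto simp: Hom_module_simps restrict_def fun_eq_iff)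
  qed (rule is_cring)
qed

text \<open>Gives both the differential of Hom(F, N) and the pullback of cochains along a map of
  resolutions. Cocycles are then a kernel, and coboundaries in positive degree an image.\<close>

lemma precomp_lin:
  assumes U: "module R U" and V: "module R V" and N: "module R N" and g: "lin R U V g"
  shows "lin R (Hom_module R V N) (Hom_module R U N) (\<lambda>f. \<lambda>z\<in>carrier U. f (g z))"
proof (rule linI)
  fix f assume "f \<in> carrier (Hom_module R V N)"
  then show "(\<lambda>z\<in>carrier U. f (g z)) \<in> carrier (Hom_module R U N)"
    using lin_comp[OF g, of N f] by (simp add: Hom_module_simps mod_hom_iff lin_restrict[OF U])
qed (use lin_closed[OF g] in \<open>auto simp: Hom_module_simps intro!: restrict_ext\<close>)

context
  fixes A :: "('a, 'm, 'y) module_scheme" and N :: "('a, 'n, 'z) module_scheme" and j :: nat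
  assumes A: "module R A" and N: "module R N"
begin

interpretation N: module R N by (rule N)
interpretation HM: module R "cochains R A N j" by (rule module_Hom[OF module_free_res N])

lemma Ext_cocycles_submodule: "submodule (Ext_cocycles R A N j) R (cochains R A N j)"
proof -
  note d = precomp_lin[OF module_free_res module_free_res N lin_res_d[OF A], of j]
  have "(\<lambda>z\<in>carrier (free_res R A (Suc j)). f (res_d R z)) = \<zero>\<^bsub>cochains R A N (Suc j)\<^esub> \<longleftrightarrow>
      (\<forall>z\<in>carrier (free_res R A (Suc j)). f (res_d R z) = \<zero>\<^bsub>N\<^esub>)" for f
    by (auto simp: Hom_module_simps restrict_def fun_eq_iff)
  then show ?thesis
    using submodule_ker[OF module_Hom[OF module_free_res N] module_Hom[OF module_free_res N] d]
    by (simp add: Ext_cocycles_def Hom_module_simps(1))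
qed

lemma Ext_coboundaries_submodule: "submodule (Ext_coboundaries R A N j) R (cochains R A N j)"
proof (cases j)
  case 0
  then show ?thesis using HM.submodule_zero by simp
next
  case (Suc i)
  then show ?thesis
    using submodule_image[OF module_Hom[OF module_free_res N] HM.module_axioms[unfolded Suc]
        precomp_lin[OF module_free_res module_free_res N lin_res_d[OF A]]
        module.carrier_is_submodule[OF module_Hom[OF module_free_res N]]]
    by (simp add: Hom_module_simps(1) del: res_gens.simps)
qed

lemma Ext_coboundaries_iff:
  "f \<in> Ext_coboundaries R A N j \<longleftrightarrow>
     f \<in> mod_hom R (free_res R A j) N \<and> ext_coboundary R A N j f"
proof (cases j)
  case 0
  have "f = (\<lambda>x\<in>carrier (free_res R A j). \<zero>\<^bsub>N\<^esub>)"
    if "f \<in> extensional (carrier (free_res R A j))" "\<forall>z\<in>carrier (free_res R A j). f z = \<zero>\<^bsub>N\<^esub>"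
    using that by (auto simp: fun_eq_iff extensional_def)
  then show ?thesis
    using 0 HM.M.zero_closed by (auto simp: Hom_module_simps coboundary_0 mod_hom_iff)
next
  case (Suc i)
  note d = lin_res_d[OF A, of i]
  show ?thesis
  proof
    assume "f \<in> Ext_coboundaries R A N j"
    then obtain g where g: "g \<in> mod_hom R (free_res R A i) N"
      "f = (\<lambda>z\<in>carrier (free_res R A j). g (res_d R z))" using Suc by auto
    then have "lin R (free_res R A j) N f"
      using lin_comp[OF d, of N g] Suc by (simp add: lin_restrict[OF module_free_res] mod_hom_iff)
    then show "f \<in> mod_hom R (free_res R A j) N \<and> ext_coboundary R A N j f"
      using g by (auto simp: Suc mod_hom_iff coboundary_Suc)
  next
    assume f: "f \<in> mod_hom R (free_res R A j) N \<and> ext_coboundary R A N j f"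
    then obtain g where g: "lin R (free_res R A i) N g"
      "\<And>z. z \<in> carrier (free_res R A j) \<Longrightarrow> f z = g (res_d R z)" by (auto simp: Suc coboundary_Suc)
    let ?g = "restrict g (carrier (free_res R A i))"
    have "?g \<in> mod_hom R (free_res R A i) N" using g(1) by (simp add: mod_hom_iff lin_restrict[OF module_free_res])
    moreover have "f = (\<lambda>z\<in>carrier (free_res R A j). ?g (res_d R z))"
      using f g(2) lin_closed[OF d] Suc by (auto simp: fun_eq_iff mod_hom_iff extensional_def)
    ultimately show "f \<in> Ext_coboundaries R A N j"
      unfolding Suc Ext_coboundaries.simps by (intro image_eqI[of _ _ ?g])
  qed
qed

lemma coboundary_vanishes:
  assumes "lin R (free_res R A j) N f" "ext_coboundary R A N j f"
    and z: "z \<in> carrier (free_res R A (Suc j))"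
  shows "f (res_d R z) = \<zero>\<^bsub>N\<^esub>"
proof (cases j)
  case 0
  then show ?thesis using assms lin_closed[OF lin_res_d[OF A] z] by (simp add: coboundary_0)
next
  case (Suc i)
  then obtain g where g: "lin R (free_res R A i) N g"
    "\<And>z. z \<in> carrier (free_res R A j) \<Longrightarrow> f z = g (res_d R z)"
    using assms(2) by (auto simp: coboundary_Suc)
  have "res_d R (res_d R z) = \<zero>\<^bsub>free_res R A i\<^esub>"
    using res_d_d[OF A z] by (simp add: free_res_def free_simps)
  then show ?thesis
    using g(2)[OF lin_closed[OF lin_res_d[OF A] z]] lin_zero[OF module_free_res N g(1)] by simp
qed

end

end

definition cocycle_module ::
    "('r, 'x) ring_scheme \<Rightarrow> ('r, 'm, 'y) module_scheme \<Rightarrow> ('r, 'n, 'z) module_scheme \<Rightarrow> nat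
      \<Rightarrow> ('r, (('r, 'm) gen \<Rightarrow> 'r) \<Rightarrow> 'n) module" where
  "cocycle_module R A N j = submod (cochains R A N j) (Ext_cocycles R A N j)"

definition Ext_class ::
    "('r, 'x) ring_scheme \<Rightarrow> ('r, 'm, 'y) module_scheme \<Rightarrow> ('r, 'n, 'z) module_scheme \<Rightarrow> nat
      \<Rightarrow> ((('r, 'm) gen \<Rightarrow> 'r) \<Rightarrow> 'n) \<Rightarrow> ((('r, 'm) gen \<Rightarrow> 'r) \<Rightarrow> 'n) set" where
  "Ext_class R A N j f = Ext_coboundaries R A N j +>\<^bsub>cocycle_module R A N j\<^esub> f"

context cring
begin

lemma cocycle_module_simps:
  "carrier (cocycle_module R A N j) = Ext_cocycles R A N j"
  "\<zero>\<^bsub>cocycle_module R A N j\<^esub> = (\<lambda>x\<in>carrier (free_res R A j). \<zero>\<^bsub>N\<^esub>)"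
  "f \<oplus>\<^bsub>cocycle_module R A N j\<^esub> g = (\<lambda>x\<in>carrier (free_res R A j). f x \<oplus>\<^bsub>N\<^esub> g x)"
  "r \<odot>\<^bsub>cocycle_module R A N j\<^esub> f = (\<lambda>x\<in>carrier (free_res R A j). r \<odot>\<^bsub>N\<^esub> f x)"
  by (simp_all add: cocycle_module_def Hom_module_simps)

lemma Ext_cocycles_iff:
  "f \<in> Ext_cocycles R A N j \<longleftrightarrow> lin R (free_res R A j) N f \<and>
    f \<in> extensional (carrier (free_res R A j)) \<and>
    (\<forall>z\<in>carrier (free_res R A (Suc j)). f (res_d R z) = \<zero>\<^bsub>N\<^esub>)"
  by (auto simp: Ext_cocycles_def mod_hom_iff)

lemma Ext_eq_quot: "Ext R A N j = quot_module (cocycle_module R A N j) (Ext_coboundaries R A N j)"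
  by (simp add: Ext_def cocycle_module_def)

context
  fixes A :: "('a, 'm, 'y) module_scheme" and N :: "('a, 'n, 'z) module_scheme" and j :: nat
  assumes A: "module R A" and N: "module R N"
begin

lemma module_cocycles: "module R (cocycle_module R A N j)"
  unfolding cocycle_module_def
  by (rule submodule.submodule_is_module[OF Ext_cocycles_submodule[OF A N] module_Hom[OF module_free_res N]])

interpretation N: module R N by (rule N)
interpretation C: module R "cocycle_module R A N j" by (rule module_cocycles)

lemma coboundaries_submodule: "submodule (Ext_coboundaries R A N j) R (cocycle_module R A N j)"
proof (rule C.module_incl_imp_submodule)
  show "Ext_coboundaries R A N j \<subseteq> carrier (cocycle_module R A N j)"
    using coboundary_vanishes[OF A N]
    by (auto simp: Ext_coboundaries_iff[OF A N] cocycle_module_simps Ext_cocycles_iff mod_hom_iff)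
  show "module R (submod (cocycle_module R A N j) (Ext_coboundaries R A N j))"
    using module_submod[OF module_Hom[OF module_free_res N] Ext_coboundaries_submodule[OF A N]]
    by (simp add: cocycle_module_def)
qed

lemma module_Ext: "module R (Ext R A N j)"
  unfolding Ext_eq_quot by (rule C.module_quot[OF coboundaries_submodule])

lemma Ext_carrier: "carrier (Ext R A N j) = Ext_class R A N j ` Ext_cocycles R A N j"
  unfolding Ext_eq_quot C.quot_carrier[OF coboundaries_submodule]
  by (simp add: Ext_class_def cocycle_module_simps)

lemma Ext_class_lin: "lin R (cocycle_module R A N j) (Ext R A N j) (Ext_class R A N j)"
  unfolding Ext_eq_quot Ext_class_def by (rule C.quot_lin[OF coboundaries_submodule])

lemma Ext_class_zero_iff:
  "f \<in> Ext_cocycles R A N j \<Longrightarrow>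
    Ext_class R A N j f = \<zero>\<^bsub>Ext R A N j\<^esub> \<longleftrightarrow> ext_coboundary R A N j f"
  using C.quot_eq_zero_iff[OF coboundaries_submodule, of f] C.quot_zero[OF coboundaries_submodule]
  by (auto simp: Ext_eq_quot Ext_class_def cocycle_module_simps Ext_coboundaries_iff[OF A N] Ext_cocycles_iff mod_hom_iff)

lemma Ext_class_smult:
  "r \<in> carrier R \<Longrightarrow> f \<in> Ext_cocycles R A N j \<Longrightarrow>
    r \<odot>\<^bsub>Ext R A N j\<^esub> Ext_class R A N j f = Ext_class R A N j (\<lambda>x\<in>carrier (free_res R A j). r \<odot>\<^bsub>N\<^esub> f x)"
  using lin_smult[OF Ext_class_lin, of r f] by (simp add: cocycle_module_simps)

lemma cocycles_smult:
  "r \<in> carrier R \<Longrightarrow> f \<in> Ext_cocycles R A N j \<Longrightarrow>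
    (\<lambda>x\<in>carrier (free_res R A j). r \<odot>\<^bsub>N\<^esub> f x) \<in> Ext_cocycles R A N j"
  using C.smult_closed[of r f] by (simp add: cocycle_module_simps)

lemma coboundary_restrict:
  "ext_coboundary R A N j (restrict f (carrier (free_res R A j))) =
    ext_coboundary R A N j f"
  by (cases j) (auto simp: coboundary_0 coboundary_Suc)

lemma Ext_class_smult_zero_iff:
  assumes "r \<in> carrier R" "f \<in> Ext_cocycles R A N j"
  shows "r \<odot>\<^bsub>Ext R A N j\<^esub> Ext_class R A N j f = \<zero>\<^bsub>Ext R A N j\<^esub> \<longleftrightarrow>
    ext_coboundary R A N j (\<lambda>z. r \<odot>\<^bsub>N\<^esub> f z)"
  using Ext_class_smult[OF assms] Ext_class_zero_iff[OF cocycles_smult[OF assms]]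
  by (simp add: coboundary_restrict)

text \<open>Elements of \<open>Ext\<close> have extensional representatives, while
  \<open>ext_torsion\<close> ranges over all linear maps; restriction to the carrier passes from one
  to the other.\<close>

lemma ext_torsion_iff:
  assumes "S \<subseteq> carrier R"
  shows "ext_torsion R S A N j \<longleftrightarrow>
    (\<forall>u\<in>carrier (Ext R A N j). \<exists>s\<in>S. s \<odot>\<^bsub>Ext R A N j\<^esub> u = \<zero>\<^bsub>Ext R A N j\<^esub>)"
proof -
  have "ext_torsion R S A N j \<longleftrightarrow>
    (\<forall>f\<in>Ext_cocycles R A N j. \<exists>s\<in>S. ext_coboundary R A N j (\<lambda>z. s \<odot>\<^bsub>N\<^esub> f z))"
    (is "?l \<longleftrightarrow> ?r")
  proof
    assume ?l
    then show ?r by (auto simp: ext_torsion_def torsion_coh_def Ext_cocycles_iff)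
  next
    assume r: ?r
    show ?l unfolding ext_torsion_def torsion_coh_def
    proof (intro allI impI)
      fix f assume f: "lin R (free_res R A j) N f \<and> (\<forall>z\<in>carrier (free_res R A (Suc j)). f (res_d R z) = \<zero>\<^bsub>N\<^esub>)"
      let ?f = "restrict f (carrier (free_res R A j))"
      have "?f \<in> Ext_cocycles R A N j"
        using f lin_closed[OF lin_res_d[OF A]] by (simp add: Ext_cocycles_iff lin_restrict[OF module_free_res])
      then obtain s where s: "s \<in> S" "ext_coboundary R A N j (\<lambda>z. s \<odot>\<^bsub>N\<^esub> ?f z)"
        using r by blast
      from s(2) have "ext_coboundary R A N j (\<lambda>z. s \<odot>\<^bsub>N\<^esub> f z)"
        by (cases j) (auto simp: coboundary_0 coboundary_Suc)
      with s(1) show "\<exists>s\<in>S. ext_coboundary R A N j (\<lambda>z. s \<odot>\<^bsub>N\<^esub> f z)" by blast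
    qed
  qed
  then show ?thesis using assms by (simp add: Ext_carrier Ext_class_smult_zero_iff subset_iff)
qed

lemma Supp_Ext_iff:
  "\<pp> \<in> Supp R (Ext R A N j) \<longleftrightarrow> primeideal \<pp> R \<and> \<not> ext_torsion R (carrier R - \<pp>) A N j"
  using module.Supp_iff[OF module_Ext] by (simp add: ext_torsion_iff)

end

section \<open>Functoriality of Ext in the first argument\<close>

lemma cocycle_pullback:
  assumes A: "module R A" and B: "module R B" and N: "module R N" and h: "lin R A B h"
    and f: "f \<in> Ext_cocycles R B N j"
  shows "(\<lambda>z\<in>carrier (free_res R A j). f (res_map R h z)) \<in> Ext_cocycles R A N j"
proof -
  note m = lin_res_map[OF A B h]
  have "lin R (free_res R A j) N (\<lambda>z. f (res_map R h z))"
    using f by (intro lin_comp[OF m]) (simp add: Ext_cocycles_iff)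
  moreover have "f (res_map R h (res_d R z)) = \<zero>\<^bsub>N\<^esub>" if z: "z \<in> carrier (free_res R A (Suc j))" for z
    using f lin_closed[OF m z] unfolding res_d_map[OF A B h z, symmetric] by (simp add: Ext_cocycles_iff)
  ultimately show ?thesis
    using lin_closed[OF lin_res_d[OF A]] by (simp add: Ext_cocycles_iff lin_restrict[OF module_free_res])
qed

lemma coboundary_pullback:
  assumes A: "module R A" and B: "module R B" and h: "lin R A B h"
    and f: "ext_coboundary R B N j f"
  shows "ext_coboundary R A N j (\<lambda>z. f (res_map R h z))"
proof (cases j)
  case 0
  then show ?thesis using f lin_closed[OF lin_res_map[OF A B h]] by (auto simp: coboundary_0)
next
  case (Suc i)
  then obtain g where g: "lin R (free_res R B i) N g"
    "\<And>z. z \<in> carrier (free_res R B (Suc i)) \<Longrightarrow> f z = g (res_d R z)"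
    using f by (auto simp: coboundary_Suc)
  then show ?thesis
    unfolding Suc coboundary_Suc
    using lin_comp[OF lin_res_map[OF A B h] g(1)] lin_closed[OF lin_res_map[OF A B h]] res_d_map[OF A B h]
    by (intro exI[of _ "\<lambda>z. g (res_map R h z)"]) auto
qed

lemma pullback_lin:
  assumes A: "module R A" and B: "module R B" and N: "module R N" and h: "lin R A B h"
  shows "lin R (cocycle_module R B N j) (cocycle_module R A N j)
    (\<lambda>f. \<lambda>z\<in>carrier (free_res R A j). f (res_map R h z))"
  using precomp_lin[OF module_free_res module_free_res N lin_res_map[OF A B h], of j]
    cocycle_pullback[OF A B N h] by (simp add: lin_def cocycle_module_def Ext_cocycles_def Hom_module_simps(1))

lemma Ext_map_class:
  assumes A: "module R A" and B: "module R B" and N: "module R N" and h: "lin R A B h"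
    and f: "f \<in> Ext_cocycles R B N j"
  shows "Ext_map R A h N j (Ext_class R B N j f) =
    Ext_class R A N j (\<lambda>z\<in>carrier (free_res R A j). f (res_map R h z))"
proof -
  interpret CB: module R "cocycle_module R B N j" by (rule module_cocycles[OF B N])
  interpret CA: module R "cocycle_module R A N j" by (rule module_cocycles[OF A N])
  let ?p = "\<lambda>f. \<lambda>z\<in>carrier (free_res R A j). f (res_map R h z)"
  note sB = coboundaries_submodule[OF B N, of j] and sA = coboundaries_submodule[OF A N, of j]
  note p = pullback_lin[OF A B N h, of j]
  \<comment> \<open>\<open>Ext_map\<close> takes cosets among all cochains and
    \<open>Ext_class\<close> among cocycles; these agree because a coset depends only on the
    addition.\<close>
  have "Ext_map R A h N j (Ext_class R B N j f) = (\<Union>g\<in>Ext_class R B N j f. Ext_class R A N j (?p g))"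
    by (simp add: Ext_map_def Ext_class_def cocycle_module_def a_r_coset_def r_coset_def)
  also have "\<dots> = Ext_class R A N j (?p f)"
    unfolding Ext_class_def[of R B]
  proof (rule CB.coset_UN_eq[OF sB])
    show fc: "f \<in> carrier (cocycle_module R B N j)" using f by (simp add: cocycle_module_simps)
    fix g assume g: "g \<in> Ext_coboundaries R B N j +>\<^bsub>cocycle_module R B N j\<^esub> f"
    have gc: "g \<in> carrier (cocycle_module R B N j)" by (rule CB.coset_subset[OF sB fc g])
    have "g \<ominus>\<^bsub>cocycle_module R B N j\<^esub> f \<in> Ext_coboundaries R B N j"
      using abelian_subgroup.a_rcos_module[OF CB.submodule_abelian_subgroup[OF sB] fc gc] g
      by (simp add: a_minus_def)
    then have "ext_coboundary R A N j
        (\<lambda>z. (g \<ominus>\<^bsub>cocycle_module R B N j\<^esub> f) (res_map R h z))"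
      by (intro coboundary_pullback[OF A B h]) (simp add: Ext_coboundaries_iff[OF B N])
    then have "ext_coboundary R A N j (?p (g \<ominus>\<^bsub>cocycle_module R B N j\<^esub> f))"
      by (simp add: coboundary_restrict[OF A N])
    moreover have "?p (g \<ominus>\<^bsub>cocycle_module R B N j\<^esub> f) \<in> Ext_cocycles R A N j"
      using gc fc by (intro cocycle_pullback[OF A B N h]) (simp add: cocycle_module_simps(1)[symmetric])
    ultimately have "?p (g \<ominus>\<^bsub>cocycle_module R B N j\<^esub> f) \<in> Ext_coboundaries R A N j"
      by (simp add: Ext_coboundaries_iff[OF A N] Ext_cocycles_def)
    then have "?p g \<ominus>\<^bsub>cocycle_module R A N j\<^esub> ?p f \<in> Ext_coboundaries R A N j"
      by (simp add: lin_minus[OF CB.module_axioms CA.module_axioms p gc fc])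
    then show "Ext_class R A N j (?p g) = Ext_class R A N j (?p f)"
      unfolding Ext_class_def using CA.quot_eq_iff[OF sA lin_closed[OF p gc] lin_closed[OF p fc]] by blast
  qed
  finally show ?thesis .
qed

lemma Ext_map_lin:
  assumes A: "module R A" and B: "module R B" and N: "module R N" and h: "lin R A B h"
  shows "lin R (Ext R B N j) (Ext R A N j) (Ext_map R A h N j)"
proof (rule lin_factor[OF Ext_class_lin[OF B N] _ _ module_cocycles[OF B N]])
  show "carrier (Ext R B N j) \<subseteq> Ext_class R B N j ` carrier (cocycle_module R B N j)"
    by (simp add: Ext_carrier[OF B N] cocycle_module_simps)
  show "lin R (cocycle_module R B N j) (Ext R A N j) (\<lambda>f. Ext_map R A h N j (Ext_class R B N j f))"
    using lin_comp[OF pullback_lin[OF A B N h] Ext_class_lin[OF A N]]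
    by (subst lin_cong[OF module_cocycles[OF B N] Ext_map_class[OF A B N h]])
      (simp_all add: cocycle_module_simps)
qed

lemma Ext_map_id:
  assumes A: "module R A" and N: "module R N" and h: "\<And>x. x \<in> carrier A \<Longrightarrow> h x = x"
    and u: "u \<in> carrier (Ext R A N j)"
  shows "Ext_map R A h N j u = u"
proof -
  obtain f where f: "f \<in> Ext_cocycles R A N j" "u = Ext_class R A N j f"
    using u unfolding Ext_carrier[OF A N] by blast
  have hl: "lin R A A h" by (subst lin_cong[OF A h]) (auto simp: lin_id)
  have "(\<lambda>z\<in>carrier (free_res R A j). f (res_map R h z)) = f"
  proof
    fix z
    show "(\<lambda>z\<in>carrier (free_res R A j). f (res_map R h z)) z = f z"
      using f(1) res_map_id[of A h z j] h by (cases "z \<in> carrier (free_res R A j)")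
        (auto simp: Ext_cocycles_iff extensional_def)
  qed
  then show ?thesis using Ext_map_class[OF A A N hl f(1)] f(2) by simp
qed

lemma Ext_map_comp:
  assumes A: "module R A" and B: "module R B" and C: "module R C" and N: "module R N"
    and h: "lin R A B h" and g: "lin R B C g" and k: "\<And>x. x \<in> carrier A \<Longrightarrow> k x = g (h x)"
    and u: "u \<in> carrier (Ext R C N j)"
  shows "Ext_map R A h N j (Ext_map R B g N j u) = Ext_map R A k N j u"
proof -
  obtain f where f: "f \<in> Ext_cocycles R C N j" "u = Ext_class R C N j f"
    using u unfolding Ext_carrier[OF C N] by blast
  have kl: "lin R A C k" using lin_comp[OF h g] by (subst lin_cong[OF A k]) auto
  have "(\<lambda>z\<in>carrier (free_res R A j). (\<lambda>z\<in>carrier (free_res R B j). f (res_map R g z)) (res_map R h z)) =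
      (\<lambda>z\<in>carrier (free_res R A j). f (res_map R k z))"
  proof (rule restrict_ext)
    fix z assume z: "z \<in> carrier (free_res R A j)"
    have "res_map R g (res_map R h z) = res_map R k z"
      using res_map_comp[OF z] res_map_cong[OF k z] by simp
    then show "(\<lambda>z\<in>carrier (free_res R B j). f (res_map R g z)) (res_map R h z) = f (res_map R k z)"
      using lin_closed[OF lin_res_map[OF A B h] z] by simp
  qed
  then show ?thesis
    unfolding f(2) Ext_map_class[OF B C N g f(1)] Ext_map_class[OF A C N kl f(1)]
      Ext_map_class[OF A B N h cocycle_pullback[OF B C N g f(1)]] by simp
qed

end

section \<open>Direct limits\<close>

locale direct_system = cring R for R :: "('r, 'x) ring_scheme" (structure) +
  fixes Z :: "nat \<Rightarrow> ('r, 'a, 'y) module_scheme" and \<phi> :: "nat \<Rightarrow> nat \<Rightarrow> 'a \<Rightarrow> 'a"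
  assumes modZ: "module R (Z n)"
    and lin: "n \<le> k \<Longrightarrow> lin R (Z n) (Z k) (\<phi> n k)"
    and id: "u \<in> carrier (Z n) \<Longrightarrow> \<phi> n n u = u"
    and comp: "n \<le> k \<Longrightarrow> k \<le> l \<Longrightarrow> u \<in> carrier (Z n) \<Longrightarrow> \<phi> k l (\<phi> n k u) = \<phi> n l u"
begin

abbreviation D where "D \<equiv> dirlim Z \<phi>"

definition cls :: "nat \<Rightarrow> 'a \<Rightarrow> (nat \<times> 'a) set" where
  "cls n u = dirlim_rel Z \<phi> `` {(n, u)}"

lemma closed: "n \<le> k \<Longrightarrow> u \<in> carrier (Z n) \<Longrightarrow> \<phi> n k u \<in> carrier (Z k)"
  by (rule lin_closed[OF lin])

lemma rel_iff: "((n, u), (m, v)) \<in> dirlim_rel Z \<phi> \<longleftrightarrow>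
    u \<in> carrier (Z n) \<and> v \<in> carrier (Z m) \<and> (\<exists>k\<ge>max n m. \<phi> n k u = \<phi> m k v)"
  by (auto simp: dirlim_rel_def)

lemma rel_trans:
  assumes "((n, u), (m, v)) \<in> dirlim_rel Z \<phi>" "((m, v), (l, w)) \<in> dirlim_rel Z \<phi>"
  shows "((n, u), (l, w)) \<in> dirlim_rel Z \<phi>"
proof -
  obtain k k' where k: "max n m \<le> k" "\<phi> n k u = \<phi> m k v" "max m l \<le> k'" "\<phi> m k' v = \<phi> l k' w"
    and c: "u \<in> carrier (Z n)" "v \<in> carrier (Z m)" "w \<in> carrier (Z l)"
    using assms by (auto simp: rel_iff)
  let ?K = "max k k'"
  have "\<phi> n ?K u = \<phi> k ?K (\<phi> n k u)" using comp[of n k ?K u] k c by simp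
  also have "\<dots> = \<phi> m ?K v" using comp[of m k ?K v] k c by simp
  also have "\<dots> = \<phi> k' ?K (\<phi> m k' v)" using comp[of m k' ?K v] k c by simp
  also have "\<dots> = \<phi> l ?K w" using comp[of l k' ?K w] k c by simp
  finally show ?thesis using c k by (auto simp: rel_iff intro!: exI[of _ ?K])
qed

lemma equiv_rel: "equiv (SIGMA n:UNIV. carrier (Z n)) (dirlim_rel Z \<phi>)"
proof (rule equivI)
  show "dirlim_rel Z \<phi> \<subseteq> (SIGMA n:UNIV. carrier (Z n)) \<times> (SIGMA n:UNIV. carrier (Z n))"
    by (auto simp: dirlim_rel_def)
  show "refl_on (SIGMA n:UNIV. carrier (Z n)) (dirlim_rel Z \<phi>)"
    by (auto simp: refl_on_def rel_iff dirlim_rel_def)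
  show "sym (dirlim_rel Z \<phi>)" by (auto simp: sym_def dirlim_rel_def)
  show "trans (dirlim_rel Z \<phi>)" using rel_trans by (auto simp: trans_def)
qed

lemma cls_eq_iff:
  assumes "u \<in> carrier (Z n)" "v \<in> carrier (Z m)"
  shows "cls n u = cls m v \<longleftrightarrow> (\<exists>k\<ge>max n m. \<phi> n k u = \<phi> m k v)"
  using assms eq_equiv_class_iff[OF equiv_rel, of "(n, u)" "(m, v)"] by (simp add: cls_def rel_iff)

lemma cls_up: "n \<le> k \<Longrightarrow> u \<in> carrier (Z n) \<Longrightarrow> cls k (\<phi> n k u) = cls n u"
  using closed[of n k u] comp[of n k k u] by (subst cls_eq_iff) auto

lemma mem_cls_iff: "u \<in> carrier (Z n) \<Longrightarrow> (m, v) \<in> cls n u \<longleftrightarrow> v \<in> carrier (Z m) \<and> cls m v = cls n u"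
  using cls_eq_iff[of u n v m] by (auto simp: cls_def rel_iff)

lemma carrier_dirlim: "carrier D = {cls n u | n u. u \<in> carrier (Z n)}"
  by (auto simp: dirlim_def cls_def quotient_def)

lemma zero_dirlim: "\<zero>\<^bsub>D\<^esub> = cls 0 \<zero>\<^bsub>Z 0\<^esub>"
  by (simp add: dirlim_def cls_def)

lemma zero_closed': "\<zero>\<^bsub>Z n\<^esub> \<in> carrier (Z n)"
proof -
  interpret module R "Z n" by (rule modZ)
  show ?thesis by simp
qed

lemma zero_cls: "\<zero>\<^bsub>D\<^esub> = cls n \<zero>\<^bsub>Z n\<^esub>"
  using cls_up[of 0 n "\<zero>\<^bsub>Z 0\<^esub>"] zero_closed'[of 0] lin_zero[OF modZ modZ lin[of 0 n]]
  by (simp add: zero_dirlim)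

lemma smult_cls:
  assumes r: "r \<in> carrier R" and u: "u \<in> carrier (Z n)"
  shows "r \<odot>\<^bsub>D\<^esub> cls n u = cls n (r \<odot>\<^bsub>Z n\<^esub> u)"
proof -
  have "(case p of (m, v) \<Rightarrow> cls m (r \<odot>\<^bsub>Z m\<^esub> v)) = cls n (r \<odot>\<^bsub>Z n\<^esub> u)" if "p \<in> cls n u" for p
  proof -
    obtain m v where p: "p = (m, v)" by (cases p)
    then have v: "v \<in> carrier (Z m)" "cls m v = cls n u" using that mem_cls_iff[OF u] by auto
    then obtain k where k: "k \<ge> max m n" "\<phi> m k v = \<phi> n k u" using cls_eq_iff[OF v(1) u] by blast
    have "r \<odot>\<^bsub>Z m\<^esub> v \<in> carrier (Z m)" "r \<odot>\<^bsub>Z n\<^esub> u \<in> carrier (Z n)"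
      using module.smult_closed[OF modZ r] u v(1) by auto
    moreover have "\<phi> m k (r \<odot>\<^bsub>Z m\<^esub> v) = \<phi> n k (r \<odot>\<^bsub>Z n\<^esub> u)"
      using lin_smult[OF lin[of m k] r v(1)] lin_smult[OF lin[of n k] r u] k by simp
    ultimately show ?thesis using cls_eq_iff k(1) p by auto
  qed
  then have "(\<Union>p\<in>cls n u. case p of (m, v) \<Rightarrow> cls m (r \<odot>\<^bsub>Z m\<^esub> v)) = (\<Union>p\<in>cls n u. cls n (r \<odot>\<^bsub>Z n\<^esub> u))"
    by (rule SUP_cong[OF refl])
  also have "\<dots> = cls n (r \<odot>\<^bsub>Z n\<^esub> u)"
    using mem_cls_iff[OF u, of n u] u by (intro SUP_const) auto
  finally have "(\<Union>p\<in>cls n u. case p of (m, v) \<Rightarrow> cls m (r \<odot>\<^bsub>Z m\<^esub> v)) = cls n (r \<odot>\<^bsub>Z n\<^esub> u)" .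
  then show ?thesis by (simp add: dirlim_def cls_def)
qed

text \<open>Addition in the limit is computed at stage \<open>max n m\<close>. Moving it to an
  arbitrary later stage lets two pairs of representatives be compared at one common stage.\<close>

lemma add_rep_eq:
  assumes u: "u \<in> carrier (Z n)" and v: "v \<in> carrier (Z m)" and k: "k \<ge> max n m"
  shows "cls (max n m) (\<phi> n (max n m) u \<oplus>\<^bsub>Z (max n m)\<^esub> \<phi> m (max n m) v) = cls k (\<phi> n k u \<oplus>\<^bsub>Z k\<^esub> \<phi> m k v)"
proof -
  let ?l = "max n m"
  interpret Zl: module R "Z ?l" by (rule modZ)
  have c: "\<phi> n ?l u \<in> carrier (Z ?l)" "\<phi> m ?l v \<in> carrier (Z ?l)" using closed u v by auto
  have "\<phi> ?l k (\<phi> n ?l u \<oplus>\<^bsub>Z ?l\<^esub> \<phi> m ?l v) = \<phi> n k u \<oplus>\<^bsub>Z k\<^esub> \<phi> m k v"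
    using lin_add[OF lin[OF k] c] comp[of n ?l k u] comp[of m ?l k v] u v k by simp
  then show ?thesis using cls_up[OF k, of "\<phi> n ?l u \<oplus>\<^bsub>Z ?l\<^esub> \<phi> m ?l v"] c by simp
qed

lemma add_cls:
  assumes u: "u \<in> carrier (Z n)" and v: "v \<in> carrier (Z n)"
  shows "cls n u \<oplus>\<^bsub>D\<^esub> cls n v = cls n (u \<oplus>\<^bsub>Z n\<^esub> v)"
proof -
  let ?F = "\<lambda>p q. case p of (a, x) \<Rightarrow> case q of (b, y) \<Rightarrow>
    cls (max a b) (\<phi> a (max a b) x \<oplus>\<^bsub>Z (max a b)\<^esub> \<phi> b (max a b) y)"
  have const: "?F p q = cls n (u \<oplus>\<^bsub>Z n\<^esub> v)" if "p \<in> cls n u" "q \<in> cls n v" for p q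
  proof -
    obtain a x b y where pq: "p = (a, x)" "q = (b, y)" by (cases p, cases q)
    then have x: "x \<in> carrier (Z a)" "cls a x = cls n u" and y: "y \<in> carrier (Z b)" "cls b y = cls n v"
      using that mem_cls_iff u v by auto
    obtain k where k: "k \<ge> max a n" "\<phi> a k x = \<phi> n k u" using cls_eq_iff[OF x(1) u] x(2) by blast
    obtain l where l: "l \<ge> max b n" "\<phi> b l y = \<phi> n l v" using cls_eq_iff[OF y(1) v] y(2) by blast
    let ?K = "max k l"
    have eq: "\<phi> a ?K x = \<phi> n ?K u" "\<phi> b ?K y = \<phi> n ?K v"
      using comp[of a k ?K x] comp[of n k ?K u] comp[of b l ?K y] comp[of n l ?K v] k l x y u v by auto
    have K: "max a b \<le> ?K" "max n n \<le> ?K" using k l by auto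
    have "?F p q = cls ?K (\<phi> a ?K x \<oplus>\<^bsub>Z ?K\<^esub> \<phi> b ?K y)"
      using add_rep_eq[OF x(1) y(1) K(1)] by (simp add: pq)
    also have "\<dots> = cls n (u \<oplus>\<^bsub>Z n\<^esub> v)"
      using add_rep_eq[OF u v K(2)] eq id u v by simp
    finally show ?thesis .
  qed
  have "(n, u) \<in> cls n u" "(n, v) \<in> cls n v" using mem_cls_iff u v by auto
  then have "(\<Union>p\<in>cls n u. \<Union>q\<in>cls n v. cls n (u \<oplus>\<^bsub>Z n\<^esub> v)) = cls n (u \<oplus>\<^bsub>Z n\<^esub> v)" by blast
  then have "(\<Union>p\<in>cls n u. \<Union>q\<in>cls n v. ?F p q) = cls n (u \<oplus>\<^bsub>Z n\<^esub> v)"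
    using SUP_cong[OF refl SUP_cong[OF refl const], of "cls n u" "\<lambda>p. cls n v"] by (simp only:)
  moreover have "cls n u \<oplus>\<^bsub>D\<^esub> cls n v = (\<Union>p\<in>cls n u. \<Union>q\<in>cls n v. ?F p q)"
    by (auto simp: dirlim_def cls_def split: prod.splits)
  ultimately show ?thesis by simp
qed

lemma common_stage:
  assumes "c \<in> carrier D" "d \<in> carrier D" "e \<in> carrier D"
  shows "\<exists>n u v w. u \<in> carrier (Z n) \<and> v \<in> carrier (Z n) \<and> w \<in> carrier (Z n) \<and>
    c = cls n u \<and> d = cls n v \<and> e = cls n w"
proof -
  obtain i j k u v w where *: "u \<in> carrier (Z i)" "v \<in> carrier (Z j)" "w \<in> carrier (Z k)"
    "c = cls i u" "d = cls j v" "e = cls k w"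
    using assms unfolding carrier_dirlim by blast
  obtain n where n: "i \<le> n" "j \<le> n" "k \<le> n" by (metis linorder_linear order_trans)
  have "c = cls n (\<phi> i n u)" "d = cls n (\<phi> j n v)" "e = cls n (\<phi> k n w)"
    using * cls_up n by simp_all
  moreover have "\<phi> i n u \<in> carrier (Z n)" "\<phi> j n v \<in> carrier (Z n)" "\<phi> k n w \<in> carrier (Z n)"
    using * closed n by simp_all
  ultimately show ?thesis by blast
qed

lemma cls_closed: "u \<in> carrier (Z n) \<Longrightarrow> cls n u \<in> carrier D"
  by (auto simp: carrier_dirlim)

theorem module_dirlim: "module R D"
proof (rule moduleI)
  show "abelian_group D"
  proof (rule abelian_groupI)
    fix c d assume c: "c \<in> carrier D" and d: "d \<in> carrier D"
    obtain n u v where *: "u \<in> carrier (Z n)" "v \<in> carrier (Z n)" "c = cls n u" "d = cls n v"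
      using common_stage[OF c d d] by blast
    interpret Zn: module R "Z n" by (rule modZ)
    show "c \<oplus>\<^bsub>D\<^esub> d \<in> carrier D" using * by (simp add: add_cls cls_closed)
    show "c \<oplus>\<^bsub>D\<^esub> d = d \<oplus>\<^bsub>D\<^esub> c" using * by (simp add: add_cls Zn.M.a_comm)
  next
    fix c d e assume cde: "c \<in> carrier D" "d \<in> carrier D" "e \<in> carrier D"
    obtain n u v w where *: "u \<in> carrier (Z n)" "v \<in> carrier (Z n)" "w \<in> carrier (Z n)"
      "c = cls n u" "d = cls n v" "e = cls n w"
      using common_stage[OF cde] by blast
    interpret Zn: module R "Z n" by (rule modZ)
    show "c \<oplus>\<^bsub>D\<^esub> d \<oplus>\<^bsub>D\<^esub> e = c \<oplus>\<^bsub>D\<^esub> (d \<oplus>\<^bsub>D\<^esub> e)"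
      using * by (simp add: add_cls Zn.M.a_assoc)
  next
    show "\<zero>\<^bsub>D\<^esub> \<in> carrier D"
      unfolding zero_dirlim by (intro cls_closed zero_closed')
  next
    fix c assume c: "c \<in> carrier D"
    obtain n u where *: "u \<in> carrier (Z n)" "c = cls n u" using c unfolding carrier_dirlim by blast
    interpret Zn: module R "Z n" by (rule modZ)
    show "\<zero>\<^bsub>D\<^esub> \<oplus>\<^bsub>D\<^esub> c = c" using * by (simp add: zero_cls[of n] add_cls)
    show "\<exists>d\<in>carrier D. d \<oplus>\<^bsub>D\<^esub> c = \<zero>\<^bsub>D\<^esub>"
      using * by (intro bexI[of _ "cls n (\<ominus>\<^bsub>Z n\<^esub> u)"]) (simp_all add: zero_cls[of n] add_cls cls_closed Zn.M.l_neg)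
  qed
next
  fix r c assume r: "r \<in> carrier R" and c: "c \<in> carrier D"
  obtain n u where *: "u \<in> carrier (Z n)" "c = cls n u" using c unfolding carrier_dirlim by blast
  interpret Zn: module R "Z n" by (rule modZ)
  show "r \<odot>\<^bsub>D\<^esub> c \<in> carrier D" using * r by (simp add: smult_cls cls_closed)
  {
    fix s assume s: "s \<in> carrier R"
    show "(r \<oplus> s) \<odot>\<^bsub>D\<^esub> c = r \<odot>\<^bsub>D\<^esub> c \<oplus>\<^bsub>D\<^esub> s \<odot>\<^bsub>D\<^esub> c"
      using * r s by (simp add: smult_cls add_cls Zn.smult_l_distr)
    show "(r \<otimes> s) \<odot>\<^bsub>D\<^esub> c = r \<odot>\<^bsub>D\<^esub> (s \<odot>\<^bsub>D\<^esub> c)"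
      using * r s by (simp add: smult_cls Zn.smult_assoc1)
  }
next
  fix c assume c: "c \<in> carrier D"
  obtain n u where *: "u \<in> carrier (Z n)" "c = cls n u" using c unfolding carrier_dirlim by blast
  interpret Zn: module R "Z n" by (rule modZ)
  show "\<one> \<odot>\<^bsub>D\<^esub> c = c" using * by (simp add: smult_cls)
next
  fix r c d assume r: "r \<in> carrier R" and c: "c \<in> carrier D" and d: "d \<in> carrier D"
  obtain n u v where *: "u \<in> carrier (Z n)" "v \<in> carrier (Z n)" "c = cls n u" "d = cls n v"
    using common_stage[OF c d d] by blast
  interpret Zn: module R "Z n" by (rule modZ)
  show "r \<odot>\<^bsub>D\<^esub> (c \<oplus>\<^bsub>D\<^esub> d) = r \<odot>\<^bsub>D\<^esub> c \<oplus>\<^bsub>D\<^esub> r \<odot>\<^bsub>D\<^esub> d"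
    using * r by (simp add: smult_cls add_cls Zn.smult_r_distr)
qed (rule is_cring)

lemma cls_eq_zero_iff:
  assumes "u \<in> carrier (Z n)"
  shows "cls n u = \<zero>\<^bsub>D\<^esub> \<longleftrightarrow> (\<exists>k\<ge>n. \<phi> n k u = \<zero>\<^bsub>Z k\<^esub>)"
  using cls_eq_iff[OF assms zero_closed'[of n]] lin_zero[OF modZ modZ lin[of n]]
  by (auto simp: zero_cls[of n])

text \<open>\<open>s\<close> kills the class of \<open>u\<close> exactly when some later transition
  map kills \<open>s u\<close>, so torsion of the limit is expressed by the stages alone.\<close>

theorem Supp_dirlim_iff:
  "\<pp> \<in> Supp R D \<longleftrightarrow> primeideal \<pp> R \<and>
    \<not> (\<forall>n. \<forall>u\<in>carrier (Z n). \<exists>s\<in>carrier R - \<pp>. \<exists>k\<ge>n. \<phi> n k (s \<odot>\<^bsub>Z n\<^esub> u) = \<zero>\<^bsub>Z k\<^esub>)"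
proof -
  have "(\<exists>s\<in>carrier R - \<pp>. s \<odot>\<^bsub>D\<^esub> cls n u = \<zero>\<^bsub>D\<^esub>) \<longleftrightarrow>
      (\<exists>s\<in>carrier R - \<pp>. \<exists>k\<ge>n. \<phi> n k (s \<odot>\<^bsub>Z n\<^esub> u) = \<zero>\<^bsub>Z k\<^esub>)" if "u \<in> carrier (Z n)" for n u
    using that module.smult_closed[OF modZ, of _ u n]
    by (intro bex_cong refl) (simp add: smult_cls cls_eq_zero_iff)
  then show ?thesis
    unfolding module.Supp_iff[OF module_dirlim] carrier_dirlim by blast
qed

end

section \<open>Powers of an ideal\<close>

context module
begin

lemma submodule_Inter:
  assumes "\<H> \<noteq> {}" "\<And>H. H \<in> \<H> \<Longrightarrow> submodule H R M"
  shows "submodule (\<Inter>\<H>) R M"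
proof (rule submoduleI)
  show "\<Inter>\<H> \<subseteq> carrier M" using assms submoduleE(1) by (meson Inter_lower all_not_in_conv order_trans)
qed (use assms(2) submodule_zero_mem submoduleE(3,4,5) in \<open>auto simp: Inter_iff\<close>)

lemma span_submodule: "T \<subseteq> carrier M \<Longrightarrow> submodule (submodule_span R M T) R M"
  unfolding submodule_span_def using carrier_is_submodule by (intro submodule_Inter) auto

lemma span_superset: "T \<subseteq> submodule_span R M T"
  by (auto simp: submodule_span_def)

lemma span_minimal: "submodule H R M \<Longrightarrow> T \<subseteq> H \<Longrightarrow> submodule_span R M T \<subseteq> H"
  by (auto simp: submodule_span_def)

lemma ideal_times_submodule: "J \<subseteq> carrier R \<Longrightarrow> submodule (ideal_times_module R J M) R M"
  unfolding ideal_times_module_def by (rule span_submodule) auto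

lemma ideal_times_mem: "a \<in> J \<Longrightarrow> x \<in> carrier M \<Longrightarrow> a \<odot>\<^bsub>M\<^esub> x \<in> ideal_times_module R J M"
  unfolding ideal_times_module_def by (rule subsetD[OF span_superset]) auto

lemma ideal_times_minimal:
  assumes "submodule H R M" "\<And>a x. a \<in> J \<Longrightarrow> x \<in> carrier M \<Longrightarrow> a \<odot>\<^bsub>M\<^esub> x \<in> H"
  shows "ideal_times_module R J M \<subseteq> H"
  unfolding ideal_times_module_def using assms by (intro span_minimal) auto

lemma ideal_times_mono: "J \<subseteq> J' \<Longrightarrow> J' \<subseteq> carrier R \<Longrightarrow> ideal_times_module R J M \<subseteq> ideal_times_module R J' M"
  by (intro ideal_times_minimal ideal_times_submodule) (auto intro: ideal_times_mem)

text \<open>Lets a product with \<open>r\<close> be tested on the generators of an ideal times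
  \<open>M\<close>, through \<open>ideal_times_minimal\<close>.\<close>

lemma submodule_colon:
  assumes H: "submodule H R M" and r: "r \<in> carrier R"
  shows "submodule {x \<in> carrier M. r \<odot>\<^bsub>M\<^esub> x \<in> H} R M"
  by (rule submodule_preimage[OF module_axioms module_axioms lin_scale[OF module_axioms lin_id r] H])

end

lemma (in cring) ideal_pow:
  assumes "ideal I R"
  shows "ideal (I [^]\<^bsub>ideals_set R\<^esub> (n::nat)) R"
    and "I [^]\<^bsub>ideals_set R\<^esub> (0::nat) = carrier R"
    and "I [^]\<^bsub>ideals_set R\<^esub> (Suc n) = (I [^]\<^bsub>ideals_set R\<^esub> n) \<cdot> I"
    and "I [^]\<^bsub>ideals_set R\<^esub> (1::nat) = I"
proof -
  interpret IS: comm_monoid "ideals_set R" by (rule ideals_set_is_comm_monoid)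
  have c: "I \<in> carrier (ideals_set R)" using assms by (simp add: ideals_set_def)
  have m: "x \<otimes>\<^bsub>ideals_set R\<^esub> y = x \<cdot> y" for x y by (simp add: ideals_set_def)
  show "ideal (I [^]\<^bsub>ideals_set R\<^esub> n) R" using IS.nat_pow_closed[OF c] by (simp add: ideals_set_def)
  show "I [^]\<^bsub>ideals_set R\<^esub> (0::nat) = carrier R" by (simp add: ideals_set_def)
  show "I [^]\<^bsub>ideals_set R\<^esub> (Suc n) = (I [^]\<^bsub>ideals_set R\<^esub> n) \<cdot> I" by (simp only: IS.nat_pow_Suc m)
  show "I [^]\<^bsub>ideals_set R\<^esub> (1::nat) = I" using c by (simp only: IS.nat_pow_eone)
qed

locale adic_setting = cring R + M: module R M + N: module R N
  for R :: "('r, 'x) ring_scheme" (structure) and M :: "('r, 'm, 'y) module_scheme"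
    and N :: "('r, 'n, 'z) module_scheme" +
  fixes I :: "'r set"
  assumes I: "ideal I R"
begin

definition pow_sub :: "nat \<Rightarrow> 'm set" where
  "pow_sub n = ideal_times_module R (I [^]\<^bsub>ideals_set R\<^esub> n) M"

lemmas modN = N.module_axioms

abbreviation Q :: "nat \<Rightarrow> ('r, 'm set) module" where
  "Q n \<equiv> power_quot R I M n"

lemma Q_eq: "Q n = quot_module M (pow_sub n)"
  by (simp add: power_quot_def pow_sub_def)

lemma pow_carrier: "I [^]\<^bsub>ideals_set R\<^esub> (n::nat) \<subseteq> carrier R"
  using ideal_pow(1)[OF I] by (metis ideal.Icarr subsetI)

lemma pow_sub_submodule: "submodule (pow_sub n) R M"
  unfolding pow_sub_def by (rule M.ideal_times_submodule[OF pow_carrier])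

lemma pow_sub_mono: "n \<le> k \<Longrightarrow> pow_sub k \<subseteq> pow_sub n"
proof (induction k rule: dec_induct)
  case (step k)
  have "I [^]\<^bsub>ideals_set R\<^esub> (Suc k) \<subseteq> I [^]\<^bsub>ideals_set R\<^esub> k"
    using ideal_prod_inter[OF ideal_pow(1)[OF I, of k] I] by (simp only: ideal_pow(3)[OF I]) blast
  then have "pow_sub (Suc k) \<subseteq> pow_sub k" unfolding pow_sub_def by (rule M.ideal_times_mono[OF _ pow_carrier])
  with step show ?case by blast
qed simp

lemma pow_sub_0: "pow_sub 0 = carrier M"
proof
  show "pow_sub 0 \<subseteq> carrier M" using M.submoduleE(1)[OF pow_sub_submodule] .
  show "carrier M \<subseteq> pow_sub 0"
  proof
    fix x assume x: "x \<in> carrier M"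
    then have "\<one> \<odot>\<^bsub>M\<^esub> x \<in> pow_sub 0"
      unfolding pow_sub_def ideal_pow(2)[OF I] by (intro M.ideal_times_mem) auto
    then show "x \<in> pow_sub 0" using x by simp
  qed
qed

lemma pow_sub_1: "pow_sub 1 = ideal_times_module R I M"
  by (simp only: pow_sub_def ideal_pow(4)[OF I])

text \<open>If \<open>r M\<close> lies in I M, then \<open>r (a x) = a (r x)\<close> lies in I^n (I
  M) for \<open>a\<close> in I^n. Thus the annihilator of M/IM kills every factor of the adic
  filtration.\<close>

lemma pow_sub_Suc:
  assumes r: "r \<in> carrier R" and k: "\<And>x. x \<in> carrier M \<Longrightarrow> r \<odot>\<^bsub>M\<^esub> x \<in> pow_sub 1"
    and y: "y \<in> pow_sub n"
  shows "r \<odot>\<^bsub>M\<^esub> y \<in> pow_sub (Suc n)"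
proof -
  note sub = pow_sub_submodule[of "Suc n"]
  have mult: "a \<odot>\<^bsub>M\<^esub> w \<in> pow_sub (Suc n)" if a: "a \<in> I [^]\<^bsub>ideals_set R\<^esub> n" and w: "w \<in> pow_sub 1" for a w
  proof -
    have ac: "a \<in> carrier R" using a pow_carrier by blast
    have "ideal_times_module R I M \<subseteq> {w \<in> carrier M. a \<odot>\<^bsub>M\<^esub> w \<in> pow_sub (Suc n)}"
    proof (rule M.ideal_times_minimal[OF M.submodule_colon[OF sub ac]])
      fix b x assume b: "b \<in> I" and x: "x \<in> carrier M"
      have bc: "b \<in> carrier R" using b I ideal.Icarr by metis
      have "(a \<otimes> b) \<odot>\<^bsub>M\<^esub> x \<in> pow_sub (Suc n)"
        unfolding pow_sub_def ideal_pow(3)[OF I]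
        by (intro M.ideal_times_mem ideal_prod.prod a b x)
      then show "b \<odot>\<^bsub>M\<^esub> x \<in> {w \<in> carrier M. a \<odot>\<^bsub>M\<^esub> w \<in> pow_sub (Suc n)}"
        using x ac bc by (simp add: M.smult_assoc1)
    qed
    then show ?thesis using w unfolding pow_sub_1 by blast
  qed
  have "pow_sub n \<subseteq> {y \<in> carrier M. r \<odot>\<^bsub>M\<^esub> y \<in> pow_sub (Suc n)}"
    unfolding pow_sub_def[of n]
  proof (rule M.ideal_times_minimal[OF M.submodule_colon[OF sub r]])
    fix a x assume a: "a \<in> I [^]\<^bsub>ideals_set R\<^esub> n" and x: "x \<in> carrier M"
    have ac: "a \<in> carrier R" using a pow_carrier by blast
    have "r \<odot>\<^bsub>M\<^esub> (a \<odot>\<^bsub>M\<^esub> x) = a \<odot>\<^bsub>M\<^esub> (r \<odot>\<^bsub>M\<^esub> x)"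
      using r ac x by (simp add: M.smult_assoc1[symmetric] m_comm)
    then show "a \<odot>\<^bsub>M\<^esub> x \<in> {y \<in> carrier M. r \<odot>\<^bsub>M\<^esub> y \<in> pow_sub (Suc n)}"
      using mult[OF a k[OF x]] ac x by simp
  qed
  then show ?thesis using y by blast
qed

lemma module_Q: "module R (Q n)"
  unfolding Q_eq by (rule M.module_quot[OF pow_sub_submodule])

lemma Q_surjection: "n \<le> k \<Longrightarrow> module_surjection R (Q k) (Q n) (quot_proj M (pow_sub n))"
  unfolding Q_eq by (rule M.quot_proj_surjection[OF pow_sub_submodule pow_sub_submodule pow_sub_mono])

lemma Q_lin: "n \<le> k \<Longrightarrow> lin R (Q k) (Q n) (quot_proj M (pow_sub n))"
  unfolding Q_eq by (rule M.quot_proj_lin[OF pow_sub_submodule pow_sub_submodule pow_sub_mono])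

lemma Q_rep: "z \<in> carrier (Q n) \<Longrightarrow> \<exists>x\<in>carrier M. z = pow_sub n +>\<^bsub>M\<^esub> x"
  unfolding Q_eq M.quot_carrier[OF pow_sub_submodule] by blast

lemma quot_proj_pow:
  "n \<le> k \<Longrightarrow> x \<in> carrier M \<Longrightarrow> quot_proj M (pow_sub n) (pow_sub k +>\<^bsub>M\<^esub> x) = pow_sub n +>\<^bsub>M\<^esub> x"
  by (rule M.quot_proj_coset[OF pow_sub_submodule pow_sub_submodule pow_sub_mono])

sublocale coh: direct_system R "\<lambda>n. Ext R (Q n) N j"
  "\<lambda>n k. Ext_map R (Q k) (quot_proj M (pow_sub n)) N j" for j
proof (intro direct_system.intro direct_system_axioms.intro is_cring)
  show "module R (Ext R (Q n) N j)" for n by (rule module_Ext[OF module_Q modN])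
  show "lin R (Ext R (Q n) N j) (Ext R (Q k) N j) (Ext_map R (Q k) (quot_proj M (pow_sub n)) N j)"
    if "n \<le> k" for n k
    by (rule Ext_map_lin[OF module_Q module_Q modN Q_lin[OF that]])
  show "Ext_map R (Q n) (quot_proj M (pow_sub n)) N j u = u" if "u \<in> carrier (Ext R (Q n) N j)" for n u
    by (rule Ext_map_id[OF module_Q modN _ that]) (auto dest!: Q_rep simp: quot_proj_pow)
  show "Ext_map R (Q l) (quot_proj M (pow_sub k)) N j (Ext_map R (Q k) (quot_proj M (pow_sub n)) N j u) =
      Ext_map R (Q l) (quot_proj M (pow_sub n)) N j u"
    if "n \<le> k" "k \<le> l" "u \<in> carrier (Ext R (Q n) N j)" for n k l u
    by (rule Ext_map_comp[OF module_Q module_Q module_Q modN Q_lin[OF that(2)] Q_lin[OF that(1)] _ that(3)])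
      (use that(1,2) in \<open>auto dest!: Q_rep simp: quot_proj_pow\<close>)
qed

lemma Supp_local_cohomology_iff:
  "\<pp> \<in> Supp R (gen_local_cohomology R I M N j) \<longleftrightarrow> primeideal \<pp> R \<and>
    \<not> (\<forall>n. \<forall>u\<in>carrier (Ext R (Q n) N j). \<exists>s\<in>carrier R - \<pp>. \<exists>k\<ge>n.
        Ext_map R (Q k) (quot_proj M (pow_sub n)) N j (s \<odot>\<^bsub>Ext R (Q n) N j\<^esub> u) = \<zero>\<^bsub>Ext R (Q k) N j\<^esub>)"
  unfolding gen_local_cohomology_def pow_sub_def[symmetric] by (rule coh.Supp_dirlim_iff)

section \<open>Torsion of Ext of the quotients and of their limit\<close>

context
  fixes S :: "'r set"
  assumes ES: "ext_setting R N S" and fgM: "fg R M"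
begin

interpretation ES: ext_setting R N S by (rule ES)

lemma fg_Q: "fg R (Q n)"
  unfolding Q_eq
  using M.quot_lin[OF pow_sub_submodule] M.module_quot[OF pow_sub_submodule] M.quot_carrier[OF pow_sub_submodule]
  by (intro fg_image[OF M.module_axioms _ _ _ fgM]) auto

text \<open>The kernel of M/I^(n+1)M -> M/I^nM consists of the classes from I^n M. By
  \<open>pow_sub_Suc\<close> the annihilator of M/IM kills it, so vanishing transfers from
  \<open>Q 1\<close> to the kernel and then to the extension.\<close>

lemma below_Q:
  assumes "ES.below (Q 1) t"
  shows "ES.below (Q n) t"
proof (induction n)
  case 0
  \<comment> \<open>The zeroth power of \<open>I\<close> is the whole ring, so this is the zero
    module M/M.\<close>
  have "carrier (Q 0) = {\<zero>\<^bsub>Q 0\<^esub>}"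
    unfolding Q_eq M.quot_carrier[OF pow_sub_submodule] M.quot_zero[OF pow_sub_submodule]
    using M.quot_eq_zero_iff[OF pow_sub_submodule[of 0]] M.M.zero_closed by (auto simp: pow_sub_0)
  then show ?case by (rule ES.below_zero_module[OF module_Q assms module_Q])
next
  case (Suc n)
  let ?K = "{z \<in> carrier (Q (Suc n)). quot_proj M (pow_sub n) z = \<zero>\<^bsub>Q n\<^esub>}"
  have K: "submodule ?K R (Q (Suc n))"
    by (rule submodule_ker[OF module_Q module_Q Q_lin]) simp
  have "ES.below (submod (Q (Suc n)) ?K) t"
  proof (rule ES.below_transfer[OF module_Q fg_Q assms module_submod[OF module_Q K]
        fg_submodule[OF ES.noeth module_Q fg_Q K]])
    fix r z assume r: "r \<in> carrier R" and kill: "\<And>a. a \<in> carrier (Q 1) \<Longrightarrow> r \<odot>\<^bsub>Q 1\<^esub> a = \<zero>\<^bsub>Q 1\<^esub>"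
      and "z \<in> carrier (submod (Q (Suc n)) ?K)"
    then have z: "z \<in> carrier (Q (Suc n))" "quot_proj M (pow_sub n) z = \<zero>\<^bsub>Q n\<^esub>" by auto
    obtain y where y: "y \<in> carrier M" "z = pow_sub (Suc n) +>\<^bsub>M\<^esub> y" using Q_rep[OF z(1)] by blast
    have "y \<in> pow_sub n"
      using z(2) y quot_proj_pow[of n "Suc n" y] M.quot_eq_zero_iff[OF pow_sub_submodule y(1), of n]
        M.quot_zero[OF pow_sub_submodule, of n] by (simp add: Q_eq)
    moreover have "r \<odot>\<^bsub>M\<^esub> x \<in> pow_sub 1" if x: "x \<in> carrier M" for x
    proof -
      have "pow_sub 1 +>\<^bsub>M\<^esub> x \<in> carrier (Q 1)"
        unfolding Q_eq M.quot_carrier[OF pow_sub_submodule] using x by blast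
      from kill[OF this] have "pow_sub 1 +>\<^bsub>M\<^esub> (r \<odot>\<^bsub>M\<^esub> x) = pow_sub 1"
        unfolding Q_eq M.quot_smult[OF pow_sub_submodule r x] M.quot_zero[OF pow_sub_submodule] .
      then show ?thesis using M.quot_eq_zero_iff[OF pow_sub_submodule] r x by blast
    qed
    ultimately have "r \<odot>\<^bsub>M\<^esub> y \<in> pow_sub (Suc n)" using r by (intro pow_sub_Suc)
    then have "r \<odot>\<^bsub>Q (Suc n)\<^esub> z = \<zero>\<^bsub>Q (Suc n)\<^esub>"
      using M.quot_eq_zero_iff[OF pow_sub_submodule, of "r \<odot>\<^bsub>M\<^esub> y" "Suc n"] y r
      by (simp add: Q_eq M.quot_smult[OF pow_sub_submodule] M.quot_zero[OF pow_sub_submodule])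
    then show "r \<odot>\<^bsub>submod (Q (Suc n)) ?K\<^esub> z = \<zero>\<^bsub>submod (Q (Suc n)) ?K\<^esub>" by simp
  qed
  then show ?case using ES.below_extension[OF Q_surjection[of n "Suc n"]] Suc.IH by simp
qed

text \<open>
  For the implication from left to right, a class in \<open>Ext\<^sup>t(M/IM, N)\<close> that dies in \<open>Ext\<^sup>t(M/I\<^sup>kM, N)\<close>
  comes from \<open>Ext\<^sup>t\<^sup>-\<^sup>1(IM/I\<^sup>kM, N)\<close>, which is torsion because \<open>IM/I\<^sup>kM\<close> is killed by the
  annihilator of \<open>M/I\<^sup>kM\<close>.
\<close>

lemma local_cohomology_torsion_iff:
  "(\<forall>j<t. \<forall>n. \<forall>u\<in>carrier (Ext R (Q n) N j). \<exists>s\<in>S. \<exists>k\<ge>n.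
      Ext_map R (Q k) (quot_proj M (pow_sub n)) N j (s \<odot>\<^bsub>Ext R (Q n) N j\<^esub> u) = \<zero>\<^bsub>Ext R (Q k) N j\<^esub>)
    \<longleftrightarrow> ES.below (Q 1) t"
  (is "(\<forall>j<t. ?null j) \<longleftrightarrow> _")
proof
  note S = submonoid.subset[OF ES.S] submonoid.m_closed[OF ES.S]
  show "\<forall>j<t. ?null j" if b: "ES.below (Q 1) t"
  proof (intro allI impI ballI)
    fix j n u assume j: "j < t" and u: "u \<in> carrier (Ext R (Q n) N j)"
    have "ext_torsion R S (Q n) N j" using below_Q[OF b] j by (simp add: ES.below_def)
    then obtain s where s: "s \<in> S" "s \<odot>\<^bsub>Ext R (Q n) N j\<^esub> u = \<zero>\<^bsub>Ext R (Q n) N j\<^esub>"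
      using ext_torsion_iff[OF module_Q modN S(1)] u by blast
    \<comment> \<open>The Ext module at stage \<open>n\<close> is itself torsion, so no passage to a
      later stage is needed and \<open>k = n\<close>.\<close>
    then show "\<exists>s\<in>S. \<exists>k\<ge>n. Ext_map R (Q k) (quot_proj M (pow_sub n)) N j (s \<odot>\<^bsub>Ext R (Q n) N j\<^esub> u) =
        \<zero>\<^bsub>Ext R (Q k) N j\<^esub>"
      using coh.id[OF coh.zero_closed'] by (intro bexI[OF _ s(1)] exI[of _ n]) simp
  qed
  show "ES.below (Q 1) t" if null: "\<forall>j<t. ?null j"
    using null
  proof (induction t)
    case (Suc t)
    \<comment> \<open>The lower degrees, known by induction, make every \<open>Q k\<close> torsion
      below \<open>t\<close>, and with it the kernel of the map from \<open>Q k\<close> to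
      \<open>Q 1\<close>; \<open>ext_torsion_connecting\<close> requires this in degree
      \<open>t - 1\<close>.\<close>
    then have b: "ES.below (Q 1) t" by simp
    have "ext_torsion R S (Q 1) N t"
      unfolding ext_torsion_iff[OF module_Q modN S(1)]
    proof
      fix u assume u: "u \<in> carrier (Ext R (Q 1) N t)"
      then obtain f where f: "f \<in> Ext_cocycles R (Q 1) N t" "u = Ext_class R (Q 1) N t f"
        unfolding Ext_carrier[OF module_Q modN] by blast
      obtain s k where s: "s \<in> S" "1 \<le> k"
        "Ext_map R (Q k) (quot_proj M (pow_sub 1)) N t (s \<odot>\<^bsub>Ext R (Q 1) N t\<^esub> u) = \<zero>\<^bsub>Ext R (Q k) N t\<^esub>"
        using Suc.prems u by blast
      have sc: "s \<in> carrier R" using s S by auto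
      let ?sf = "\<lambda>x\<in>carrier (free_res R (Q 1) t). s \<odot>\<^bsub>N\<^esub> f x"
      have sf: "?sf \<in> Ext_cocycles R (Q 1) N t"
        by (rule cocycles_smult[OF module_Q modN sc f(1)])
      interpret surj: module_surjection R "Q k" "Q 1" "quot_proj M (pow_sub 1)"
        by (rule Q_surjection[OF s(2)])
      have K: "submodule {z \<in> carrier (Q k). quot_proj M (pow_sub 1) z = \<zero>\<^bsub>Q 1\<^esub>} R (Q k)"
        by (rule submodule_ker[OF module_Q module_Q Q_lin[OF s(2)]])
      have "ES.below surj.Ker t"
        unfolding surj.Ker_def
        by (rule ES.below_transfer[OF module_Q fg_Q below_Q[OF b, of k] module_submod[OF module_Q K]
              fg_submodule[OF ES.noeth module_Q fg_Q K]]) auto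
      moreover have "ext_coboundary R (Q k) N t (\<lambda>z. ?sf (res_map R (quot_proj M (pow_sub 1)) z))"
        using s(3)
        unfolding f(2) Ext_class_smult[OF module_Q modN sc f(1)]
          Ext_map_class[OF module_Q module_Q modN Q_lin[OF s(2)] sf]
          Ext_class_zero_iff[OF module_Q modN
            cocycle_pullback[OF module_Q module_Q modN Q_lin[OF s(2)] sf]]
          coboundary_restrict[OF module_Q modN] .
      ultimately obtain s' where s': "s' \<in> S"
        "ext_coboundary R (Q 1) N t (\<lambda>z. s' \<odot>\<^bsub>N\<^esub> ?sf z)"
        using surj.ext_torsion_connecting[OF modN ES.S, of t ?sf] sf
        unfolding Ext_cocycles_iff ES.below_def by blast
      have s'c: "s' \<in> carrier R" using s' S by auto
      note coh_mod = module_Ext[OF module_Q modN, of 1 t]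
      have "s' \<odot>\<^bsub>Ext R (Q 1) N t\<^esub> (s \<odot>\<^bsub>Ext R (Q 1) N t\<^esub> u) = \<zero>\<^bsub>Ext R (Q 1) N t\<^esub>"
        unfolding f(2) Ext_class_smult[OF module_Q modN sc f(1)]
          Ext_class_smult_zero_iff[OF module_Q modN s'c sf] by (rule s'(2))
      then have "(s' \<otimes> s) \<odot>\<^bsub>Ext R (Q 1) N t\<^esub> u = \<zero>\<^bsub>Ext R (Q 1) N t\<^esub>"
        using module.smult_assoc1[OF coh_mod s'c sc u] by simp
      then show "\<exists>s\<in>S. s \<odot>\<^bsub>Ext R (Q 1) N t\<^esub> u = \<zero>\<^bsub>Ext R (Q 1) N t\<^esub>"
        using S(2)[OF s'(1) s(1)] by blast
    qed
    then show ?case using b by (auto simp: ES.below_def less_Suc_eq)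
  qed (simp add: ES.below_0)
qed

end

end

theorem lemma2p8:
  fixes R :: "('r, 'x) ring_scheme"
    and \<mm> I :: "'r set"
    and M :: "('r, 'm, 'y) module_scheme"
    and N :: "('r, 'n, 'z) module_scheme"
    and i :: enat
  assumes "local_ring R \<mm>"
    and "noetherian_ring R"
    and "ideal I R"
    and "module R M" and "fin_gen_module R M"
    and "module R N" and "fin_gen_module R N"
    and "0 < i"
  shows "(\<Union>j\<in>{j::nat. enat j < i}. Supp R (gen_local_cohomology R I M N j)) =
         (\<Union>j\<in>{j::nat. enat j < i}. Supp R (Ext R (quot_module M (ideal_times_module R I M)) N j))"
proof -
  interpret M: module R M by fact
  interpret adic_setting R M N I
    by (intro adic_setting.intro adic_setting_axioms.intro M.is_cring assms(3,4,6))
  have fgM: "fg R M" by (rule M.fin_gen_imp_fg[OF assms(5)])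
  let ?Q = "quot_module M (ideal_times_module R I M)"
  have Q1: "?Q = Q 1" by (simp only: Q_eq pow_sub_1)
  \<comment> \<open>For a prime and a finite bound \<open>t\<close>, both sides are negated: no
    degree below \<open>t\<close> contributes exactly when Ext of M/IM is torsion in all degrees
    below \<open>t\<close>.\<close>
  have first: "(\<exists>j<t. \<pp> \<in> Supp R (gen_local_cohomology R I M N j)) \<longleftrightarrow> (\<exists>j<t. \<pp> \<in> Supp R (Ext R ?Q N j))"
    for \<pp> and t :: nat
  proof (cases "primeideal \<pp> R")
    case True
    then have ES: "ext_setting R N (carrier R - \<pp>)"
      by (intro ext_setting.intro ext_setting_axioms.intro M.is_cring assms(2,6) primeideal.compl_submonoid)
    show ?thesis
      using local_cohomology_torsion_iff[OF ES fgM, of t] True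
      unfolding Q1 Supp_local_cohomology_iff M.Supp_Ext_iff[OF module_Q assms(6)] ext_setting.below_def[OF ES]
      by blast
  qed (simp add: Supp_def)
  have "(\<exists>j. enat j < i \<and> a j) \<longleftrightarrow> (\<exists>j. enat j < i \<and> b j)"
    if ab: "\<And>t::nat. (\<exists>j<t. a j) \<longleftrightarrow> (\<exists>j<t. b j)" for a b :: "nat \<Rightarrow> bool"
  proof -
    \<comment> \<open>A witness \<open>j\<close> is tested with the finite bound
      \<open>Suc j\<close>, which returns some \<open>k <= j < i\<close>; this treats infinite
      \<open>i\<close> as well.\<close>
    have *: "\<exists>j. enat j < i \<and> b j"
      if imp: "\<And>t::nat. (\<exists>j<t. a j) \<Longrightarrow> (\<exists>j<t. b j)" and "enat j < i" "a j" for a b j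
    proof -
      obtain k where "k < Suc j" "b k" using \<open>a j\<close> imp[of "Suc j"] by auto
      then show ?thesis using \<open>enat j < i\<close> by (meson enat_ord_simps(1) le_less_trans less_Suc_eq_le)
    qed
    show ?thesis using *[of a b] *[of b a] ab by blast
  qed
  from this[OF first] show ?thesis by (auto simp: set_eq_iff)
qed

end
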